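(* Let $A,B,P$ be finitely generated groups with $A\le P$, and let $G=P\ast_A(A\times B)$ be the amalgamated product over $A$. Assume that the word problems of $P$ and of $B$ are solvable in deterministic logarithmic space, and that the membership problem for $A$ in $P$ (given a word over generators of $P$, decide whether the element it represents lies in $A$) is solvable in deterministic logarithmic space. Then the word problem of $G$ is solvable in deterministic logarithmic space.
   Context: The word problem of a finitely generated group asks, given a word over a finite symmetric generating set, whether it represents the identity. Here $A\times B$ contains $A$ as the first factor and the amalgamation identifies this copy of $A$ with the subgroup $A\le P$. *)

theory Defs
  imports "HOL-Algebra.Algebra" "HOL-Library.Landau_Symbols"
begin

section \<open>Deterministic logarithmic space\<close>

text \<open>
  Deterministic Turing machines with a two-way read-only input tape, delimited by end markers, and
  finitely many read-write work tapes. Work tapes are infinite to the right. States and work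
  symbols are natural numbers below a fixed bound, and the work symbol 0 is the blank.
\<close>

datatype dir = MoveL | Stay | MoveR

datatype 'a in_sym = LeftEnd | Letter 'a | RightEnd

record 'a machine =
  num_states :: nat
  num_symbols :: nat
  num_tapes :: nat
  start_state :: nat
  accept_state :: nat
  reject_state :: nat
  transition :: "nat \<Rightarrow> 'a in_sym \<Rightarrow> nat list \<Rightarrow> nat \<times> dir \<times> (nat \<times> dir) list"

definition in_syms :: "'a set \<Rightarrow> 'a in_sym set" where
  "in_syms \<Sigma> = insert LeftEnd (insert RightEnd (Letter ` \<Sigma>))"

definition machine_over :: "'a set \<Rightarrow> 'a machine \<Rightarrow> bool" where
  "machine_over \<Sigma> M \<longleftrightarrow>
     finite \<Sigma> \<and> 0 < num_symbols M \<and>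
     start_state M < num_states M \<and> accept_state M < num_states M \<and>
     reject_state M < num_states M \<and> accept_state M \<noteq> reject_state M \<and>
     (\<forall>q < num_states M. \<forall>x \<in> in_syms \<Sigma>. \<forall>ys. length ys = num_tapes M \<and> set ys \<subseteq> {..<num_symbols M} \<longrightarrow>
        (case transition M q x ys of (q', d, acts) \<Rightarrow>
           q' < num_states M \<and> length acts = num_tapes M \<and> fst ` set acts \<subseteq> {..<num_symbols M}))"

text \<open>A work tape is given by its contents and the position of its head.\<close>

type_synonym work_tape = "(nat \<Rightarrow> nat) \<times> nat"

record config =
  state :: nat
  in_pos :: nat
  work :: "work_tape list"

definition init_config :: "'a machine \<Rightarrow> config" where
  "init_config M = \<lparr>state = start_state M, in_pos = 0, work = replicate (num_tapes M) (\<lambda>_. 0, 0)\<rparr>"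

definition in_read :: "'a list \<Rightarrow> nat \<Rightarrow> 'a in_sym" where
  "in_read w p = (if p = 0 then LeftEnd else if p \<le> length w then Letter (w ! (p - 1)) else RightEnd)"

text \<open>A head at the left end of its tape stays there when told to move left.\<close>

fun shift :: "dir \<Rightarrow> nat \<Rightarrow> nat" where
  "shift MoveL p = p - 1"
| "shift Stay p = p"
| "shift MoveR p = Suc p"

definition act_tape :: "nat \<times> dir \<Rightarrow> work_tape \<Rightarrow> work_tape" where
  "act_tape = (\<lambda>(y, d) (c, h). (c(h := y), shift d h))"

definition step :: "'a machine \<Rightarrow> 'a list \<Rightarrow> config \<Rightarrow> config" where
  "step M w c =
     (if state c \<in> {accept_state M, reject_state M} then c
      else case transition M (state c) (in_read w (in_pos c)) (map (\<lambda>(t, h). t h) (work c)) of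
        (q, d, acts) \<Rightarrow>
          \<lparr>state = q, in_pos = min (shift d (in_pos c)) (Suc (length w)),
           work = map2 act_tape acts (work c)\<rparr>)"

definition run :: "'a machine \<Rightarrow> 'a list \<Rightarrow> nat \<Rightarrow> config" where
  "run M w t = (step M w ^^ t) (init_config M)"

definition decides :: "'a machine \<Rightarrow> 'a set \<Rightarrow> 'a list set \<Rightarrow> bool" where
  "decides M \<Sigma> L \<longleftrightarrow>
     (\<forall>w \<in> lists \<Sigma>. \<exists>t. state (run M w t) = (if w \<in> L then accept_state M else reject_state M))"

text \<open>
  The space used is measured per tape; as the number of tapes is fixed for each machine, the
  total over all tapes differs from this at most by a constant factor.
\<close>

definition runs_in_space :: "'a machine \<Rightarrow> 'a list \<Rightarrow> nat \<Rightarrow> bool" where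
  "runs_in_space M w m \<longleftrightarrow> (\<forall>t. \<forall>(c, h) \<in> set (work (run M w t)). h < m)"

definition in_logspace :: "'a set \<Rightarrow> 'a list set \<Rightarrow> bool" where
  "in_logspace \<Sigma> L \<longleftrightarrow>
     (\<exists>M s. machine_over \<Sigma> M \<and> decides M \<Sigma> L \<and>
        (\<forall>w \<in> lists \<Sigma>. runs_in_space M w (s (length w))) \<and>
        (\<lambda>n. real (s n)) \<in> O(\<lambda>n. ln (real n)))"


section \<open>Word and membership problems\<close>

definition finitely_generated :: "('g, 'm) monoid_scheme \<Rightarrow> bool" where
  "finitely_generated G \<longleftrightarrow> (\<exists>S. finite S \<and> S \<subseteq> carrier G \<and> generate G S = carrier G)"

definition sym_gen_set :: "('g, 'm) monoid_scheme \<Rightarrow> 'g set \<Rightarrow> bool" where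
  "sym_gen_set G S \<longleftrightarrow>
     finite S \<and> S \<subseteq> carrier G \<and> (\<forall>x \<in> S. inv\<^bsub>G\<^esub> x \<in> S) \<and> generate G S = carrier G"

definition word_value :: "('g, 'm) monoid_scheme \<Rightarrow> 'g list \<Rightarrow> 'g" where
  "word_value G w = foldr (\<otimes>\<^bsub>G\<^esub>) w \<one>\<^bsub>G\<^esub>"

definition word_problem :: "('g, 'm) monoid_scheme \<Rightarrow> 'g set \<Rightarrow> 'g list set" where
  "word_problem G S = {w \<in> lists S. word_value G w = \<one>\<^bsub>G\<^esub>}"

definition membership_problem :: "('g, 'm) monoid_scheme \<Rightarrow> 'g set \<Rightarrow> 'g set \<Rightarrow> 'g list set" where
  "membership_problem G A S = {w \<in> lists S. word_value G w \<in> A}"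


section \<open>Amalgamated products\<close>

text \<open>
  The amalgamated product of \<open>G\<^sub>1\<close> and \<open>G\<^sub>2\<close> along maps \<open>i : H \<rightarrow> G\<^sub>1\<close> and \<open>j : H \<rightarrow> G\<^sub>2\<close>: words over
  the disjoint union of the carriers modulo the least congruence that contains the multiplication
  tables of both factors and identifies \<open>i h\<close> with \<open>j h\<close>. Only the underlying set of \<open>H\<close> matters.
\<close>

definition amalg_words :: "('a, 'm) monoid_scheme \<Rightarrow> ('b, 'n) monoid_scheme \<Rightarrow> ('a + 'b) list set" where
  "amalg_words G1 G2 = lists (carrier G1 <+> carrier G2)"

inductive amalg_eq ::
  "('a, 'm) monoid_scheme \<Rightarrow> ('b, 'n) monoid_scheme \<Rightarrow> 'h set \<Rightarrow> ('h \<Rightarrow> 'a) \<Rightarrow> ('h \<Rightarrow> 'b) \<Rightarrow>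
   ('a + 'b) list \<Rightarrow> ('a + 'b) list \<Rightarrow> bool"
  for G1 G2 H i j where
  refl: "w \<in> amalg_words G1 G2 \<Longrightarrow> amalg_eq G1 G2 H i j w w"
| sym: "amalg_eq G1 G2 H i j u v \<Longrightarrow> amalg_eq G1 G2 H i j v u"
| trans: "amalg_eq G1 G2 H i j u v \<Longrightarrow> amalg_eq G1 G2 H i j v w \<Longrightarrow> amalg_eq G1 G2 H i j u w"
| append: "amalg_eq G1 G2 H i j u u' \<Longrightarrow> amalg_eq G1 G2 H i j v v' \<Longrightarrow>
    amalg_eq G1 G2 H i j (u @ v) (u' @ v')"
| one1: "amalg_eq G1 G2 H i j [Inl \<one>\<^bsub>G1\<^esub>] []"
| one2: "amalg_eq G1 G2 H i j [Inr \<one>\<^bsub>G2\<^esub>] []"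
| mult1: "x \<in> carrier G1 \<Longrightarrow> y \<in> carrier G1 \<Longrightarrow>
    amalg_eq G1 G2 H i j [Inl x, Inl y] [Inl (x \<otimes>\<^bsub>G1\<^esub> y)]"
| mult2: "x \<in> carrier G2 \<Longrightarrow> y \<in> carrier G2 \<Longrightarrow>
    amalg_eq G1 G2 H i j [Inr x, Inr y] [Inr (x \<otimes>\<^bsub>G2\<^esub> y)]"
| glue: "h \<in> H \<Longrightarrow> amalg_eq G1 G2 H i j [Inl (i h)] [Inr (j h)]"

definition amalg_rel ::
  "('a, 'm) monoid_scheme \<Rightarrow> ('b, 'n) monoid_scheme \<Rightarrow> 'h set \<Rightarrow> ('h \<Rightarrow> 'a) \<Rightarrow> ('h \<Rightarrow> 'b) \<Rightarrow>
   (('a + 'b) list \<times> ('a + 'b) list) set" where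
  "amalg_rel G1 G2 H i j = {(u, v). amalg_eq G1 G2 H i j u v}"

definition amalg_prod ::
  "('a, 'm) monoid_scheme \<Rightarrow> ('b, 'n) monoid_scheme \<Rightarrow> 'h set \<Rightarrow> ('h \<Rightarrow> 'a) \<Rightarrow> ('h \<Rightarrow> 'b) \<Rightarrow>
   ('a + 'b) list set monoid" where
  "amalg_prod G1 G2 H i j =
     \<lparr>carrier = amalg_words G1 G2 // amalg_rel G1 G2 H i j,
      monoid.mult = (\<lambda>U V. \<Union>u \<in> U. \<Union>v \<in> V. amalg_rel G1 G2 H i j `` {u @ v}),
      one = amalg_rel G1 G2 H i j `` {[]}\<rparr>"

text \<open>
  The group \<open>P *\<^sub>A (A \<times> B)\<close>, where \<open>a \<in> A \<subseteq> P\<close> is identified with \<open>(a, 1)\<close>.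
\<close>

definition amalg_direct ::
  "('p, 'm) monoid_scheme \<Rightarrow> 'p set \<Rightarrow> ('b, 'n) monoid_scheme \<Rightarrow> ('p + 'p \<times> 'b) list set monoid" where
  "amalg_direct P A B =
     amalg_prod P (P\<lparr>carrier := A\<rparr> \<times>\<times> B) A (\<lambda>a. a) (\<lambda>a. (a, \<one>\<^bsub>B\<^esub>))"


subsection \<open>Group structure and universal property\<close>

locale amalgam = G1: group G1 + G2: group G2
  for G1 :: "('a, 'm) monoid_scheme" and G2 :: "('b, 'n) monoid_scheme" +
  fixes H :: "'h set" and i :: "'h \<Rightarrow> 'a" and j :: "'h \<Rightarrow> 'b"
  assumes i_closed: "h \<in> H \<Longrightarrow> i h \<in> carrier G1"
    and j_closed: "h \<in> H \<Longrightarrow> j h \<in> carrier G2"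
begin

abbreviation "W \<equiv> amalg_words G1 G2"
abbreviation "E \<equiv> amalg_eq G1 G2 H i j"
abbreviation "R \<equiv> amalg_rel G1 G2 H i j"
abbreviation "Q \<equiv> amalg_prod G1 G2 H i j"

lemma W_simps [simp]:
  "[] \<in> W" "Inl x # w \<in> W \<longleftrightarrow> x \<in> carrier G1 \<and> w \<in> W" "Inr y # w \<in> W \<longleftrightarrow> y \<in> carrier G2 \<and> w \<in> W"
  "u @ v \<in> W \<longleftrightarrow> u \<in> W \<and> v \<in> W"
  by (auto simp: amalg_words_def)

lemma E_words: "E u v \<Longrightarrow> u \<in> W \<and> v \<in> W"
  by (induction rule: amalg_eq.induct) (auto simp: i_closed j_closed)

lemma equiv_R: "equiv W R"
  by (intro equivI refl_onI symI transI)
    (auto simp: amalg_rel_def E_words intro: amalg_eq.refl amalg_eq.sym amalg_eq.trans)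

lemma class_eq_iff: "u \<in> W \<Longrightarrow> v \<in> W \<Longrightarrow> R `` {u} = R `` {v} \<longleftrightarrow> E u v"
  using eq_equiv_class_iff[OF equiv_R, of u v] by (simp add: amalg_rel_def)

lemma class_closed: "u \<in> W \<Longrightarrow> R `` {u} \<in> carrier Q"
  by (simp add: amalg_prod_def quotientI)

lemma carrier_cases:
  assumes "U \<in> carrier Q" obtains u where "u \<in> W" "U = R `` {u}"
  using assms by (auto simp: amalg_prod_def elim: quotientE)

lemma one_class: "\<one>\<^bsub>Q\<^esub> = R `` {[]}"
  by (simp add: amalg_prod_def)

lemma mult_class:
  assumes "u \<in> W" "v \<in> W" shows "R `` {u} \<otimes>\<^bsub>Q\<^esub> R `` {v} = R `` {u @ v}"
proof -
  have "congruent2 R R (\<lambda>u v. R `` {u @ v})"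
  proof (rule congruent2I')
    fix u u' v v' assume "(u, u') \<in> R" "(v, v') \<in> R"
    then have "(u @ v, u' @ v') \<in> R" by (simp add: amalg_rel_def amalg_eq.append)
    then show "R `` {u @ v} = R `` {u' @ v'}" by (rule equiv_class_eq[OF equiv_R])
  qed
  from UN_equiv_class2[OF equiv_R equiv_R this assms] show ?thesis
    by (simp add: amalg_prod_def)
qed

definition inv_letter :: "'a + 'b \<Rightarrow> 'a + 'b" where
  "inv_letter = map_sum (m_inv G1) (m_inv G2)"

lemma left_inverse: "w \<in> W \<Longrightarrow> rev (map inv_letter w) \<in> W \<and> E (rev (map inv_letter w) @ w) []"
proof (induction w)
  case Nil
  then show ?case by (simp add: amalg_eq.refl)
next
  case (Cons a w)
  let ?v = "rev (map inv_letter w)"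
  have w: "w \<in> W" using Cons.prems by (auto simp: amalg_words_def)
  have v: "?v \<in> W" and vw: "E (?v @ w) []" using Cons.IH[OF w] by auto
  have a: "[a] \<in> W" using Cons.prems by (auto simp: amalg_words_def)
  have ia: "[inv_letter a] \<in> W" using a by (cases a) (auto simp: inv_letter_def)
  have "E [inv_letter a, a] []"
  proof (cases a)
    case (Inl x)
    then show ?thesis
      using amalg_eq.trans[OF amalg_eq.mult1[of "inv\<^bsub>G1\<^esub> x" G1 x], of G2 H i j "[]"] a
      by (simp add: inv_letter_def amalg_eq.one1)
  next
    case (Inr x)
    then show ?thesis
      using amalg_eq.trans[OF amalg_eq.mult2[of "inv\<^bsub>G2\<^esub> x" G2 x], of G1 H i j "[]"] a
      by (simp add: inv_letter_def amalg_eq.one2)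
  qed
  then have "E (?v @ ([inv_letter a, a] @ w)) (?v @ ([] @ w))"
    by (intro amalg_eq.append amalg_eq.refl v w)
  then have "E (?v @ [inv_letter a, a] @ w) []"
    using amalg_eq.trans[OF _ vw] by simp
  then show ?case using v ia by simp
qed

sublocale Q: group Q
proof (rule groupI)
  fix U V assume "U \<in> carrier Q" "V \<in> carrier Q"
  then show "U \<otimes>\<^bsub>Q\<^esub> V \<in> carrier Q"
    by (elim carrier_cases) (simp add: mult_class class_closed)
next
  show "\<one>\<^bsub>Q\<^esub> \<in> carrier Q" by (simp add: one_class class_closed)
next
  fix U V Z assume "U \<in> carrier Q" "V \<in> carrier Q" "Z \<in> carrier Q"
  then show "U \<otimes>\<^bsub>Q\<^esub> V \<otimes>\<^bsub>Q\<^esub> Z = U \<otimes>\<^bsub>Q\<^esub> (V \<otimes>\<^bsub>Q\<^esub> Z)"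
    by (elim carrier_cases) (simp add: mult_class)
next
  fix U assume "U \<in> carrier Q"
  then show "\<one>\<^bsub>Q\<^esub> \<otimes>\<^bsub>Q\<^esub> U = U"
    by (elim carrier_cases) (simp add: mult_class one_class)
next
  fix U assume "U \<in> carrier Q"
  then obtain u where u: "u \<in> W" "U = R `` {u}" by (rule carrier_cases)
  let ?v = "rev (map inv_letter u)"
  have "R `` {?v} \<otimes>\<^bsub>Q\<^esub> U = \<one>\<^bsub>Q\<^esub>"
    using u left_inverse[OF u(1)] by (simp add: mult_class one_class class_eq_iff)
  then show "\<exists>V \<in> carrier Q. V \<otimes>\<^bsub>Q\<^esub> U = \<one>\<^bsub>Q\<^esub>"
    using left_inverse[OF u(1)] class_closed by blast
qed

definition inj1 :: "'a \<Rightarrow> ('a + 'b) list set" where "inj1 x = R `` {[Inl x]}"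
definition inj2 :: "'b \<Rightarrow> ('a + 'b) list set" where "inj2 y = R `` {[Inr y]}"

lemma inj1_hom: "inj1 \<in> hom G1 Q"
  by (rule homI) (auto simp: inj1_def class_closed mult_class class_eq_iff intro: amalg_eq.sym[OF amalg_eq.mult1])

lemma inj2_hom: "inj2 \<in> hom G2 Q"
  by (rule homI) (auto simp: inj2_def class_closed mult_class class_eq_iff intro: amalg_eq.sym[OF amalg_eq.mult2])

lemma inj_glue: "h \<in> H \<Longrightarrow> inj1 (i h) = inj2 (j h)"
  by (simp add: inj1_def inj2_def class_eq_iff i_closed j_closed amalg_eq.glue)

lemma universal_property:
  assumes "group K" and f: "f \<in> hom G1 K" and g: "g \<in> hom G2 K"
    and glue: "\<And>h. h \<in> H \<Longrightarrow> f (i h) = g (j h)"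
  shows "\<exists>\<phi> \<in> hom Q K. (\<forall>x \<in> carrier G1. \<phi> (inj1 x) = f x) \<and> (\<forall>y \<in> carrier G2. \<phi> (inj2 y) = g y) \<and>
    (\<forall>\<psi> \<in> hom Q K. (\<forall>x \<in> carrier G1. \<psi> (inj1 x) = f x) \<and> (\<forall>y \<in> carrier G2. \<psi> (inj2 y) = g y) \<longrightarrow>
       (\<forall>U \<in> carrier Q. \<psi> U = \<phi> U))"
proof -
  interpret K: group K by fact
  define val where "val w = foldr (\<otimes>\<^bsub>K\<^esub>) (map (case_sum f g) w) \<one>\<^bsub>K\<^esub>" for w
  have fc: "f x \<in> carrier K" if "x \<in> carrier G1" for x using f that by (auto simp: hom_def)
  have gc: "g x \<in> carrier K" if "x \<in> carrier G2" for x using g that by (auto simp: hom_def)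
  have val_simps [simp]: "val [] = \<one>\<^bsub>K\<^esub>" "val (Inl x # w) = f x \<otimes>\<^bsub>K\<^esub> val w"
    "val (Inr y # w) = g y \<otimes>\<^bsub>K\<^esub> val w" for x y w by (simp_all add: val_def)
  have val_closed [simp]: "val w \<in> carrier K" if "w \<in> W" for w
    using that
  proof (induction w)
    case (Cons a w)
    then show ?case by (cases a) (simp_all add: fc gc)
  qed simp
  have val_app: "val (u @ v) = val u \<otimes>\<^bsub>K\<^esub> val v" if "u \<in> W" "v \<in> W" for u v
    using that(1)
  proof (induction u)
    case (Cons a u)
    then show ?case using that(2) by (cases a) (simp_all add: K.m_assoc fc gc)
  qed (simp add: that)
  have f1: "f \<one>\<^bsub>G1\<^esub> = \<one>\<^bsub>K\<^esub>" using f by (intro hom_one) auto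
  have g1: "g \<one>\<^bsub>G2\<^esub> = \<one>\<^bsub>K\<^esub>" using g by (intro hom_one) auto
  have val_cong: "E u v \<Longrightarrow> val u = val v" for u v
  proof (induction rule: amalg_eq.induct)
    case (append u u' v v')
    then show ?case by (metis E_words val_app)
  next
    case (mult1 x y)
    then show ?case using f by (simp add: hom_mult fc)
  next
    case (mult2 x y)
    then show ?case using g by (simp add: hom_mult gc)
  next
    case (glue h)
    then show ?case by (simp add: assms(4) gc j_closed)
  qed (simp_all add: f1 g1)
  define \<phi> where "\<phi> U = val (SOME u. u \<in> U)" for U
  have phi: "\<phi> (R `` {u}) = val u" if "u \<in> W" for u
  proof -
    have "E u (SOME v. v \<in> R `` {u})"
      using someI[of "\<lambda>v. v \<in> R `` {u}" u] amalg_eq.refl[OF that] by (auto simp: amalg_rel_def)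
    then show ?thesis using val_cong by (simp add: \<phi>_def)
  qed
  have hom: "\<phi> \<in> hom Q K"
    by (rule homI) (auto elim!: carrier_cases simp: phi mult_class val_app)
  have uniq: "\<psi> (R `` {u}) = val u"
    if psi: "\<psi> \<in> hom Q K" "\<forall>x \<in> carrier G1. \<psi> (inj1 x) = f x" "\<forall>y \<in> carrier G2. \<psi> (inj2 y) = g y"
      and "u \<in> W" for \<psi> u
    using \<open>u \<in> W\<close>
  proof (induction u)
    case Nil
    then show ?case using hom_one[OF psi(1) Q.group_axioms \<open>group K\<close>] by (simp add: one_class)
  next
    case (Cons a u)
    have u: "u \<in> W" and a: "[a] \<in> W" using Cons.prems by (cases a; simp)+
    have "\<psi> (R `` {a # u}) = \<psi> (R `` {[a]}) \<otimes>\<^bsub>K\<^esub> val u"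
      using hom_mult[OF psi(1) class_closed[OF a] class_closed[OF u]] Cons.IH[OF u]
      by (simp add: mult_class a u)
    then show ?case using psi(2,3) Cons.prems by (cases a) (auto simp: inj1_def inj2_def)
  qed
  show ?thesis
  proof (intro bexI[OF _ hom] conjI ballI impI)
    fix x assume "x \<in> carrier G1"
    then show "\<phi> (inj1 x) = f x" by (simp add: inj1_def phi fc)
  next
    fix y assume "y \<in> carrier G2"
    then show "\<phi> (inj2 y) = g y" by (simp add: inj2_def phi gc)
  next
    fix \<psi> U
    assume psi: "\<psi> \<in> hom Q K"
      "(\<forall>x \<in> carrier G1. \<psi> (inj1 x) = f x) \<and> (\<forall>y \<in> carrier G2. \<psi> (inj2 y) = g y)"
      and "U \<in> carrier Q"
    then obtain u where u: "u \<in> W" "U = R `` {u}" by (elim carrier_cases)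
    show "\<psi> U = \<phi> U" unfolding u(2) using psi by (simp only: phi[OF u(1)]) (intro uniq u(1); simp)
  qed
qed

end

lemma amalgam_direct:
  assumes "group P" "group B" "subgroup A P"
  shows "amalgam P (P\<lparr>carrier := A\<rparr> \<times>\<times> B) A (\<lambda>a. a) (\<lambda>a. (a, \<one>\<^bsub>B\<^esub>))"
proof -
  have "group (P\<lparr>carrier := A\<rparr>)"
    using assms by (simp add: subgroup.subgroup_is_group)
  then have "group (P\<lparr>carrier := A\<rparr> \<times>\<times> B)"
    using assms(2) by (rule DirProd_group)
  then show ?thesis
    using assms subgroup.subset[OF assms(3)]
    by (auto simp: amalgam_def amalgam_axioms_def monoid.one_closed group.is_monoid)
qed

lemma group_amalg_direct:
  assumes "group P" "group B" "subgroup A P"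
  shows "group (amalg_direct P A B)"
proof -
  interpret amalgam P "P\<lparr>carrier := A\<rparr> \<times>\<times> B" A "\<lambda>a. a" "\<lambda>a. (a, \<one>\<^bsub>B\<^esub>)"
    using assms by (rule amalgam_direct)
  show ?thesis unfolding amalg_direct_def by (rule Q.group_axioms)
qed

end

theory Submission
  imports Defs
begin

text \<open>
  Writing a word of \<open>G = P *\<^sub>A (A \<times> B)\<close> as \<open>p\<^sub>1 b\<^sub>1 \<dots> p\<^sub>n b\<^sub>n\<close>, let \<open>\<pi>\<^sub>i = p\<^sub>1 \<dots> p\<^sub>i\<close> and \<open>\<beta>\<^sub>i = b\<^sub>1 \<dots> b\<^sub>i\<close>. The kernel
  of \<open>G \<rightarrow> P \<times> B\<close> is free, which leads to the following test. Number the cosets \<open>\<pi>\<^sub>i A\<close> by \<open>\<kappa>\<close> and the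
  elements \<open>\<beta>\<^sub>i\<close> by \<open>\<nu>\<close>, both by the position of first occurrence, and let the \<open>i\<close>-th syllable act on an
  integer vector by \<open>a\<^sup>-\<^sup>k b\<^sup>d a\<^sup>k\<close>, where \<open>k = \<kappa> (\<pi>\<^sub>i A)\<close>, \<open>d = \<nu> \<beta>\<^sub>i - \<nu> \<beta>\<^sub>i\<^sub>-\<^sub>1\<close>, and \<open>a\<close>, \<open>b\<close> are the two unipotent
  matrices generating a free group. The exponents telescope, so the action respects the relations
  of \<open>G\<close>, and by ping-pong a reduced word with at least one syllable moves \<open>(1, 0)\<close> off the first
  axis. Hence the word is trivial iff \<open>\<pi>\<^sub>n = 1\<close> and the second coordinate \<open>y\<close> of the image of \<open>(1, 0)\<close>
  vanishes. The numbers \<open>k\<close> and \<open>d\<close> are found by testing infixes of the word for membership in \<open>A\<close> and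
  for triviality in \<open>B\<close>. As \<open>y\<close> has polynomially many bits, it suffices to compute it modulo all \<open>m\<close> up
  to a polynomial bound, because the least common multiple of \<open>1, \<dots>, n + 1\<close> is at least \<open>2\<^sup>n\<close>.

  Logarithmic space is handled through functions with polynomially bounded values, which are
  closed under composition and bounded loops: such a function is implemented by counters stored in
  binary on work tapes, and conversely the tapes of a logarithmic space machine are encoded as
  polynomially bounded numbers, so that it can be simulated inside a larger computation.
\<close>

section \<open>Structured tape programs\<close>

text \<open>Deciding triviality by normal forms would mean storing a reduced word, so the test has
  to be a product evaluated from left to right. Killing \<open>B\<close> splits \<open>G\<close> as
  a semidirect product of \<open>P\<close> with a free product of copies of \<open>B\<close>, one
  for each coset in \<open>P/A\<close>; a syllable \<open>b\<close> read after the prefix \<pi> lies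
  in the copy belonging to \<open>\<pi>A\<close>. Matrices can separate the copies, but an arbitrary
  \<open>B\<close> has no integer representation. So a syllable contributes the exponent
  \<nu>(\<beta>b) - \<nu>(\<beta>), which depends on the current value \<beta> and telescopes for
  every function \<nu>. The numberings depend on the word and are injective only on the cosets and
  values that its prefixes reach. Hence invariance under the relations of \<open>G\<close> is proved
  for all \<kappa> and \<nu>, and the reduction to normal form has to be shown to visit no new coset
  or value. Numbering by first occurrence also keeps \<kappa> and \<nu> at most the length of the
  word, which is what bounds the matrix entries.\<close>

datatype 'a test = TapeTest nat "nat \<Rightarrow> bool" | HeadTest "'a in_sym \<Rightarrow> bool"

datatype 'a prog =
    Write nat "nat \<Rightarrow> nat \<times> dir"
  | Move dir
  | Seq "'a prog" "'a prog"  (infixr ";;" 60)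
  | Cond "'a test" "'a prog" "'a prog"
  | While "'a test" "'a prog"

type_synonym pstate = "nat \<times> (nat \<Rightarrow> work_tape)"

definition sym_at :: "work_tape \<Rightarrow> nat" where
  "sym_at = (\<lambda>(c, h). c h)"

fun holds :: "'a list \<Rightarrow> 'a test \<Rightarrow> pstate \<Rightarrow> bool" where
  "holds w (TapeTest r P) s = P (sym_at (snd s r))"
| "holds w (HeadTest P) s = P (in_read w (fst s))"

text \<open>Termination and space in one judgement: a derivation exists only for a terminating run
  in which every write leaves its head at a position at most \<open>m\<close>.\<close>

inductive exec :: "nat \<Rightarrow> 'a list \<Rightarrow> 'a prog \<Rightarrow> pstate \<Rightarrow> pstate \<Rightarrow> bool" for m w where
  Write: "T' = act_tape (f (sym_at (T r))) (T r) \<Longrightarrow> snd T' \<le> m \<Longrightarrow>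
    exec m w (Write r f) (p, T) (p, T(r := T'))"
| Move: "exec m w (Move d) (p, T) (min (shift d p) (Suc (length w)), T)"
| Seq: "exec m w c s s' \<Longrightarrow> exec m w d s' s'' \<Longrightarrow> exec m w (c ;; d) s s''"
| IfT: "holds w t s \<Longrightarrow> exec m w c s s' \<Longrightarrow> exec m w (Cond t c d) s s'"
| IfF: "\<not> holds w t s \<Longrightarrow> exec m w d s s' \<Longrightarrow> exec m w (Cond t c d) s s'"
| WhileF: "\<not> holds w t s \<Longrightarrow> exec m w (While t c) s s"
| WhileT: "holds w t s \<Longrightarrow> exec m w c s s' \<Longrightarrow> exec m w (While t c) s' s'' \<Longrightarrow>
    exec m w (While t c) s s''"

fun wf_test :: "nat \<Rightarrow> 'a test \<Rightarrow> bool" where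
  "wf_test N (TapeTest r P) \<longleftrightarrow> r < N"
| "wf_test N (HeadTest P) \<longleftrightarrow> True"

text \<open>The five symbols are the blank, the two digits and a marked copy of each digit.\<close>

fun wf_prog :: "nat \<Rightarrow> 'a prog \<Rightarrow> bool" where
  "wf_prog N (Write r f) \<longleftrightarrow> r < N \<and> (\<forall>y < 5. fst (f y) < 5)"
| "wf_prog N (Move d) \<longleftrightarrow> True"
| "wf_prog N (c ;; d) \<longleftrightarrow> wf_prog N c \<and> wf_prog N d"
| "wf_prog N (Cond t c d) \<longleftrightarrow> wf_test N t \<and> wf_prog N c \<and> wf_prog N d"
| "wf_prog N (While t c) \<longleftrightarrow> wf_test N t \<and> wf_prog N c"

type_synonym 'a instr = "'a in_sym \<Rightarrow> (nat \<Rightarrow> nat) \<Rightarrow> nat \<times> dir \<times> (nat \<Rightarrow> nat \<times> dir)"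

fun eval_test :: "'a test \<Rightarrow> 'a in_sym \<Rightarrow> (nat \<Rightarrow> nat) \<Rightarrow> bool" where
  "eval_test (TapeTest r P) x y = P (y r)"
| "eval_test (HeadTest P) x y = P x"

definition branch :: "'a test \<Rightarrow> nat \<Rightarrow> nat \<Rightarrow> 'a instr" where
  "branch t a b = (\<lambda>x y. (if eval_test t x y then a else b, Stay, \<lambda>i. (y i, Stay)))"

definition goto :: "nat \<Rightarrow> 'a instr" where
  "goto a = (\<lambda>x y. (a, Stay, \<lambda>i. (y i, Stay)))"

fun code_size :: "'a prog \<Rightarrow> nat" where
  "code_size (Write r f) = 1"
| "code_size (Move d) = 1"
| "code_size (c ;; d) = code_size c + code_size d"
| "code_size (Cond t c d) = code_size c + code_size d + 2"
| "code_size (While t c) = code_size c + 2"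

text \<open>Jump targets are absolute: \<open>a\<close> is the address of the first instruction.
  Every block exits by reaching \<open>a + code_size c\<close>, so that sequencing is
  concatenation.\<close>

fun compile :: "nat \<Rightarrow> 'a prog \<Rightarrow> 'a instr list" where
  "compile a (Write r f) = [\<lambda>x y. (Suc a, Stay, (\<lambda>i. (y i, Stay))(r := f (y r)))]"
| "compile a (Move d) = [\<lambda>x y. (Suc a, d, \<lambda>i. (y i, Stay))]"
| "compile a (c ;; d) = compile a c @ compile (a + code_size c) d"
| "compile a (Cond t c d) =
     branch t (Suc a) (a + code_size c + 2) # compile (Suc a) c @
     goto (a + code_size c + code_size d + 2) # compile (a + code_size c + 2) d"
| "compile a (While t c) =
     branch t (Suc a) (a + code_size c + 2) # compile (Suc a) c @ [goto a]"

lemma length_compile [simp]: "length (compile a c) = code_size c"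
  by (induction c arbitrary: a) auto

text \<open>The halting states are the two addresses after the code: running off its end accepts,
  jumping one further rejects.\<close>

definition code_machine :: "nat \<Rightarrow> 'a instr list \<Rightarrow> 'a machine" where
  "code_machine N C =
     \<lparr>num_states = length C + 2, num_symbols = 5, num_tapes = N, start_state = 0,
      accept_state = length C, reject_state = Suc (length C),
      transition = (\<lambda>q x ys. if q < length C then
          (case (C ! q) x (\<lambda>i. if i < N then ys ! i else 0) of (q', d, f) \<Rightarrow> (q', d, map f [0..<N]))
        else (q, Stay, map (\<lambda>y. (y, Stay)) ys))\<rparr>"

definition cfg :: "nat \<Rightarrow> nat \<Rightarrow> pstate \<Rightarrow> config" where
  "cfg N q s = \<lparr>state = q, in_pos = fst s, work = map (snd s) [0..<N]\<rparr>"

definition heads_le :: "nat \<Rightarrow> config \<Rightarrow> bool" where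
  "heads_le m c \<longleftrightarrow> (\<forall>T \<in> set (work c). snd T \<le> m)"

definition reaches :: "'a machine \<Rightarrow> 'a list \<Rightarrow> nat \<Rightarrow> config \<Rightarrow> config \<Rightarrow> bool" where
  "reaches M w m c d \<longleftrightarrow> (\<exists>t. (step M w ^^ t) c = d \<and> (\<forall>t' \<le> t. heads_le m ((step M w ^^ t') c)))"

lemma reaches_step: "step M w c = d \<Longrightarrow> heads_le m c \<Longrightarrow> heads_le m d \<Longrightarrow> reaches M w m c d"
  unfolding reaches_def by (intro exI[of _ 1]) (auto simp: le_Suc_eq)

lemma reaches_trans [trans]:
  assumes "reaches M w m c d" "reaches M w m d e" shows "reaches M w m c e"
proof -
  obtain t where t: "(step M w ^^ t) c = d" "\<And>t'. t' \<le> t \<Longrightarrow> heads_le m ((step M w ^^ t') c)"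
    using assms(1) by (auto simp: reaches_def)
  obtain u where u: "(step M w ^^ u) d = e" "\<And>t'. t' \<le> u \<Longrightarrow> heads_le m ((step M w ^^ t') d)"
    using assms(2) by (auto simp: reaches_def)
  have add: "(step M w ^^ (v + t)) c = (step M w ^^ v) d" for v
    by (simp add: funpow_add t(1))
  show ?thesis
    unfolding reaches_def
  proof (intro exI[of _ "u + t"] conjI allI impI)
    show "(step M w ^^ (u + t)) c = e" by (simp add: add u(1))
    fix t' assume "t' \<le> u + t"
    show "heads_le m ((step M w ^^ t') c)"
    proof (cases "t' \<le> t")
      case False
      then have "t' = (t' - t) + t" by simp
      with u(2)[of "t' - t"] \<open>t' \<le> u + t\<close> add[of "t' - t"] show ?thesis by simp
    qed (rule t(2))
  qed
qed

lemma step_code_machine: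
  assumes "q < length C" "(C ! q) (in_read w p) (\<lambda>i. if i < N then sym_at (T i) else 0) = (q', d, f)"
  shows "step (code_machine N C) w (cfg N q (p, T)) =
    cfg N q' (min (shift d p) (Suc (length w)), \<lambda>i. act_tape (f i) (T i))"
proof -
  have *: "(\<lambda>i. if i < N then map (\<lambda>x. case T x of (t, h) \<Rightarrow> t h) [0..<N] ! i else 0) =
      (\<lambda>i. if i < N then sym_at (T i) else 0)"
    by (auto simp: sym_at_def)
  show ?thesis
    using assms unfolding step_def cfg_def code_machine_def
    by (simp add: * comp_def) (simp add: zip_map_map zip_same_conv_map comp_def)
qed

lemma act_tape_idle [simp]: "act_tape (sym_at T, Stay) T = T"
  by (cases T) (simp add: act_tape_def sym_at_def)

lemma heads_le_cfg: "heads_le m (cfg N q s) \<longleftrightarrow> (\<forall>i < N. snd (snd s i) \<le> m)"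
  by (auto simp: heads_le_def cfg_def)

lemma step_branch:
  assumes "q < length C" "C ! q = branch t a b" "wf_test N t" "fst s \<le> Suc (length w)"
  shows "step (code_machine N C) w (cfg N q s) = cfg N (if holds w t s then a else b) s"
proof -
  obtain p T where s: "s = (p, T)" by (cases s)
  have h: "eval_test t (in_read w p) (\<lambda>i. if i < N then sym_at (T i) else 0) = holds w t s"
    using assms(3) by (cases t) (auto simp: s)
  have "step (code_machine N C) w (cfg N q (p, T)) =
    cfg N (if holds w t s then a else b) (min (shift Stay p) (Suc (length w)),
      \<lambda>i. act_tape ((if i < N then sym_at (T i) else 0), Stay) (T i))"
    by (rule step_code_machine[OF assms(1)]) (simp add: assms(2) branch_def h)
  also have "\<dots> = cfg N (if holds w t s then a else b) (p, T)"
    using assms(4) s by (auto simp: cfg_def)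
  finally show ?thesis by (simp add: s)
qed

lemma step_goto:
  assumes "q < length C" "C ! q = goto a" "fst s \<le> Suc (length w)"
  shows "step (code_machine N C) w (cfg N q s) = cfg N a s"
  using step_branch[of q C "HeadTest (\<lambda>_. True)" a a N s w] assms
  by (simp add: branch_def goto_def)

text \<open>The context \<open>pre\<close>, \<open>post\<close> lets the induction descend into
  subprograms at their own addresses. The bound on the input head is carried along because a machine
  step clamps that head, and only within the bound is an instruction that does not move it really
  idle.\<close>

theorem compile_correct:
  assumes "exec m w c s s'" "wf_prog N c" "C = pre @ compile (length pre) c @ post"
    "fst s \<le> Suc (length w)" "\<forall>i < N. snd (snd s i) \<le> m"
  shows "reaches (code_machine N C) w m (cfg N (length pre) s) (cfg N (length pre + code_size c) s')
    \<and> fst s' \<le> Suc (length w) \<and> (\<forall>i < N. snd (snd s' i) \<le> m)"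
  using assms
proof (induction arbitrary: pre post rule: exec.induct)
  case (Write T' f T r p)
  have "step (code_machine N C) w (cfg N (length pre) (p, T)) =
    cfg N (Suc (length pre)) (min (shift Stay p) (Suc (length w)),
      \<lambda>i. act_tape (((\<lambda>i. ((if i < N then sym_at (T i) else 0), Stay))(r := f (sym_at (T r)))) i) (T i))"
    by (rule step_code_machine) (use Write.prems in \<open>auto simp: fun_eq_iff\<close>)
  also have "\<dots> = cfg N (Suc (length pre)) (p, T(r := T'))"
    using Write by (auto simp: cfg_def)
  finally show ?case
    using Write by (auto intro!: reaches_step simp: heads_le_cfg)
next
  case (Move d p T)
  have "step (code_machine N C) w (cfg N (length pre) (p, T)) =
    cfg N (Suc (length pre)) (min (shift d p) (Suc (length w)),
      \<lambda>i. act_tape ((if i < N then sym_at (T i) else 0), Stay) (T i))"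
    by (rule step_code_machine) (use Move.prems in \<open>auto\<close>)
  also have "\<dots> = cfg N (Suc (length pre)) (min (shift d p) (Suc (length w)), T)"
    by (auto simp: cfg_def)
  finally show ?case
    using Move by (auto intro!: reaches_step simp: heads_le_cfg)
next
  case (Seq c s s' d s'')
  have 1: "reaches (code_machine N C) w m (cfg N (length pre) s) (cfg N (length pre + code_size c) s')
    \<and> fst s' \<le> Suc (length w) \<and> (\<forall>i < N. snd (snd s' i) \<le> m)"
    by (rule Seq.IH(1)) (use Seq.prems in auto)
  have "reaches (code_machine N C) w m (cfg N (length (pre @ compile (length pre) c)) s')
      (cfg N (length (pre @ compile (length pre) c) + code_size d) s'')
    \<and> fst s'' \<le> Suc (length w) \<and> (\<forall>i < N. snd (snd s'' i) \<le> m)"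
    by (rule Seq.IH(2)) (use Seq.prems 1 in auto)
  with 1 show ?case by (auto simp: add.assoc intro: reaches_trans)
next
  case (IfT t s c s' d)
  let ?pre = "pre @ [branch t (Suc (length pre)) (length pre + code_size c + 2)]"
  have "step (code_machine N C) w (cfg N (length pre) s) = cfg N (Suc (length pre)) s"
    by (subst step_branch[where t = t and a = "Suc (length pre)"
      and b = "length pre + code_size c + 2"]) (use IfT in \<open>auto\<close>)
  then have 1: "reaches (code_machine N C) w m (cfg N (length pre) s) (cfg N (length ?pre) s)"
    using IfT.prems by (auto intro!: reaches_step simp: heads_le_cfg)
  have 2: "reaches (code_machine N C) w m (cfg N (length ?pre) s) (cfg N (length ?pre + code_size c) s')
    \<and> fst s' \<le> Suc (length w) \<and> (\<forall>i < N. snd (snd s' i) \<le> m)"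
    by (rule IfT.IH) (use IfT.prems in auto)
  have "step (code_machine N C) w (cfg N (length ?pre + code_size c) s') =
      cfg N (length pre + code_size c + code_size d + 2) s'"
    by (rule step_goto) (use IfT.prems 2 in \<open>auto simp: nth_append\<close>)
  then have "reaches (code_machine N C) w m (cfg N (length ?pre + code_size c) s')
      (cfg N (length pre + code_size (Cond t c d)) s')"
    using 2 by (auto intro!: reaches_step simp: heads_le_cfg algebra_simps)
  with 1 2 show ?case by (blast intro: reaches_trans)
next
  case (IfF t s d s' c)
  let ?pre = "pre @ branch t (Suc (length pre)) (length pre + code_size c + 2) #
    compile (Suc (length pre)) c @ [goto (length pre + code_size c + code_size d + 2)]"
  have "step (code_machine N C) w (cfg N (length pre) s) = cfg N (length pre + code_size c + 2) s"
    by (subst step_branch[where t = t and a = "Suc (length pre)"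
      and b = "length pre + code_size c + 2"]) (use IfF in \<open>auto\<close>)
  then have 1: "reaches (code_machine N C) w m (cfg N (length pre) s) (cfg N (length ?pre) s)"
    using IfF.prems by (auto intro!: reaches_step simp: heads_le_cfg)
  have "reaches (code_machine N C) w m (cfg N (length ?pre) s) (cfg N (length ?pre + code_size d) s')
    \<and> fst s' \<le> Suc (length w) \<and> (\<forall>i < N. snd (snd s' i) \<le> m)"
    by (rule IfF.IH) (use IfF.prems in auto)
  with 1 show ?case by (auto simp: algebra_simps intro: reaches_trans)
next
  case (WhileF t s c)
  have "step (code_machine N C) w (cfg N (length pre) s) = cfg N (length pre + code_size c + 2) s"
    by (subst step_branch[where t = t and a = "Suc (length pre)"
      and b = "length pre + code_size c + 2"]) (use WhileF in \<open>auto\<close>)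
  then show ?case
    using WhileF.prems by (auto intro!: reaches_step simp: heads_le_cfg)
next
  case (WhileT t s c s' s'')
  let ?pre = "pre @ [branch t (Suc (length pre)) (length pre + code_size c + 2)]"
  have "step (code_machine N C) w (cfg N (length pre) s) = cfg N (Suc (length pre)) s"
    by (subst step_branch[where t = t and a = "Suc (length pre)"
      and b = "length pre + code_size c + 2"]) (use WhileT in \<open>auto\<close>)
  then have 1: "reaches (code_machine N C) w m (cfg N (length pre) s) (cfg N (length ?pre) s)"
    using WhileT.prems by (auto intro!: reaches_step simp: heads_le_cfg)
  have 2: "reaches (code_machine N C) w m (cfg N (length ?pre) s) (cfg N (length ?pre + code_size c) s')
    \<and> fst s' \<le> Suc (length w) \<and> (\<forall>i < N. snd (snd s' i) \<le> m)"
    by (rule WhileT.IH(1)) (use WhileT.prems in auto)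
  have "step (code_machine N C) w (cfg N (length ?pre + code_size c) s') = cfg N (length pre) s'"
    by (rule step_goto) (use WhileT.prems 2 in \<open>auto simp: nth_append\<close>)
  then have 3: "reaches (code_machine N C) w m (cfg N (length ?pre + code_size c) s') (cfg N (length pre) s')"
    using 2 by (auto intro!: reaches_step simp: heads_le_cfg)
  have "reaches (code_machine N C) w m (cfg N (length pre) s') (cfg N (length pre + code_size (While t c)) s'')
    \<and> fst s'' \<le> Suc (length w) \<and> (\<forall>i < N. snd (snd s'' i) \<le> m)"
    by (rule WhileT.IH(2)) (use WhileT.prems 2 in auto)
  with 1 2 3 show ?case by (blast intro: reaches_trans)
qed

section \<open>Registers\<close>

text \<open>
  Bijective base 2, least significant digit first: zero is the blank tape and every other number
  has a nonblank first digit, so testing for zero only inspects the first cell.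
\<close>

fun dg :: "nat \<Rightarrow> nat \<Rightarrow> nat" where
  "dg v 0 = (if v = 0 then 0 else if odd v then 1 else 2)"
| "dg v (Suc i) = dg ((v - 1) div 2) i"

lemma dg_zero [simp]: "dg 0 i = 0"
  by (induction "0 :: nat" i rule: dg.induct) auto

text \<open>Turns bounds on values into bounds on space: the digits of a number below
  \<open>2 ^ m\<close> lie in cells below \<open>m\<close>.\<close>

lemma dg_nonzero: "dg v i \<noteq> 0 \<Longrightarrow> 2 ^ i \<le> v"
proof (induction v i rule: dg.induct)
  case (2 v i)
  then have "2 ^ i \<le> (v - 1) div 2" by simp
  then show ?case by simp
qed (auto split: if_splits)

lemma dg_zero_mono: "dg v i = 0 \<Longrightarrow> i \<le> j \<Longrightarrow> dg v j = 0"
proof (induction v i arbitrary: j rule: dg.induct)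
  case (1 v)
  then show ?case by (auto split: if_splits)
next
  case (2 v i)
  then show ?case by (cases j) auto
qed

text \<open>The carry: a leading run of 2s turns into 1s and the first other digit, possibly a
  blank, goes up by one. Read backwards it describes the borrow, so it serves both
  \<open>inc_reg\<close> and \<open>dec_reg\<close>.\<close>

lemma dg_Suc:
  "\<exists>k. (\<forall>i < k. dg v i = 2) \<and> dg v k < 2 \<and>
     dg (Suc v) = (\<lambda>i. if i < k then 1 else if i = k then Suc (dg v k) else dg v i)"
proof (induction v rule: less_induct)
  case (less v)
  show ?case
  proof (cases "v = 0 \<or> odd v")
    case True
    have "dg (Suc v) i = (if i = 0 then Suc (dg v 0) else dg v i)" for i
      using True by (cases i) (auto elim!: oddE)
    with True show ?thesis by (intro exI[of _ 0]) auto
  next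
    case False
    define u where "u = (v - 1) div 2"
    have v: "v = 2 * u + 2" using False by (auto simp: u_def elim!: evenE)
    then obtain k where k: "\<forall>i < k. dg u i = 2" "dg u k < 2"
      "dg (Suc u) = (\<lambda>i. if i < k then 1 else if i = k then Suc (dg u k) else dg u i)"
      using less.IH[of u] by auto
    have d: "dg v (Suc i) = dg u i" "dg (Suc v) (Suc i) = dg (Suc u) i" for i
      by (simp_all add: v)
    have d0: "dg v 0 = 2" "dg (Suc v) 0 = 1" by (simp_all add: v)
    have "dg (Suc v) i = (if i < Suc k then 1 else if i = Suc k then Suc (dg v (Suc k)) else dg v i)" for i
      by (cases i) (simp_all del: dg.simps add: d d0 k(3))
    moreover have "\<forall>i < Suc k. dg v i = 2"
      using k(1) by (auto simp del: dg.simps simp: d d0 less_Suc_eq_0_disj)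
    ultimately show ?thesis using k(2) d(1) by (intro exI[of _ "Suc k"]) auto
  qed
qed

definition sym_is :: "nat \<Rightarrow> nat \<Rightarrow> 'a test" where
  "sym_is r a = TapeTest r (\<lambda>y. y = a)"

definition nonzero :: "nat \<Rightarrow> 'a test" where
  "nonzero r = TapeTest r (\<lambda>y. y \<noteq> 0)"

definition put :: "nat \<Rightarrow> nat \<Rightarrow> dir \<Rightarrow> 'a prog" where
  "put r z d = Write r (\<lambda>y. (z, d))"

definition sweep :: "nat \<Rightarrow> nat \<Rightarrow> nat \<Rightarrow> dir \<Rightarrow> 'a prog" where
  "sweep r a b d = While (sym_is r a) (put r b d)"

lemma sym_at_pair [simp]: "sym_at (c, h) = c h"
  by (simp add: sym_at_def)

lemma holds_sym_is [simp]: "holds w (sym_is r a) s \<longleftrightarrow> sym_at (snd s r) = a"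
  by (simp add: sym_is_def)

lemma exec_put:
  "shift d h \<le> m \<Longrightarrow>
    exec m w (put r z d) (p, T(r := (c, h))) (p, T(r := (c(h := z), shift d h)))"
  using exec.Write[of "(c(h := z), shift d h)" "\<lambda>y. (z, d)" "T(r := (c, h))" r m w p]
  by (simp add: act_tape_def put_def)

lemma exec_put':
  "c' = c(h := z) \<Longrightarrow> h' = shift d h \<Longrightarrow> h' \<le> m \<Longrightarrow>
    exec m w (put r z d) (p, T(r := (c, h))) (p, T(r := (c', h')))"
  by (simp add: exec_put)

lemma exec_sweep_right:
  assumes "h \<le> k" "k \<le> m" "\<forall>i. h \<le> i \<and> i < k \<longrightarrow> c i = a" "c k \<noteq> a"
  shows "exec m w (sweep r a b MoveR) (p, T(r := (c, h)))
    (p, T(r := (\<lambda>i. if h \<le> i \<and> i < k then b else c i, k)))"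
  using assms
proof (induction "k - h" arbitrary: h c)
  case 0
  then have *: "(\<lambda>i. if h \<le> i \<and> i < k then b else c i) = c" and hk: "h = k" by auto
  show ?case unfolding sweep_def hk *[unfolded hk] by (rule exec.WhileF) (use 0 hk in simp)
next
  case (Suc n)
  then have hk: "h < k" by simp
  have 1: "exec m w (put r b MoveR) (p, T(r := (c, h))) (p, T(r := (c(h := b), Suc h)))"
    using hk Suc.prems by (intro exec_put') simp_all
  have 2: "exec m w (sweep r a b MoveR) (p, T(r := (c(h := b), Suc h)))
    (p, T(r := (\<lambda>i. if Suc h \<le> i \<and> i < k then b else (c(h := b)) i, k)))"
    by (rule Suc.hyps(1)) (use hk Suc.hyps(2) Suc.prems in auto)
  have 3: "(\<lambda>i. if Suc h \<le> i \<and> i < k then b else (c(h := b)) i) =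
      (\<lambda>i. if h \<le> i \<and> i < k then b else c i)"
    using hk by (auto simp: fun_eq_iff)
  show ?case
    unfolding sweep_def
    by (rule exec.WhileT[OF _ 1 2[unfolded 3 sweep_def]]) (use hk Suc.prems in simp)
qed

lemma exec_sweep_left:
  assumes "h \<le> m" "\<forall>i. 0 < i \<and> i \<le> h \<longrightarrow> c i = a" "c 0 \<noteq> a"
  shows "exec m w (sweep r a a MoveL) (p, T(r := (c, h))) (p, T(r := (c, 0)))"
  using assms
proof (induction h)
  case 0
  then show ?case unfolding sweep_def by (intro exec.WhileF) simp
next
  case (Suc h)
  have 1: "exec m w (put r a MoveL) (p, T(r := (c, Suc h))) (p, T(r := (c, h)))"
    using Suc.prems by (intro exec_put') auto
  have 2: "exec m w (sweep r a a MoveL) (p, T(r := (c, h))) (p, T(r := (c, 0)))"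
    by (rule Suc.IH) (use Suc.prems in auto)
  show ?case
    unfolding sweep_def
    by (rule exec.WhileT[OF _ 1 2[unfolded sweep_def]]) (use Suc.prems in simp)
qed

text \<open>
  The symbols 3 and 4 stand for the digits 1 and 2 in the first cell, so that the head finds its
  way back while a carry is propagated.
\<close>

definition inc_reg :: "nat \<Rightarrow> 'a prog" where
  "inc_reg r =
     Cond (sym_is r 2)
       (put r 3 MoveR ;; sweep r 2 1 MoveR ;; Cond (sym_is r 0) (put r 1 MoveL) (put r 2 MoveL) ;;
        sweep r 1 1 MoveL ;; put r 1 Stay)
       (Cond (sym_is r 0) (put r 1 Stay) (put r 2 Stay))"

text \<open>A borrow runs over leading 1s. If it meets a 2, that digit becomes 1. If it meets the
  blank, the number consisted of 1s only and gets one digit shorter, so the head steps back and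
  erases the last digit; finding the marker 4 there means that the number was 1.\<close>

definition dec_reg :: "nat \<Rightarrow> 'a prog" where
  "dec_reg r =
     Cond (sym_is r 2) (put r 1 Stay)
       (put r 4 MoveR ;; sweep r 1 2 MoveR ;;
        Cond (sym_is r 2)
          (put r 1 MoveL ;; sweep r 2 2 MoveL ;; put r 2 Stay)
          (put r 0 MoveL ;;
           Cond (sym_is r 4) (put r 0 Stay) (put r 0 MoveL ;; sweep r 2 2 MoveL ;; put r 2 Stay)))"

definition regs :: "(nat \<Rightarrow> nat) \<Rightarrow> nat \<Rightarrow> work_tape" where
  "regs s = (\<lambda>r. (dg (s r), 0))"

lemma regs_upd: "regs (s(r := v)) = (regs s)(r := (dg v, 0))"
  by (auto simp: regs_def)

lemma regs_upd_same: "regs s = (regs s)(r := (dg (s r), 0))"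
  by (auto simp: regs_def)

lemma holds_nonzero [simp]: "holds w (nonzero r) (p, regs s) \<longleftrightarrow> s r \<noteq> 0"
  by (simp add: nonzero_def sym_at_def regs_def)

lemma exec_sweep_right':
  assumes "h \<le> k" "k \<le> m" "\<forall>i. h \<le> i \<and> i < k \<longrightarrow> c i = a" "c k \<noteq> a"
    "c' = (\<lambda>i. if h \<le> i \<and> i < k then b else c i)"
  shows "exec m w (sweep r a b MoveR) (p, T(r := (c, h))) (p, T(r := (c', k)))"
  using exec_sweep_right assms by simp

lemma exec_inc_reg:
  assumes "Suc (s r) < 2 ^ m"
  shows "exec m w (inc_reg r) (p, regs s) (p, regs (s(r := Suc (s r))))"
proof -
  define T where "T = regs s"
  define c where "c = dg (s r)"
  obtain k where k: "\<forall>i < k. c i = 2" "c k < 2"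
    "dg (Suc (s r)) = (\<lambda>i. if i < k then 1 else if i = k then Suc (c k) else c i)"
    using dg_Suc[of "s r"] unfolding c_def by blast
  have "dg (Suc (s r)) k \<noteq> 0" by (simp add: k(3))
  from dg_nonzero[OF this] have "(2 :: nat) ^ k < 2 ^ m" using assms by linarith
  then have km: "k < m" by simp
  have "exec m w (inc_reg r) (p, T(r := (c, 0))) (p, T(r := (dg (Suc (s r)), 0)))"
  proof (cases "k = 0")
    case True
    then have *: "dg (Suc (s r)) = c(0 := Suc (c 0))" "c 0 = 0 \<or> c 0 = 1" using k by auto
    have inner: "exec m w (Cond (sym_is r 0) (put r 1 Stay) (put r 2 Stay))
        (p, T(r := (c, 0))) (p, T(r := (c(0 := Suc (c 0)), 0)))"
    proof (cases "c 0 = 0")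
      case True
      then show ?thesis by (intro exec.IfT exec_put') simp_all
    next
      case False
      with * show ?thesis by (intro exec.IfF exec_put') (simp_all add: numeral_2_eq_2)
    qed
    show ?thesis unfolding inc_reg_def *(1)
      by (rule exec.IfF[OF _ inner]) (use *(2) in auto)
  next
    case False
    define c1 where "c1 = c(0 := 3)"
    define c2 where "c2 = (\<lambda>i. if 1 \<le> i \<and> i < k then 1 else c1 i)"
    define c3 where "c3 = c2(k := Suc (c k))"
    have c2k: "c2 k = c k" using False by (simp add: c2_def c1_def)
    have 1: "exec m w (put r 3 MoveR) (p, T(r := (c, 0))) (p, T(r := (c1, 1)))"
      using km by (intro exec_put') (auto simp: c1_def)
    have 2: "exec m w (sweep r 2 1 MoveR) (p, T(r := (c1, 1))) (p, T(r := (c2, k)))"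
      using km k False by (intro exec_sweep_right') (auto simp: c2_def c1_def)
    have 3: "exec m w (Cond (sym_is r 0) (put r 1 MoveL) (put r 2 MoveL))
        (p, T(r := (c2, k))) (p, T(r := (c3, k - 1)))"
    proof (cases "c k = 0")
      case True
      then show ?thesis using km by (intro exec.IfT exec_put') (auto simp: c3_def c2k)
    next
      case False
      then have "c k = 1" using k(2) by simp
      then show ?thesis using km by (intro exec.IfF exec_put') (auto simp: c3_def c2k)
    qed
    have 4: "exec m w (sweep r 1 1 MoveL) (p, T(r := (c3, k - 1))) (p, T(r := (c3, 0)))"
      using km False by (intro exec_sweep_left) (auto simp: c3_def c2_def c1_def)
    have 5: "exec m w (put r 1 Stay) (p, T(r := (c3, 0))) (p, T(r := (dg (Suc (s r)), 0)))"
      using False k by (intro exec_put') (auto simp: c3_def c2_def c1_def)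
    have "c 0 = 2" using k(1) False by simp
    then show ?thesis
      unfolding inc_reg_def
      by (intro exec.IfT exec.Seq[OF 1 exec.Seq[OF 2 exec.Seq[OF 3 exec.Seq[OF 4 5]]]]) simp
  qed
  then show ?thesis using regs_upd_same[of s r] by (simp add: regs_upd T_def c_def)
qed

lemma exec_dec_reg:
  assumes "s r \<noteq> 0" "s r < 2 ^ m"
  shows "exec m w (dec_reg r) (p, regs s) (p, regs (s(r := s r - 1)))"
proof -
  define T where "T = regs s"
  define u where "u = s r - 1"
  define c where "c = dg (s r)"
  define e where "e = dg u"
  have su: "s r = Suc u" using assms by (simp add: u_def)
  obtain k where k: "\<forall>i < k. e i = 2" "e k < 2"
    "c = (\<lambda>i. if i < k then 1 else if i = k then Suc (e k) else e i)"
    using dg_Suc[of u] unfolding c_def su e_def by blast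
  have "dg (s r) k \<noteq> 0" using k(3) by (simp add: c_def)
  from dg_nonzero[OF this] have "(2 :: nat) ^ k < 2 ^ m" using assms by linarith
  then have km: "k < m" by simp
  have "exec m w (dec_reg r) (p, T(r := (c, 0))) (p, T(r := (e, 0)))"
  proof (cases "e k = 0")
    case False
    then have ek: "e k = 1" using k(2) by simp
    show ?thesis
    proof (cases "k = 0")
      case True
      then show ?thesis unfolding dec_reg_def using k ek
        by (intro exec.IfT exec_put') auto
    next
      case False
      define c1 where "c1 = c(0 := 4)"
      define c2 where "c2 = (\<lambda>i. if 1 \<le> i \<and> i < k then 2 else c1 i)"
      define c3 where "c3 = c2(k := 1)"
      have 1: "exec m w (put r 4 MoveR) (p, T(r := (c, 0))) (p, T(r := (c1, 1)))"
        using km by (intro exec_put') (auto simp: c1_def)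
      have 2: "exec m w (sweep r 1 2 MoveR) (p, T(r := (c1, 1))) (p, T(r := (c2, k)))"
        using km k False ek by (intro exec_sweep_right') (auto simp: c2_def c1_def)
      have 3: "exec m w (put r 1 MoveL) (p, T(r := (c2, k))) (p, T(r := (c3, k - 1)))"
        using km by (intro exec_put') (auto simp: c3_def)
      have 4: "exec m w (sweep r 2 2 MoveL) (p, T(r := (c3, k - 1))) (p, T(r := (c3, 0)))"
        using km False by (intro exec_sweep_left) (auto simp: c3_def c2_def c1_def)
      have 5: "exec m w (put r 2 Stay) (p, T(r := (c3, 0))) (p, T(r := (e, 0)))"
        using False k ek by (intro exec_put') (auto simp: c3_def c2_def c1_def)
      have "c2 k = 2" using False k(3) ek by (simp add: c2_def c1_def)
      moreover have "c 0 \<noteq> 2" using False k(3) by simp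
      ultimately show ?thesis
        unfolding dec_reg_def
        by (intro exec.IfF exec.Seq[OF 1 exec.Seq[OF 2 exec.IfT[OF _ exec.Seq[OF 3 exec.Seq[OF 4 5]]]]])
          simp_all
    qed
  next
    case ek: True
    have e0: "e i = 0" if "k \<le> i" for i
      using dg_zero_mono[of u k i] ek that by (simp add: e_def)
    define c1 where "c1 = c(0 := 4)"
    define c2 where "c2 = (\<lambda>i. if 1 \<le> i \<and> i < Suc k then 2 else c1 i)"
    define c3 where "c3 = c2(k := 0)"
    have c2k: "c2 (Suc k) = 0" using k(3) e0 by (simp add: c2_def c1_def)
    have 1: "exec m w (put r 4 MoveR) (p, T(r := (c, 0))) (p, T(r := (c1, 1)))"
      using km by (intro exec_put') (auto simp: c1_def)
    have 2: "exec m w (sweep r 1 2 MoveR) (p, T(r := (c1, 1))) (p, T(r := (c2, Suc k)))"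
      using km k ek e0 by (intro exec_sweep_right') (auto simp: c2_def c1_def)
    have 3: "exec m w (put r 0 MoveL) (p, T(r := (c2, Suc k))) (p, T(r := (c2, k)))"
      using km c2k by (intro exec_put') auto
    have 4: "exec m w (Cond (sym_is r 4) (put r 0 Stay) (put r 0 MoveL ;; sweep r 2 2 MoveL ;; put r 2 Stay))
        (p, T(r := (c2, k))) (p, T(r := (e, 0)))"
    proof (cases "k = 0")
      case True
      then show ?thesis using k(3) e0 by (intro exec.IfT exec_put') (auto simp: c2_def c1_def)
    next
      case False
      have 4: "exec m w (put r 0 MoveL) (p, T(r := (c2, k))) (p, T(r := (c3, k - 1)))"
        using km by (intro exec_put') (auto simp: c3_def)
      have 5: "exec m w (sweep r 2 2 MoveL) (p, T(r := (c3, k - 1))) (p, T(r := (c3, 0)))"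
        using km False by (intro exec_sweep_left) (auto simp: c3_def c2_def c1_def)
      have 6: "exec m w (put r 2 Stay) (p, T(r := (c3, 0))) (p, T(r := (e, 0)))"
        using False k ek by (intro exec_put') (auto simp: c3_def c2_def c1_def)
      have "c2 k = 2" using False by (simp add: c2_def)
      then show ?thesis
        by (intro exec.IfF exec.Seq[OF 4 exec.Seq[OF 5 6]]) simp
    qed
    have "c 0 \<noteq> 2" using k(3) ek by auto
    then show ?thesis
      unfolding dec_reg_def using c2k
      by (intro exec.IfF exec.Seq[OF 1 exec.Seq[OF 2 exec.IfF[OF _ exec.Seq[OF 3 4]]]]) simp_all
  qed
  then show ?thesis using regs_upd_same[of s r] by (simp add: regs_upd T_def c_def e_def u_def)
qed

definition clear_reg :: "nat \<Rightarrow> 'a prog" where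
  "clear_reg r = While (nonzero r) (dec_reg r)"

definition move_reg :: "nat \<Rightarrow> nat \<Rightarrow> 'a prog" where
  "move_reg x y = While (nonzero x) (dec_reg x ;; inc_reg y)"

text \<open>Reading a counter destroys it, so a scratch register \<open>t\<close> takes a second
  copy from which \<open>x\<close> is restored.\<close>

definition copy_reg :: "nat \<Rightarrow> nat \<Rightarrow> nat \<Rightarrow> 'a prog" where
  "copy_reg x y t = While (nonzero x) (dec_reg x ;; inc_reg y ;; inc_reg t) ;; move_reg t x"

lemma exec_clear_reg:
  "s r < 2 ^ m \<Longrightarrow> exec m w (clear_reg r) (p, regs s) (p, regs (s(r := 0)))"
proof (induction "s r" arbitrary: s)
  case 0
  then have *: "s(r := 0) = s" by auto
  show ?case unfolding clear_reg_def * by (rule exec.WhileF) (use 0 in simp)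
next
  case (Suc n)
  then have sx: "s r = Suc n" by simp
  have 1: "exec m w (dec_reg r) (p, regs s) (p, regs (s(r := n)))"
    using exec_dec_reg[of s r m w p] sx Suc.prems by simp
  have 2: "exec m w (clear_reg r) (p, regs (s(r := n))) (p, regs (s(r := n, r := 0)))"
    by (rule Suc.hyps(1)) (use sx Suc.prems in auto)
  show ?case
    using exec.WhileT[OF _ 1 2[unfolded clear_reg_def]] sx unfolding clear_reg_def by simp
qed

lemma exec_move_reg:
  "x \<noteq> y \<Longrightarrow> s x + s y < 2 ^ m \<Longrightarrow>
    exec m w (move_reg x y) (p, regs s) (p, regs (s(x := 0, y := s x + s y)))"
proof (induction "s x" arbitrary: s)
  case 0
  then have *: "s(x := 0, y := s x + s y) = s" by auto
  show ?case unfolding move_reg_def * by (rule exec.WhileF) (use 0 in simp)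
next
  case (Suc n)
  then have sx: "s x = Suc n" by simp
  let ?s1 = "s(x := n)" and ?s2 = "s(x := n, y := Suc (s y))"
  have 1: "exec m w (dec_reg x) (p, regs s) (p, regs ?s1)"
    using exec_dec_reg[of s x m w p] sx Suc.prems by simp
  have 2: "exec m w (inc_reg y) (p, regs ?s1) (p, regs ?s2)"
    using exec_inc_reg[of ?s1 y m w p] Suc.prems sx by simp
  have "exec m w (move_reg x y) (p, regs ?s2) (p, regs (?s2(x := 0, y := ?s2 x + ?s2 y)))"
    by (rule Suc.hyps(1)) (use sx Suc.prems in auto)
  also have "?s2(x := 0, y := ?s2 x + ?s2 y) = s(x := 0, y := s x + s y)"
    using sx Suc.prems by (auto simp: fun_eq_iff)
  finally have 3: "exec m w (move_reg x y) (p, regs ?s2) (p, regs (s(x := 0, y := s x + s y)))" .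
  show ?case
    unfolding move_reg_def
    by (rule exec.WhileT[OF _ exec.Seq[OF 1 2] 3[unfolded move_reg_def]]) (use sx in simp)
qed

lemma exec_copy_reg:
  assumes "x \<noteq> y" "x \<noteq> t" "y \<noteq> t" "s y = 0" "s t = 0" "s x < 2 ^ m"
  shows "exec m w (copy_reg x y t) (p, regs s) (p, regs (s(y := s x)))"
proof -
  have *: "exec m w (While (nonzero x) (dec_reg x ;; inc_reg y ;; inc_reg t)) (p, regs s)
      (p, regs (s(x := 0, y := s x + s y, t := s x + s t)))"
    if "s x + s y < 2 ^ m" "s x + s t < 2 ^ m" for s
    using that
  proof (induction "s x" arbitrary: s)
    case 0
    then have *: "s(x := 0, y := s x + s y, t := s x + s t) = s" by auto
    show ?case unfolding * by (rule exec.WhileF) (use 0 in simp)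
  next
    case (Suc n)
    then have sx: "s x = Suc n" by simp
    let ?s1 = "s(x := n)" and ?s2 = "s(x := n, y := Suc (s y))"
      and ?s3 = "s(x := n, y := Suc (s y), t := Suc (s t))"
    have 1: "exec m w (dec_reg x) (p, regs s) (p, regs ?s1)"
      using exec_dec_reg[of s x m w p] sx Suc.prems by simp
    have 2: "exec m w (inc_reg y) (p, regs ?s1) (p, regs ?s2)"
      using exec_inc_reg[of ?s1 y m w p] Suc.prems assms sx by simp
    have 3: "exec m w (inc_reg t) (p, regs ?s2) (p, regs ?s3)"
      using exec_inc_reg[of ?s2 t m w p] Suc.prems assms sx by simp
    have "exec m w (While (nonzero x) (dec_reg x ;; inc_reg y ;; inc_reg t)) (p, regs ?s3)
        (p, regs (?s3(x := 0, y := ?s3 x + ?s3 y, t := ?s3 x + ?s3 t)))"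
      by (rule Suc.hyps(1)) (use sx Suc.prems assms in auto)
    also have "?s3(x := 0, y := ?s3 x + ?s3 y, t := ?s3 x + ?s3 t) =
        s(x := 0, y := s x + s y, t := s x + s t)"
      using sx assms by (auto simp: fun_eq_iff)
    finally have 4: "exec m w (While (nonzero x) (dec_reg x ;; inc_reg y ;; inc_reg t)) (p, regs ?s3)
        (p, regs (s(x := 0, y := s x + s y, t := s x + s t)))" .
    show ?case
      by (rule exec.WhileT[OF _ exec.Seq[OF 1 exec.Seq[OF 2 3]] 4]) (use sx in simp)
  qed
  let ?s = "s(x := 0, y := s x, t := s x)"
  have "exec m w (move_reg t x) (p, regs ?s) (p, regs (?s(t := 0, x := ?s t + ?s x)))"
    using assms by (intro exec_move_reg) auto
  also have "?s(t := 0, x := ?s t + ?s x) = s(y := s x)"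
    using assms by (auto simp: fun_eq_iff)
  finally have 2: "exec m w (move_reg t x) (p, regs ?s) (p, regs (s(y := s x)))" .
  have 1: "exec m w (While (nonzero x) (dec_reg x ;; inc_reg y ;; inc_reg t)) (p, regs s) (p, regs ?s)"
    using *[of s] assms by simp
  show ?thesis unfolding copy_reg_def by (rule exec.Seq[OF 1 2])
qed

definition well_formed :: "'a prog \<Rightarrow> bool" where
  "well_formed c \<longleftrightarrow> (\<exists>N. wf_prog N c)"

lemma wf_test_mono: "wf_test N t \<Longrightarrow> N \<le> N' \<Longrightarrow> wf_test N' t"
  by (cases t) auto

lemma wf_prog_mono: "wf_prog N c \<Longrightarrow> N \<le> N' \<Longrightarrow> wf_prog N' c"
  by (induction c) (auto intro: wf_test_mono)

lemma wf_prog_max: "wf_prog M c \<Longrightarrow> wf_prog (max M N) c" "wf_prog N c \<Longrightarrow> wf_prog (max M N) c"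
  by (auto intro: wf_prog_mono)

lemma wf_Seq [simp]: "well_formed (c ;; d) \<longleftrightarrow> well_formed c \<and> well_formed d"
  unfolding well_formed_def by (auto intro: wf_prog_max)

lemma wf_test_ex: "\<exists>N. wf_test N t"
  by (cases t) auto

lemma wf_While [simp]: "well_formed (While t c) \<longleftrightarrow> well_formed c"
  unfolding well_formed_def using wf_test_ex[of t]
  by (auto intro: wf_prog_max wf_test_mono max.cobounded1 max.cobounded2)

lemma wf_If [simp]: "well_formed (Cond t c d) \<longleftrightarrow> well_formed c \<and> well_formed d"
proof
  assume "well_formed c \<and> well_formed d"
  then obtain M N where "wf_prog M c" "wf_prog N d" by (auto simp: well_formed_def)
  moreover obtain L where "wf_test L t" using wf_test_ex by blast
  ultimately have "wf_prog (max L (max M N)) (Cond t c d)"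
    by (auto intro: wf_prog_mono wf_test_mono)
  then show "well_formed (Cond t c d)" unfolding well_formed_def by blast
qed (auto simp: well_formed_def)

lemma wf_Move [simp]: "well_formed (Move d)"
  by (simp add: well_formed_def)

lemma wf_put [simp]: "z < 5 \<Longrightarrow> well_formed (put r z d)"
  unfolding well_formed_def put_def by (auto intro: lessI)

lemma wf_reg_ops [simp]: "well_formed (inc_reg r)" "well_formed (dec_reg r)" "well_formed (clear_reg r)" "well_formed (move_reg x y)"
    "well_formed (copy_reg x y t)"
  by (simp_all add: inc_reg_def dec_reg_def clear_reg_def move_reg_def copy_reg_def sweep_def)

section \<open>Logarithmic space functions\<close>

text \<open>The summand 2 keeps the base at least 2, so that constants and constant factors can be
  absorbed by raising the exponent.\<close>

definition msr :: "'a list \<Rightarrow> nat \<Rightarrow> (nat \<Rightarrow> nat) \<Rightarrow> nat" where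
  "msr w k \<rho> = length w + (\<Sum>i<k. \<rho> i) + 2"

definition store :: "nat \<Rightarrow> nat list \<Rightarrow> (nat \<Rightarrow> nat) \<Rightarrow> nat \<Rightarrow> nat" where
  "store b vs s = (\<lambda>r. if b \<le> r \<and> r < b + length vs then vs ! (r - b) else s r)"

definition vals :: "('a list \<Rightarrow> (nat \<Rightarrow> nat) \<Rightarrow> nat) list \<Rightarrow> 'a list \<Rightarrow> (nat \<Rightarrow> nat) \<Rightarrow> nat list" where
  "vals fs w \<rho> = map (\<lambda>f. f w \<rho>) fs"

lemma vals_simps [simp]: "vals [] w \<rho> = []" "vals (f # fs) w \<rho> = f w \<rho> # vals fs w \<rho>"
    "vals (fs @ gs) w \<rho> = vals fs w \<rho> @ vals gs w \<rho>" "length (vals fs w \<rho>) = length fs"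
  by (simp_all add: vals_def)

text \<open>
  The program \<open>P ins b\<close> reads its arguments from the registers \<open>ins\<close> and uses the registers from
  \<open>b\<close> on as a stack, onto which it pushes the values of \<open>fs\<close>.
\<close>

locale implements =
  fixes \<Sigma> :: "'a set" and P :: "nat list \<Rightarrow> nat \<Rightarrow> 'a prog" and k d :: nat
    and fs :: "('a list \<Rightarrow> (nat \<Rightarrow> nat) \<Rightarrow> nat) list"
  assumes well_formed: "well_formed (P ins b)"
    and local: "w \<in> lists \<Sigma> \<Longrightarrow> (\<And>i. i < k \<Longrightarrow> \<rho> i = \<rho>' i) \<Longrightarrow> vals fs w \<rho> = vals fs w \<rho>'"
    and bound: "w \<in> lists \<Sigma> \<Longrightarrow> v \<in> set (vals fs w \<rho>) \<Longrightarrow> v \<le> msr w k \<rho> ^ d"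
    and exec: "w \<in> lists \<Sigma> \<Longrightarrow> length ins = k \<Longrightarrow> set ins \<subseteq> {..<b} \<Longrightarrow> (\<And>r. b \<le> r \<Longrightarrow> s r = 0) \<Longrightarrow>
      (\<And>r. s r < 2 ^ m) \<Longrightarrow> (\<And>i. i < k \<Longrightarrow> \<rho> i = s (ins ! i)) \<Longrightarrow> msr w k \<rho> ^ d < 2 ^ m \<Longrightarrow>
      exec m w (P ins b) (0, regs s) (0, regs (store b (vals fs w \<rho>) s))"

text \<open>The exponent \<open>d\<close> controls both the result and all registers used on the
  way: in \<open>implements\<close>, \<open>m\<close> cells are enough as soon as
  \<open>msr w k \<rho> ^ d < 2 ^ m\<close>. With all variables 0 this makes \<open>m\<close>
  logarithmic in the length of the input.\<close>

definition cpt :: "'a set \<Rightarrow> ('a list \<Rightarrow> (nat \<Rightarrow> nat) \<Rightarrow> nat) \<Rightarrow> bool" where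
  "cpt \<Sigma> f \<longleftrightarrow> (\<exists>P k d. implements \<Sigma> P k d [f])"

text \<open>A bound without computability, so that it may be derived from an arbitrary function such
  as the space function of a given machine.\<close>

definition poly_bounded :: "'a set \<Rightarrow> ('a list \<Rightarrow> (nat \<Rightarrow> nat) \<Rightarrow> nat) \<Rightarrow> bool" where
  "poly_bounded \<Sigma> f \<longleftrightarrow> (\<exists>k d. \<forall>w \<in> lists \<Sigma>. \<forall>\<rho>. f w \<rho> \<le> msr w k \<rho> ^ d)"

lemmas implementsD = implements.well_formed implements.local implements.bound implements.exec
lemmas implementsI = implements.intro

lemma msr_ge_2: "2 \<le> msr w k \<rho>"
  by (simp add: msr_def)

lemma msr_mono: "k \<le> k' \<Longrightarrow> msr w k \<rho> \<le> msr w k' \<rho>"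
  unfolding msr_def by (simp add: sum_mono2)

lemma msr_power_mono:
  assumes "k \<le> k'" "d \<le> d'" shows "msr w k \<rho> ^ d \<le> msr w k' \<rho> ^ d'"
proof -
  have "msr w k \<rho> ^ d \<le> msr w k' \<rho> ^ d" by (intro power_mono msr_mono assms) simp
  also have "\<dots> \<le> msr w k' \<rho> ^ d'"
    using msr_ge_2[of w k' \<rho>] by (intro power_increasing assms) simp
  finally show ?thesis .
qed

lemma implements_mono:
  assumes P: "implements \<Sigma> P k d fs" and "k \<le> k'" "d \<le> d'"
  shows "implements \<Sigma> (\<lambda>ins. P (take k ins)) k' d' fs"
proof (rule implementsI)
  show "well_formed (P (take k ins) b)" for ins b by (rule implementsD(1)[OF P])
  show "vals fs w \<rho> = vals fs w \<rho>'" if "w \<in> lists \<Sigma>" "\<And>i. i < k' \<Longrightarrow> \<rho> i = \<rho>' i" for w \<rho> \<rho>'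
    using that assms(2) by (intro implementsD(2)[OF P]) auto
  show "v \<le> msr w k' \<rho> ^ d'" if "w \<in> lists \<Sigma>" "v \<in> set (vals fs w \<rho>)" for v w \<rho>
    using implementsD(3)[OF P that] msr_power_mono[OF assms(2,3), of w \<rho>] by (rule order_trans)
next
  fix w :: "'a list" and ins :: "nat list" and b s m and \<rho> :: "nat \<Rightarrow> nat"
  assume *: "w \<in> lists \<Sigma>" "length ins = k'" "set ins \<subseteq> {..<b}" "\<And>r. b \<le> r \<Longrightarrow> s r = 0"
    "\<And>r. s r < 2 ^ m" "\<And>i. i < k' \<Longrightarrow> \<rho> i = s (ins ! i)" "msr w k' \<rho> ^ d' < 2 ^ m"
  show "exec m w (P (take k ins) b) (0, regs s) (0, regs (store b (vals fs w \<rho>) s))"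
    using msr_power_mono[OF assms(2,3), of w \<rho>] * assms(2) set_take_subset[of k ins]
    by (intro implementsD(4)[OF P]) auto
qed

lemma exec_skip: "p \<le> Suc (length w) \<Longrightarrow> exec m w (Move Stay) (p, T) (p, T)"
  using exec.Move[of m w Stay p T] by simp

lemma store_Nil [simp]: "store b [] s = s"
  by (auto simp: store_def)

lemma store_single: "store b [v] s = s(b := v)"
  by (auto simp: store_def)

lemma store_append: "store (b + length us) vs (store b us s) = store b (us @ vs) s"
  by (auto simp: store_def fun_eq_iff nth_append)

lemma store_less: "(\<And>v. v \<in> set vs \<Longrightarrow> v < M) \<Longrightarrow> s r < M \<Longrightarrow> store b vs s r < M"
  by (auto simp: store_def intro!: nth_mem)

lemma implements_Nil: "implements \<Sigma> (\<lambda>_ _. Move Stay) k d []"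
  by (rule implementsI) (simp_all add: exec_skip)

lemma nth_less: "set ins \<subseteq> {..<b} \<Longrightarrow> i < length ins \<Longrightarrow> ins ! i < (b :: nat)"
  by (meson lessThan_iff nth_mem subsetD)

lemma implements_append:
  assumes P: "implements \<Sigma> P k d fs" and Q: "implements \<Sigma> Q k d gs"
  shows "implements \<Sigma> (\<lambda>ins b. P ins b ;; Q ins (b + length fs)) k d (fs @ gs)"
proof (rule implementsI)
  fix w :: "'a list" and ins :: "nat list" and b s m and \<rho> :: "nat \<Rightarrow> nat"
  assume *: "w \<in> lists \<Sigma>" "length ins = k" "set ins \<subseteq> {..<b}" "\<And>r. b \<le> r \<Longrightarrow> s r = 0"
    "\<And>r. s r < 2 ^ m" "\<And>i. i < k \<Longrightarrow> \<rho> i = s (ins ! i)" "msr w k \<rho> ^ d < 2 ^ m"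
  let ?s = "store b (vals fs w \<rho>) s"
  have 1: "exec m w (P ins b) (0, regs s) (0, regs ?s)"
    by (rule implementsD(4)[OF P]) (fact *)+
  have "v < 2 ^ m" if "v \<in> set (vals fs w \<rho>)" for v
    using implementsD(3)[OF P *(1) that] *(7) by (rule le_less_trans)
  then have lt: "?s r < 2 ^ m" for r
    using *(5) by (rule store_less)
  have same: "?s (ins ! i) = s (ins ! i)" if "i < k" for i
    using nth_less[OF *(3), of i] *(2) that by (simp add: store_def)
  have zero: "?s r = 0" if "b + length fs \<le> r" for r
    using that *(4) by (simp add: store_def)
  have 2: "exec m w (Q ins (b + length fs)) (0, regs ?s)
      (0, regs (store (b + length fs) (vals gs w \<rho>) ?s))"
  proof (rule implementsD(4)[OF Q])
    show "w \<in> lists \<Sigma>" "length ins = k" "msr w k \<rho> ^ d < 2 ^ m" by fact+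
    show "set ins \<subseteq> {..<b + length fs}" using *(3) by auto
    show "?s r = 0" if "b + length fs \<le> r" for r using that by (rule zero)
    show "?s r < 2 ^ m" for r by (rule lt)
    show "\<rho> i = ?s (ins ! i)" if "i < k" for i using *(6)[OF that] same[OF that] by simp
  qed
  show "exec m w (P ins b ;; Q ins (b + length fs)) (0, regs s)
      (0, regs (store b (vals (fs @ gs) w \<rho>) s))"
    using exec.Seq[OF 1 2] store_append[of b "vals fs w \<rho>" "vals gs w \<rho>" s]
    by simp
next
  show "well_formed (P ins b ;; Q ins (b + length fs))" for ins b
    using implementsD(1)[OF P] implementsD(1)[OF Q] by simp
  show "vals (fs @ gs) w \<rho> = vals (fs @ gs) w \<rho>'" if "w \<in> lists \<Sigma>" "\<And>i. i < k \<Longrightarrow> \<rho> i = \<rho>' i" for w \<rho> \<rho>'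
    using implementsD(2)[OF P that] implementsD(2)[OF Q that] by simp
  show "v \<le> msr w k \<rho> ^ d" if "w \<in> lists \<Sigma>" "v \<in> set (vals (fs @ gs) w \<rho>)" for v w \<rho>
    using that(2) implementsD(3)[OF P that(1), of v \<rho>] implementsD(3)[OF Q that(1), of v \<rho>] by auto
qed

lemma cpt_list:
  assumes "\<And>f. f \<in> set fs \<Longrightarrow> cpt \<Sigma> f"
  shows "\<exists>P k d. implements \<Sigma> P k d fs"
  using assms
proof (induction fs)
  case Nil
  then show ?case using implements_Nil by blast
next
  case (Cons f fs)
  have "cpt \<Sigma> f" using Cons.prems by simp
  then obtain P k d where P: "implements \<Sigma> P k d [f]" unfolding cpt_def by blast
  obtain Q k' d' where Q: "implements \<Sigma> Q k' d' fs" using Cons by auto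
  from implements_append[OF implements_mono[OF P, of "max k k'" "max d d'"]
      implements_mono[OF Q, of "max k k'" "max d d'"]]
  show ?case by auto
qed

lemma cpt_poly_bounded:
  assumes "cpt \<Sigma> f" shows "poly_bounded \<Sigma> f"
proof -
  obtain P k d where "implements \<Sigma> P k d [f]" using assms unfolding cpt_def by blast
  from implementsD(3)[OF this] have "f w \<rho> \<le> msr w k \<rho> ^ d" if "w \<in> lists \<Sigma>" for w \<rho>
    using that by simp
  then show ?thesis unfolding poly_bounded_def by blast
qed

fun clear_range :: "nat \<Rightarrow> nat \<Rightarrow> 'a prog" where
  "clear_range b 0 = Move Stay"
| "clear_range b (Suc n) = clear_range b n ;; clear_reg (b + n)"

fun move_range :: "nat \<Rightarrow> nat \<Rightarrow> nat \<Rightarrow> 'a prog" where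
  "move_range x y 0 = Move Stay"
| "move_range x y (Suc n) = move_range x y n ;; move_reg (x + n) (y + n)"

lemma wf_ranges [simp]: "well_formed (clear_range b n)" "well_formed (move_range x y n)"
  by (induction n) simp_all

lemma exec_clear_range:
  assumes "p \<le> Suc (length w)" "\<And>r. s r < 2 ^ m"
  shows "exec m w (clear_range b n) (p, regs s) (p, regs (\<lambda>r. if b \<le> r \<and> r < b + n then 0 else s r))"
proof (induction n)
  case 0
  have "(\<lambda>r. if b \<le> r \<and> r < b + 0 then 0 else s r) = s" by auto
  then show ?case using exec_skip[OF assms(1)] by simp
next
  case (Suc n)
  let ?s = "\<lambda>r. if b \<le> r \<and> r < b + n then 0 else s r"
  have "exec m w (clear_reg (b + n)) (p, regs ?s) (p, regs (?s(b + n := 0)))"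
    by (rule exec_clear_reg) (use assms(2) in simp)
  also have "?s(b + n := 0) = (\<lambda>r. if b \<le> r \<and> r < b + Suc n then 0 else s r)"
    by (auto simp: fun_eq_iff)
  finally show ?case using exec.Seq[OF Suc] by simp
qed

lemma exec_move_range:
  assumes "p \<le> Suc (length w)" "\<And>r. s r < 2 ^ m" "y + n \<le> x" "\<And>r. y \<le> r \<Longrightarrow> r < y + n \<Longrightarrow> s r = 0"
  shows "exec m w (move_range x y n) (p, regs s)
    (p, regs (\<lambda>r. if y \<le> r \<and> r < y + n then s (x + (r - y)) else if x \<le> r \<and> r < x + n then 0 else s r))"
  using assms(3,4)
proof (induction n)
  case 0
  have "(\<lambda>r. if y \<le> r \<and> r < y + 0 then s (x + (r - y)) else if x \<le> r \<and> r < x + 0 then 0 else s r) = s"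
    by auto
  then show ?case using exec_skip[OF assms(1)] by simp
next
  case (Suc n)
  let ?s = "\<lambda>r. if y \<le> r \<and> r < y + n then s (x + (r - y)) else if x \<le> r \<and> r < x + n then 0 else s r"
  have 1: "exec m w (move_range x y n) (p, regs s) (p, regs ?s)"
    by (rule Suc.IH) (use Suc.prems in auto)
  have "exec m w (move_reg (x + n) (y + n)) (p, regs ?s)
      (p, regs (?s(x + n := 0, y + n := ?s (x + n) + ?s (y + n))))"
    by (rule exec_move_reg) (use Suc.prems assms(2) in auto)
  also have "?s(x + n := 0, y + n := ?s (x + n) + ?s (y + n)) =
    (\<lambda>r. if y \<le> r \<and> r < y + Suc n then s (x + (r - y)) else if x \<le> r \<and> r < x + Suc n then 0 else s r)"
    using Suc.prems by (auto simp: fun_eq_iff less_Suc_eq)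
  finally show ?case using exec.Seq[OF 1] by simp
qed

lemma cptI: "implements \<Sigma> P k d [f] \<Longrightarrow> cpt \<Sigma> f"
  unfolding cpt_def by blast

lemma cpt_zero: "cpt \<Sigma> (\<lambda>w \<rho>. 0)"
  by (rule cptI[of _ "\<lambda>_ _. Move Stay" 0 0], rule implementsI)
    (auto simp: store_single exec_skip fun_upd_idem)

lemma cpt_var: "cpt \<Sigma> (\<lambda>w \<rho>. \<rho> i)"
proof (rule cptI[of _ "\<lambda>ins b. copy_reg (ins ! i) b (Suc b)" "Suc i" 1], rule implementsI)
  show "v \<le> msr w (Suc i) \<rho> ^ 1" if "v \<in> set (vals [\<lambda>(w :: 'a list) \<rho>. \<rho> i] w \<rho>)" for v w \<rho>
    using that by (simp add: msr_def)
next
  fix w :: "'a list" and ins :: "nat list" and b s m and \<rho> :: "nat \<Rightarrow> nat"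
  assume *: "length ins = Suc i" "set ins \<subseteq> {..<b}" "\<And>r. b \<le> r \<Longrightarrow> s r = 0"
    "\<And>r. s r < 2 ^ m" "\<And>j. j < Suc i \<Longrightarrow> \<rho> j = s (ins ! j)"
  have "ins ! i < b" using nth_less[OF *(2)] *(1) by simp
  then show "exec m w (copy_reg (ins ! i) b (Suc b)) (0, regs s)
      (0, regs (store b (vals [\<lambda>(w :: 'a list) \<rho>. \<rho> i] w \<rho>) s))"
    using exec_copy_reg[of "ins ! i" b "Suc b" s m w 0] * by (simp add: store_single)
qed auto

lemma cpt_Suc_var: "cpt \<Sigma> (\<lambda>w \<rho>. Suc (\<rho> i))"
proof (rule cptI[of _ "\<lambda>ins b. copy_reg (ins ! i) b (Suc b) ;; inc_reg b" "Suc i" 1], rule implementsI)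
  show "v \<le> msr w (Suc i) \<rho> ^ 1" if "v \<in> set (vals [\<lambda>(w :: 'a list) \<rho>. Suc (\<rho> i)] w \<rho>)" for v w \<rho>
    using that by (simp add: msr_def)
next
  fix w :: "'a list" and ins :: "nat list" and b s m and \<rho> :: "nat \<Rightarrow> nat"
  assume *: "length ins = Suc i" "set ins \<subseteq> {..<b}" "\<And>r. b \<le> r \<Longrightarrow> s r = 0"
    "\<And>r. s r < 2 ^ m" "\<And>j. j < Suc i \<Longrightarrow> \<rho> j = s (ins ! j)" "msr w (Suc i) \<rho> ^ 1 < 2 ^ m"
  have "ins ! i < b" using nth_less[OF *(2)] *(1) by simp
  then have 1: "exec m w (copy_reg (ins ! i) b (Suc b)) (0, regs s) (0, regs (s(b := \<rho> i)))"
    using exec_copy_reg[of "ins ! i" b "Suc b" s m w 0] * by simp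
  have 2: "exec m w (inc_reg b) (0, regs (s(b := \<rho> i))) (0, regs (s(b := Suc (\<rho> i))))"
    using exec_inc_reg[of "s(b := \<rho> i)" b m w 0] *(6) by (simp add: msr_def)
  show "exec m w (copy_reg (ins ! i) b (Suc b) ;; inc_reg b) (0, regs s)
      (0, regs (store b (vals [\<lambda>(w :: 'a list) \<rho>. Suc (\<rho> i)] w \<rho>) s))"
    using exec.Seq[OF 1 2] by (simp add: store_single)
qed auto

text \<open>Since \<open>\<phi>\<close> is arbitrary, its value at the scanned symbol is obtained
  from finitely many head tests, each success adding one to the register.\<close>

fun tally :: "('a in_sym \<Rightarrow> nat) \<Rightarrow> nat \<Rightarrow> nat \<Rightarrow> 'a prog" where
  "tally \<phi> b 0 = Move Stay"
| "tally \<phi> b (Suc n) = tally \<phi> b n ;; Cond (HeadTest (\<lambda>x. n < \<phi> x)) (inc_reg b) (Move Stay)"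

lemma wf_tally [simp]: "well_formed (tally \<phi> b n)"
  by (induction n) simp_all

lemma exec_tally:
  assumes "p \<le> Suc (length w)" "s b = 0" "n < 2 ^ m"
  shows "exec m w (tally \<phi> b n) (p, regs s) (p, regs (s(b := min n (\<phi> (in_read w p)))))"
  using assms(3)
proof (induction n)
  case 0
  then show ?case using assms by (simp add: exec_skip fun_upd_idem)
next
  case (Suc n)
  let ?x = "\<phi> (in_read w p)"
  let ?s = "s(b := min n ?x)"
  have 1: "exec m w (tally \<phi> b n) (p, regs s) (p, regs ?s)"
    by (rule Suc.IH) (use Suc.prems in simp)
  have 2: "exec m w (Cond (HeadTest (\<lambda>x. n < \<phi> x)) (inc_reg b) (Move Stay)) (p, regs ?s)
      (p, regs (s(b := min (Suc n) ?x)))"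
  proof (cases "n < ?x")
    case True
    then have "exec m w (inc_reg b) (p, regs ?s) (p, regs (s(b := min (Suc n) ?x)))"
      using exec_inc_reg[of ?s b m w p] Suc.prems by (simp add: min_def)
    then show ?thesis by (rule exec.IfT[rotated]) (simp add: True)
  next
    case False
    then have "s(b := min (Suc n) ?x) = ?s" by (simp add: min_def)
    then show ?thesis using exec_skip[OF assms(1)] False by (intro exec.IfF) simp_all
  qed
  show ?case unfolding tally.simps by (rule exec.Seq[OF 1 2])
qed

lemma exec_advance:
  assumes "s r < 2 ^ m" "p \<le> Suc (length w)"
  shows "exec m w (While (nonzero r) (dec_reg r ;; Move MoveR)) (p, regs s)
    (min (p + s r) (Suc (length w)), regs (s(r := 0)))"
  using assms
proof (induction "s r" arbitrary: s p)
  case 0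
  then have *: "s(r := 0) = s" by auto
  have "exec m w (While (nonzero r) (dec_reg r ;; Move MoveR)) (p, regs s) (p, regs s)"
    by (rule exec.WhileF) (use 0 in simp)
  then show ?case using * 0 by simp
next
  case (Suc n)
  then have sr: "s r = Suc n" by simp
  have 1: "exec m w (dec_reg r) (p, regs s) (p, regs (s(r := n)))"
    using exec_dec_reg[of s r m w p] sr Suc.prems by simp
  have 2: "exec m w (Move MoveR) (p, regs (s(r := n))) (min (Suc p) (Suc (length w)), regs (s(r := n)))"
    using exec.Move[of m w MoveR p] by simp
  let ?p = "min (Suc p) (Suc (length w))"
  have 3: "exec m w (While (nonzero r) (dec_reg r ;; Move MoveR)) (?p, regs (s(r := n)))
      (min (?p + (s(r := n)) r) (Suc (length w)), regs ((s(r := n))(r := 0)))"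
    by (rule Suc.hyps(1)) (use sr Suc.prems in auto)
  have 4: "exec m w (While (nonzero r) (dec_reg r ;; Move MoveR)) (p, regs s)
      (min (?p + (s(r := n)) r) (Suc (length w)), regs ((s(r := n))(r := 0)))"
    by (rule exec.WhileT[OF _ exec.Seq[OF 1 2] 3]) (use sr in simp)
  have "min (?p + (s(r := n)) r) (Suc (length w)) = min (p + s r) (Suc (length w))"
    using sr by simp
  with 4 show ?case by simp
qed

lemma exec_rewind:
  "p \<le> Suc (length w) \<Longrightarrow> exec m w (While (HeadTest (\<lambda>x. x \<noteq> LeftEnd)) (Move MoveL)) (p, T) (0, T)"
proof (induction p)
  case 0
  show ?case by (rule exec.WhileF) (simp add: in_read_def)
next
  case (Suc p)
  have 1: "exec m w (Move MoveL) (Suc p, T) (p, T)"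
    using exec.Move[of m w MoveL "Suc p"] Suc.prems by simp
  show ?case
    by (rule exec.WhileT[OF _ 1 Suc.IH]) (use Suc.prems in \<open>auto simp: in_read_def\<close>)
qed

lemma cpt_read_var:
  fixes \<phi> :: "'a in_sym \<Rightarrow> nat"
  assumes "finite \<Sigma>"
  shows "cpt \<Sigma> (\<lambda>w \<rho>. \<phi> (in_read w (\<rho> i)))"
proof -
  define C where "C = Max (\<phi> ` in_syms \<Sigma>)"
  have "finite (in_syms \<Sigma>)" using assms by (simp add: in_syms_def)
  then have C: "\<phi> x \<le> C" if "x \<in> in_syms \<Sigma>" for x
    unfolding C_def using that by (intro Max_ge) auto
  have rd: "in_read w p \<in> in_syms \<Sigma>" if "w \<in> lists \<Sigma>" for w p
    using that nth_mem[of "p - 1" w] by (auto simp: in_read_def in_syms_def in_lists_conv_set)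
  have Cb: "C \<le> msr w (Suc i) \<rho> ^ Suc C" for w :: "'a list" and \<rho>
  proof -
    have "C \<le> 2 ^ C" by simp
    also have "\<dots> \<le> msr w (Suc i) \<rho> ^ C" by (intro power_mono msr_ge_2) simp
    also have "\<dots> \<le> msr w (Suc i) \<rho> ^ Suc C"
      using msr_ge_2[of w "Suc i" \<rho>] by (intro power_increasing) auto
    finally show ?thesis .
  qed
  show ?thesis
  proof (rule cptI[of _ "\<lambda>ins b. copy_reg (ins ! i) (Suc b) (Suc (Suc b)) ;;
      While (nonzero (Suc b)) (dec_reg (Suc b) ;; Move MoveR) ;; tally \<phi> b C ;;
      While (HeadTest (\<lambda>x. x \<noteq> LeftEnd)) (Move MoveL)" "Suc i" "Suc C"], rule implementsI)
    show "v \<le> msr w (Suc i) \<rho> ^ Suc C"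
      if "w \<in> lists \<Sigma>" "v \<in> set (vals [\<lambda>(w :: 'a list) \<rho>. \<phi> (in_read w (\<rho> i))] w \<rho>)" for v w \<rho>
      using order_trans[OF C[OF rd[OF that(1)]] Cb] that(2) by simp
  next
    fix w :: "'a list" and ins :: "nat list" and b s m and \<rho> :: "nat \<Rightarrow> nat"
    assume *: "w \<in> lists \<Sigma>" "length ins = Suc i" "set ins \<subseteq> {..<b}" "\<And>r. b \<le> r \<Longrightarrow> s r = 0"
      "\<And>r. s r < 2 ^ m" "\<And>j. j < Suc i \<Longrightarrow> \<rho> j = s (ins ! j)" "msr w (Suc i) \<rho> ^ Suc C < 2 ^ m"
    have "ins ! i < b" using nth_less[OF *(3)] *(2) by simp
    then have 1: "exec m w (copy_reg (ins ! i) (Suc b) (Suc (Suc b))) (0, regs s)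
        (0, regs (s(Suc b := \<rho> i)))"
      using exec_copy_reg[of "ins ! i" "Suc b" "Suc (Suc b)" s m w 0] * by simp
    let ?p = "min (\<rho> i) (Suc (length w))"
    have 2: "exec m w (While (nonzero (Suc b)) (dec_reg (Suc b) ;; Move MoveR))
        (0, regs (s(Suc b := \<rho> i))) (?p, regs s)"
      using exec_advance[of "s(Suc b := \<rho> i)" "Suc b" m 0 w] *(4-6) by (simp add: fun_upd_idem)
    have "C < 2 ^ m" using Cb *(7) by (rule le_less_trans)
    then have 3: "exec m w (tally \<phi> b C) (?p, regs s) (?p, regs (s(b := min C (\<phi> (in_read w ?p)))))"
      using *(4) by (intro exec_tally) auto
    have 4: "exec m w (While (HeadTest (\<lambda>x. x \<noteq> LeftEnd)) (Move MoveL))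
        (?p, regs (s(b := min C (\<phi> (in_read w ?p))))) (0, regs (s(b := min C (\<phi> (in_read w ?p)))))"
      by (rule exec_rewind) simp
    \<comment> \<open>The head stops at the right end marker, and \<open>in_read\<close> returns
      this marker for every larger position as well.\<close>
    have "in_read w ?p = in_read w (\<rho> i)" by (auto simp: in_read_def min_def)
    moreover have "min C (\<phi> (in_read w (\<rho> i))) = \<phi> (in_read w (\<rho> i))"
      using C[OF rd[OF *(1)]] by (rule min.absorb2)
    ultimately show "exec m w (copy_reg (ins ! i) (Suc b) (Suc (Suc b)) ;;
        While (nonzero (Suc b)) (dec_reg (Suc b) ;; Move MoveR) ;; tally \<phi> b C ;;
        While (HeadTest (\<lambda>x. x \<noteq> LeftEnd)) (Move MoveL)) (0, regs s)
        (0, regs (store b (vals [\<lambda>(w :: 'a list) \<rho>. \<phi> (in_read w (\<rho> i))] w \<rho>) s))"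
      using exec.Seq[OF 1 exec.Seq[OF 2 exec.Seq[OF 3 4]]] by (simp add: store_single)
  qed auto
qed

text \<open>The measure of an environment whose first \<open>n\<close> entries are computed values
  and whose other entries are old variables, shifted. It covers composition, where there is no old
  part, and the body of a loop.\<close>

lemma msr_vals_le:
  assumes "\<And>i. i < n \<Longrightarrow> \<sigma> i \<le> msr w k \<rho> ^ d" "\<And>i. n \<le> i \<Longrightarrow> i < n' \<Longrightarrow> \<sigma> i = \<rho> (i - n)"
    "n' \<le> n + k" "n \<le> n'"
  shows "msr w n' \<sigma> \<le> msr w k \<rho> ^ (n + d + 1)"
proof -
  let ?M = "msr w k \<rho>"
  have M: "1 \<le> ?M" "2 \<le> ?M" using msr_ge_2[of w k \<rho>] by auto
  have "(\<Sum>i<n'. \<sigma> i) = (\<Sum>i<n. \<sigma> i) + (\<Sum>i=n..<n'. \<sigma> i)"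
    using assms(4) by (metis atLeast0LessThan le0 sum.atLeastLessThan_concat)
  also have "(\<Sum>i=n..<n'. \<sigma> i) = (\<Sum>i=n..<n'. \<rho> (i - n))"
    using assms(2) by (intro sum.cong) auto
  also have "\<dots> = (\<Sum>i<n' - n. \<rho> i)"
    by (rule sum.reindex_bij_witness[of _ "\<lambda>i. i + n" "\<lambda>i. i - n"]) (use assms(4) in auto)
  also have "(\<Sum>i<n. \<sigma> i) \<le> n * ?M ^ d"
    using sum_bounded_above[of "{..<n}" \<sigma> "?M ^ d"] assms(1) by simp
  finally have "msr w n' \<sigma> \<le> n * ?M ^ d + msr w (n' - n) \<rho>"
    by (simp add: msr_def)
  also have "msr w (n' - n) \<rho> \<le> ?M" using assms(3) by (intro msr_mono) simp
  also have "n * ?M ^ d + ?M \<le> n * ?M ^ (d + 1) + ?M ^ (d + 1)"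
    using M power_increasing[of d "d + 1" ?M] power_increasing[of 1 "d + 1" ?M]
    by (intro add_mono mult_left_mono) auto
  also have "\<dots> = (n + 1) * ?M ^ (d + 1)" by simp
  also have "\<dots> \<le> 2 ^ n * ?M ^ (d + 1)"
    using less_exp[of n] by (intro mult_right_mono) (simp_all add: Suc_leI)
  also have "\<dots> \<le> ?M ^ n * ?M ^ (d + 1)"
    using M by (intro mult_right_mono power_mono) auto
  also have "\<dots> = ?M ^ (n + d + 1)" by (simp add: power_add)
  finally show ?thesis by simp
qed

lemma power_le_power_trans:
  fixes a b :: nat
  assumes "a \<le> b ^ n" "n * e \<le> E" "1 \<le> b" shows "a ^ e \<le> b ^ E"
proof -
  have "a ^ e \<le> (b ^ n) ^ e" using assms(1) by (intro power_mono) auto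
  also have "\<dots> = b ^ (n * e)" by (simp add: power_mult)
  also have "\<dots> \<le> b ^ E" using assms by (intro power_increasing)
  finally show ?thesis .
qed

lemma cpt_comp:
  assumes f: "cpt \<Sigma> f" and g: "\<And>i. cpt \<Sigma> (g i)"
  shows "cpt \<Sigma> (\<lambda>w \<rho>. f w (\<lambda>i. g i w \<rho>))"
proof -
  obtain Pf kf df where Pf: "implements \<Sigma> Pf kf df [f]" using f unfolding cpt_def by blast
  let ?gs = "map g [0..<kf]"
  obtain Pg k d where Pg: "implements \<Sigma> Pg k d ?gs" using cpt_list[of ?gs \<Sigma>] g by auto
  define D where "D = max d ((kf + d + 1) * df)"
  have vg: "vals ?gs w \<rho> = map (\<lambda>i. g i w \<rho>) [0..<kf]" for w \<rho>
    by (simp add: vals_def)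
  have bg: "g i w \<rho> \<le> msr w k \<rho> ^ d" if "w \<in> lists \<Sigma>" "i < kf" for w \<rho> i
    using implementsD(3)[OF Pg that(1), of "g i w \<rho>" \<rho>] that(2) by (simp add: vg)
  have bm: "msr w kf (\<lambda>i. g i w \<rho>) ^ df \<le> msr w k \<rho> ^ D" if "w \<in> lists \<Sigma>" for w \<rho>
  proof (rule power_le_power_trans)
    show "msr w kf (\<lambda>i. g i w \<rho>) \<le> msr w k \<rho> ^ (kf + d + 1)"
      by (rule msr_vals_le) (use bg[OF that] in auto)
  qed (use msr_ge_2[of w k \<rho>] in \<open>auto simp: D_def\<close>)
  have Dd: "msr w k \<rho> ^ d \<le> msr w k \<rho> ^ D" for w :: "'a list" and \<rho>
    by (rule msr_power_mono) (simp_all add: D_def)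
  let ?h = "\<lambda>w \<rho>. f w (\<lambda>i. g i w \<rho>)"
  \<comment> \<open>Register \<open>b\<close> is kept free for the result: the arguments are stored
    above it, the result on top of them, and once the arguments are cleared it is moved
    down.\<close>
  let ?P = "\<lambda>ins b. Pg ins (Suc b) ;; Pf [Suc b..<Suc b + kf] (Suc b + kf) ;;
    clear_range (Suc b) kf ;; move_reg (Suc b + kf) b"
  show ?thesis
  proof (rule cptI[of _ ?P k D], rule implementsI)
    show "well_formed (?P ins b)" for ins b
      using implementsD(1)[OF Pf] implementsD(1)[OF Pg] by simp
  next
    fix w and \<rho> \<rho>' :: "nat \<Rightarrow> nat"
    assume *: "w \<in> lists \<Sigma>" "\<And>i. i < k \<Longrightarrow> \<rho> i = \<rho>' i"
    have "vals ?gs w \<rho> = vals ?gs w \<rho>'" using * by (rule implementsD(2)[OF Pg])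
    then have "g i w \<rho> = g i w \<rho>'" if "i < kf" for i using that by (simp add: vg)
    then have "vals [f] w (\<lambda>i. g i w \<rho>) = vals [f] w (\<lambda>i. g i w \<rho>')"
      by (intro implementsD(2)[OF Pf *(1)])
    then show "vals [?h] w \<rho> = vals [?h] w \<rho>'" by simp
  next
    fix w v and \<rho> :: "nat \<Rightarrow> nat"
    assume *: "w \<in> lists \<Sigma>" "v \<in> set (vals [?h] w \<rho>)"
    then have "v \<le> msr w kf (\<lambda>i. g i w \<rho>) ^ df"
      using implementsD(3)[OF Pf *(1), of v "\<lambda>i. g i w \<rho>"] by simp
    also have "\<dots> \<le> msr w k \<rho> ^ D" by (rule bm[OF *(1)])
    finally show "v \<le> msr w k \<rho> ^ D" .
  next
    fix w :: "'a list" and ins :: "nat list" and b s m and \<rho> :: "nat \<Rightarrow> nat"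
    assume *: "w \<in> lists \<Sigma>" "length ins = k" "set ins \<subseteq> {..<b}" "\<And>r. b \<le> r \<Longrightarrow> s r = 0"
      "\<And>r. s r < 2 ^ m" "\<And>i. i < k \<Longrightarrow> \<rho> i = s (ins ! i)" "msr w k \<rho> ^ D < 2 ^ m"
    define s1 where "s1 = store (Suc b) (vals ?gs w \<rho>) s"
    define s2 where "s2 = s1(Suc b + kf := ?h w \<rho>)"
    define s3 where "s3 = (\<lambda>r. if Suc b \<le> r \<and> r < Suc b + kf then 0 else s2 r)"
    have md: "msr w k \<rho> ^ d < 2 ^ m" using Dd[of w \<rho>] *(7) by linarith
    have 1: "exec m w (Pg ins (Suc b)) (0, regs s) (0, regs s1)"
      unfolding s1_def
    proof (rule implementsD(4)[OF Pg])
      show "set ins \<subseteq> {..<Suc b}" using *(3) by auto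
      show "s r = 0" if "Suc b \<le> r" for r using that *(4) by simp
    qed (fact * md)+
    have s1lt: "s1 r < 2 ^ m" for r
      unfolding s1_def
    proof (rule store_less)
      show "v < 2 ^ m" if "v \<in> set (vals ?gs w \<rho>)" for v
        using implementsD(3)[OF Pg *(1) that] md by (rule le_less_trans)
    qed (fact *)
    have "exec m w (Pf [Suc b..<Suc b + kf] (Suc b + kf)) (0, regs s1)
        (0, regs (store (Suc b + kf) (vals [f] w (\<lambda>i. g i w \<rho>)) s1))"
    proof (rule implementsD(4)[OF Pf])
      show "s1 r = 0" if "Suc b + kf \<le> r" for r using that *(4) by (simp add: s1_def store_def)
      show "s1 r < 2 ^ m" for r by (rule s1lt)
      show "g i w \<rho> = s1 ([Suc b..<Suc b + kf] ! i)" if "i < kf" for i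
        using that by (simp add: s1_def store_def vg del: upt_Suc)
      show "msr w kf (\<lambda>i. g i w \<rho>) ^ df < 2 ^ m" using bm[OF *(1), of \<rho>] *(7) by linarith
    qed (use *(1) in \<open>auto simp del: upt_Suc\<close>)
    then have 2: "exec m w (Pf [Suc b..<Suc b + kf] (Suc b + kf)) (0, regs s1) (0, regs s2)"
      by (simp only: vals_simps store_single s2_def)
    have h: "?h w \<rho> < 2 ^ m"
      using implementsD(3)[OF Pf *(1), of "?h w \<rho>" "\<lambda>i. g i w \<rho>"] bm[OF *(1), of \<rho>] *(7) by simp
    have s2lt: "s2 r < 2 ^ m" for r using s1lt h by (simp add: s2_def)
    have 3: "exec m w (clear_range (Suc b) kf) (0, regs s2) (0, regs s3)"
      unfolding s3_def by (rule exec_clear_range) (use s2lt in auto)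
    have s3: "s3 b = 0" "s3 (Suc b + kf) = ?h w \<rho>" using *(4) by (auto simp: s3_def s2_def s1_def store_def)
    have 4: "exec m w (move_reg (Suc b + kf) b) (0, regs s3)
        (0, regs (s3(Suc b + kf := 0, b := s3 (Suc b + kf) + s3 b)))"
      by (rule exec_move_reg) (use s3 h in auto)
    have 5: "s3(Suc b + kf := 0, b := s3 (Suc b + kf) + s3 b) = store b (vals [?h] w \<rho>) s"
      using *(4) s3 by (auto simp: fun_eq_iff store_single s3_def s2_def s1_def store_def vg)
    show "exec m w (?P ins b) (0, regs s) (0, regs (store b (vals [?h] w \<rho>) s))"
      by (rule exec.Seq[OF 1 exec.Seq[OF 2 exec.Seq[OF 3 4[unfolded 5]]]])
  qed
qed

definition push :: "nat list \<Rightarrow> (nat \<Rightarrow> nat) \<Rightarrow> nat \<Rightarrow> nat" where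
  "push ys \<rho> = (\<lambda>i. if i < length ys then ys ! i else \<rho> (i - length ys))"

definition iter :: "('a list \<Rightarrow> (nat \<Rightarrow> nat) \<Rightarrow> nat) list \<Rightarrow> 'a list \<Rightarrow> (nat \<Rightarrow> nat) \<Rightarrow> nat \<Rightarrow> nat list \<Rightarrow> nat list" where
  "iter fs w \<rho> j ys = ((\<lambda>ys. vals fs w (push ys \<rho>)) ^^ j) ys"

lemma iter_simps [simp]:
  "iter fs w \<rho> 0 ys = ys" "iter fs w \<rho> (Suc j) ys = vals fs w (push (iter fs w \<rho> j ys) \<rho>)"
  by (simp_all add: iter_def)

lemma length_iter: "length ys = length fs \<Longrightarrow> length (iter fs w \<rho> j ys) = length fs"
  by (cases j) auto

definition loop_result ::
  "('a list \<Rightarrow> (nat \<Rightarrow> nat) \<Rightarrow> nat) list \<Rightarrow> ('a list \<Rightarrow> (nat \<Rightarrow> nat) \<Rightarrow> nat) \<Rightarrow>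
   ('a list \<Rightarrow> (nat \<Rightarrow> nat) \<Rightarrow> nat) list \<Rightarrow> 'a list \<Rightarrow> (nat \<Rightarrow> nat) \<Rightarrow> nat \<Rightarrow> nat list \<Rightarrow> bool" where
  "loop_result es g fs w \<rho> t ys \<longleftrightarrow>
     ys = iter fs w \<rho> t (vals es w \<rho>) \<and> g w (push ys \<rho>) = 0 \<and>
     (\<forall>j<t. g w (push (iter fs w \<rho> j (vals es w \<rho>)) \<rho>) \<noteq> 0)"

lemma loop_result_unique: "loop_result es g fs w \<rho> t ys \<Longrightarrow> loop_result es g fs w \<rho> t' ys' \<Longrightarrow> ys = ys'"
  unfolding loop_result_def by (metis linorder_neqE_nat)

text \<open>\<open>es\<close> gives the initial values, \<open>fs\<close> the simultaneous update
  and \<open>g\<close> the guard, zero meaning stop. The exit time \<open>t\<close> is only asserted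
  to exist, so no clock is kept and the time may be superpolynomial; the polynomial bound concerns
  the values that occur.\<close>

lemma cpt_while:
  fixes h :: "'a list \<Rightarrow> (nat \<Rightarrow> nat) \<Rightarrow> nat"
  assumes es: "\<And>e. e \<in> set es \<Longrightarrow> cpt \<Sigma> e" and fs: "\<And>f. f \<in> set fs \<Longrightarrow> cpt \<Sigma> f" and g: "cpt \<Sigma> g"
    and len: "length es = length fs" "0 < length fs"
    and u: "poly_bounded \<Sigma> u"
    and spec: "\<And>w \<rho>. w \<in> lists \<Sigma> \<Longrightarrow> \<exists>t ys. loop_result es g fs w \<rho> t ys \<and> h w \<rho> = hd ys \<and>
      (\<forall>j\<le>t. \<forall>y \<in> set (iter fs w \<rho> j (vals es w \<rho>)). y \<le> u w \<rho>)"
  shows "cpt \<Sigma> h"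
proof -
  define n where "n = length fs"
  have n: "0 < n" using len by (simp add: n_def)
  obtain Pe0 ke de where Pe0: "implements \<Sigma> Pe0 ke de es" using cpt_list[of es \<Sigma>] es by blast
  obtain Pf0 kf df where Pf0: "implements \<Sigma> Pf0 kf df fs" using cpt_list[of fs \<Sigma>] fs by blast
  obtain Pg0 kg dg where Pg0: "implements \<Sigma> Pg0 kg dg [g]" using g unfolding cpt_def by blast
  obtain ku du where u: "\<And>w \<rho>. w \<in> lists \<Sigma> \<Longrightarrow> u w \<rho> \<le> msr w ku \<rho> ^ du"
    using u unfolding poly_bounded_def by blast
  define k where "k = max (max ke ku) (max kf kg)"
  define d where "d = max (max de du) (max df dg)"
  have "ke \<le> k" "kf \<le> n + k" "kg \<le> n + k" "de \<le> d" "df \<le> d" "dg \<le> d"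
    by (auto simp: k_def d_def)
  then obtain Pe Pf Pg where Pe: "implements \<Sigma> Pe k d es" and Pf: "implements \<Sigma> Pf (n + k) d fs"
    and Pg: "implements \<Sigma> Pg (n + k) d [g]"
    using implements_mono[OF Pe0] implements_mono[OF Pf0] implements_mono[OF Pg0] by metis
  have u: "u w \<rho> \<le> msr w k \<rho> ^ d" if "w \<in> lists \<Sigma>" for w \<rho>
    by (rule order_trans[OF u[OF that] msr_power_mono]) (auto simp: k_def d_def)
  define D where "D = (n + d + 1) * d + d"
  have dD: "msr w k \<rho> ^ d \<le> msr w k \<rho> ^ D" for w :: "'a list" and \<rho>
    by (rule msr_power_mono) (simp_all add: D_def)
  let ?Y = "\<lambda>w \<rho> j. iter fs w \<rho> j (vals es w \<rho>)"
  have lY: "length (?Y w \<rho> j) = n" for w \<rho> j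
    unfolding n_def by (rule length_iter) (simp add: len)
  have agree: "vals fs w (push ys \<rho>) = vals fs w (push ys \<rho>') \<and> g w (push ys \<rho>) = g w (push ys \<rho>')"
    if "w \<in> lists \<Sigma>" "\<And>i. i < k \<Longrightarrow> \<rho> i = \<rho>' i" "length ys = n" for w \<rho> \<rho>' ys
  proof -
    have *: "push ys \<rho> i = push ys \<rho>' i" if "i < n + k" for i
      using that \<open>length ys = n\<close> \<open>\<And>i. i < k \<Longrightarrow> \<rho> i = \<rho>' i\<close> by (auto simp: push_def)
    show ?thesis using implementsD(2)[OF Pf that(1) *] implementsD(2)[OF Pg that(1) *] by simp
  qed
  have agreeY: "?Y w \<rho> j = ?Y w \<rho>' j" if "w \<in> lists \<Sigma>" "\<And>i. i < k \<Longrightarrow> \<rho> i = \<rho>' i" for w \<rho> \<rho>' j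
  proof (induction j)
    case 0
    then show ?case using implementsD(2)[OF Pe that] by simp
  next
    case (Suc j)
    then show ?case using agree[OF that lY] by simp
  qed
  have hY: "h w \<rho> = hd ys" if "w \<in> lists \<Sigma>" "loop_result es g fs w \<rho> t ys" for w \<rho> t ys
    using spec[OF that(1), of \<rho>] loop_result_unique[OF that(2)] by metis
  have bm: "msr w (n + k) (push ys \<rho>) ^ d \<le> msr w k \<rho> ^ D"
    if "length ys = n" "\<And>y. y \<in> set ys \<Longrightarrow> y \<le> msr w k \<rho> ^ d" for w :: "'a list" and \<rho> ys
  proof (rule power_le_power_trans)
    show "msr w (n + k) (push ys \<rho>) \<le> msr w k \<rho> ^ (n + d + 1)"
      by (rule msr_vals_le) (use that in \<open>auto simp: push_def\<close>)
  qed (use msr_ge_2[of w k \<rho>] in \<open>auto simp: D_def\<close>)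
  let ?J = "\<lambda>b. [b..<b + n]"
  \<comment> \<open>The new values are computed above the old ones before any of these is
    overwritten. Register \<open>b + n\<close> holds the guard and is cleared first because
    \<open>Pf\<close> expects blank registers from there on.\<close>
  let ?body = "\<lambda>ins b. clear_reg (b + n) ;; Pf (?J b @ ins) (b + n) ;; clear_range b n ;;
    move_range (b + n) b n ;; Pg (?J b @ ins) (b + n)"
  let ?P = "\<lambda>ins b. Pe ins b ;; Pg (?J b @ ins) (b + n) ;; While (nonzero (b + n)) (?body ins b) ;;
    clear_range (Suc b) (n - 1)"
  show ?thesis
  proof (rule cptI[of _ ?P k D], rule implementsI)
    show "well_formed (?P ins b)" for ins b
      using implementsD(1)[OF Pe] implementsD(1)[OF Pf] implementsD(1)[OF Pg] by simp
  next
    fix w and \<rho> \<rho>' :: "nat \<Rightarrow> nat"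
    assume *: "w \<in> lists \<Sigma>" "\<And>i. i < k \<Longrightarrow> \<rho> i = \<rho>' i"
    obtain t ys where r: "loop_result es g fs w \<rho> t ys" using spec[OF *(1), of \<rho>] by blast
    have Y: "?Y w \<rho>' j = ?Y w \<rho> j" for j using agreeY[of w \<rho> \<rho>' j] * by simp
    have G: "g w (push (?Y w \<rho> j) \<rho>') = g w (push (?Y w \<rho> j) \<rho>)" for j
      using agree[of w \<rho> \<rho>' "?Y w \<rho> j"] lY[of w \<rho> j] * by simp
    have "loop_result es g fs w \<rho>' t ys"
      using r by (auto simp: loop_result_def Y G)
    then have "h w \<rho>' = hd ys" "h w \<rho> = hd ys" using r by (auto intro: hY[OF *(1)])
    then show "vals [h] w \<rho> = vals [h] w \<rho>'" by simp
  next
    fix w v and \<rho> :: "nat \<Rightarrow> nat"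
    assume *: "w \<in> lists \<Sigma>" "v \<in> set (vals [h] w \<rho>)"
    obtain t ys where r: "loop_result es g fs w \<rho> t ys" "h w \<rho> = hd ys"
      "\<forall>j\<le>t. \<forall>y \<in> set (?Y w \<rho> j). y \<le> u w \<rho>" using spec[OF *(1), of \<rho>] by blast
    have "ys = ?Y w \<rho> t" using r(1) by (simp add: loop_result_def)
    moreover from this have "ys \<noteq> []" using lY[of w \<rho> t] n by auto
    ultimately have "h w \<rho> \<le> u w \<rho>" using r(2,3) by auto
    also have "\<dots> \<le> msr w k \<rho> ^ d" by (rule u[OF *(1)])
    also have "\<dots> \<le> msr w k \<rho> ^ D" by (rule dD)
    finally show "v \<le> msr w k \<rho> ^ D" using *(2) by simp
  next
    fix w :: "'a list" and ins :: "nat list" and b s m and \<rho> :: "nat \<Rightarrow> nat"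
    assume *: "w \<in> lists \<Sigma>" "length ins = k" "set ins \<subseteq> {..<b}" "\<And>r. b \<le> r \<Longrightarrow> s r = 0"
      "\<And>r. s r < 2 ^ m" "\<And>i. i < k \<Longrightarrow> \<rho> i = s (ins ! i)" "msr w k \<rho> ^ D < 2 ^ m"
    obtain t ys where r: "loop_result es g fs w \<rho> t ys" "h w \<rho> = hd ys"
      "\<forall>j\<le>t. \<forall>y \<in> set (?Y w \<rho> j). y \<le> u w \<rho>" using spec[OF *(1), of \<rho>] by blast
    have md: "msr w k \<rho> ^ d < 2 ^ m" using dD[of w \<rho>] *(7) by linarith
    have Yle: "y \<le> msr w k \<rho> ^ d" if "j \<le> t" "y \<in> set (?Y w \<rho> j)" for j y
      using r(3) that u[OF *(1), of \<rho>] order_trans by blast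
    have Ylt: "y < 2 ^ m" if "j \<le> t" "y \<in> set (?Y w \<rho> j)" for j y
      using Yle[OF that] md by simp
    have mY: "msr w (n + k) (push (?Y w \<rho> j) \<rho>) ^ d < 2 ^ m" if "j \<le> t" for j
      by (rule le_less_trans[OF bm *(7)]) (use lY Yle[OF that] in auto)
    define st where "st j = store b (?Y w \<rho> j) s" for j
    have stlt: "st j r < 2 ^ m" if "j \<le> t" for j r
      unfolding st_def by (rule store_less) (use Ylt[OF that] *(5) in auto)
    have st0: "st j r = 0" if "b + n \<le> r" for j r
      using that *(4) lY by (simp add: st_def store_def)
    have insb: "ins ! i < b" if "i < k" for i using nth_less[OF *(3)] that *(2) by simp
    have J: "set (?J b @ ins) \<subseteq> {..<b + n}" "length (?J b @ ins) = n + k" using *(2,3) by auto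
    have arg: "push (?Y w \<rho> j) \<rho> i = st j ((?J b @ ins) ! i)" if "i < n + k" for i j
    proof (cases "i < n")
      case True
      then show ?thesis using lY[of w \<rho> j] by (simp add: push_def st_def store_def nth_append)
    next
      case False
      then have "i - n < k" using that by simp
      then show ?thesis
        using False insb[of "i - n"] *(6)[of "i - n"] lY[of w \<rho> j]
        by (simp add: push_def st_def store_def nth_append leD)
    qed
    define G where "G j = g w (push (?Y w \<rho> j) \<rho>)" for j
    have Glt: "G j < 2 ^ m" if "j \<le> t" for j
      using implementsD(3)[OF Pg *(1), of "G j" "push (?Y w \<rho> j) \<rho>"] mY[OF that] by (simp add: G_def)
    have g: "exec m w (Pg (?J b @ ins) (b + n)) (0, regs (st j)) (0, regs ((st j)(b + n := G j)))"
      if "j \<le> t" for j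
    proof -
      have "exec m w (Pg (?J b @ ins) (b + n)) (0, regs (st j))
          (0, regs (store (b + n) (vals [g] w (push (?Y w \<rho> j) \<rho>)) (st j)))"
      proof (rule implementsD(4)[OF Pg *(1) J(2,1)])
        show "st j r = 0" if "b + n \<le> r" for r using that by (rule st0)
        show "st j r < 2 ^ m" for r by (rule stlt[OF that])
        show "push (?Y w \<rho> j) \<rho> i = st j ((?J b @ ins) ! i)" if "i < n + k" for i
          using that by (rule arg)
        show "msr w (n + k) (push (?Y w \<rho> j) \<rho>) ^ d < 2 ^ m" by (rule mY[OF that])
      qed
      then show ?thesis by (simp only: vals_simps store_single G_def)
    qed
    have body: "exec m w (?body ins b) (0, regs ((st j)(b + n := G j)))
        (0, regs ((st (Suc j))(b + n := G (Suc j))))" if "Suc j \<le> t" for j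
    proof -
      have jt: "j \<le> t" using that by simp
      have "exec m w (clear_reg (b + n)) (0, regs ((st j)(b + n := G j)))
          (0, regs ((st j)(b + n := G j, b + n := 0)))"
        by (rule exec_clear_reg) (simp add: Glt[OF jt])
      moreover have "(st j)(b + n := G j, b + n := 0) = st j"
        using st0[of "b + n" j] by auto
      ultimately have 1: "exec m w (clear_reg (b + n)) (0, regs ((st j)(b + n := G j))) (0, regs (st j))"
        by (simp only:)
      define s2 where "s2 = store (b + n) (?Y w \<rho> (Suc j)) (st j)"
      define s3 where "s3 = (\<lambda>r. if b \<le> r \<and> r < b + n then 0 else s2 r)"
      have 2: "exec m w (Pf (?J b @ ins) (b + n)) (0, regs (st j)) (0, regs s2)"
        unfolding s2_def iter_simps
      proof (rule implementsD(4)[OF Pf *(1) J(2,1)])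
        show "st j r = 0" if "b + n \<le> r" for r using that by (rule st0)
        show "st j r < 2 ^ m" for r by (rule stlt[OF jt])
        show "push (?Y w \<rho> j) \<rho> i = st j ((?J b @ ins) ! i)" if "i < n + k" for i
          using that by (rule arg)
        show "msr w (n + k) (push (?Y w \<rho> j) \<rho>) ^ d < 2 ^ m" by (rule mY[OF jt])
      qed
      have s2lt: "s2 r < 2 ^ m" for r
        unfolding s2_def by (rule store_less) (use Ylt[OF that] stlt[OF jt] in auto)
      have 3: "exec m w (clear_range b n) (0, regs s2) (0, regs s3)"
        unfolding s3_def by (rule exec_clear_range) (simp_all add: s2lt)
      have s3lt: "s3 r < 2 ^ m" for r using s2lt by (simp add: s3_def)
      have "exec m w (move_range (b + n) b n) (0, regs s3)
        (0, regs (\<lambda>r. if b \<le> r \<and> r < b + n then s3 (b + n + (r - b))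
          else if b + n \<le> r \<and> r < b + n + n then 0 else s3 r))"
        by (rule exec_move_range) (use s3lt in \<open>auto simp: s3_def\<close>)
      moreover have "(\<lambda>r. if b \<le> r \<and> r < b + n then s3 (b + n + (r - b))
          else if b + n \<le> r \<and> r < b + n + n then 0 else s3 r) = st (Suc j)"
      proof
        fix r
        show "(if b \<le> r \<and> r < b + n then s3 (b + n + (r - b))
          else if b + n \<le> r \<and> r < b + n + n then 0 else s3 r) = st (Suc j) r"
          using lY[of w \<rho> "Suc j"] lY[of w \<rho> j] *(4)
          by (simp add: s3_def s2_def st_def store_def del: iter_simps(2))
      qed
      ultimately have 4: "exec m w (move_range (b + n) b n) (0, regs s3) (0, regs (st (Suc j)))"
        by (simp only:)
      show ?thesis by (rule exec.Seq[OF 1 exec.Seq[OF 2 exec.Seq[OF 3 exec.Seq[OF 4 g[OF that]]]]])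
    qed
    have Gt: "G t = 0" and Gj: "\<And>j. j < t \<Longrightarrow> G j \<noteq> 0" and ys: "ys = ?Y w \<rho> t"
      using r(1) by (auto simp: loop_result_def G_def)
    \<comment> \<open>Here \<open>i\<close> counts the rounds that are still to come, so the
      induction starts at the exit.\<close>
    have loop: "exec m w (While (nonzero (b + n)) (?body ins b)) (0, regs ((st (t - i))(b + n := G (t - i))))
        (0, regs (st t))" if "i \<le> t" for i
      using that
    proof (induction i)
      case 0
      have *: "(st t)(b + n := G t) = st t" using Gt st0[of "b + n" t] by auto
      show ?case unfolding diff_zero * by (rule exec.WhileF) (simp add: st0)
    next
      case (Suc i)
      have e: "Suc (t - Suc i) = t - i" using Suc.prems by simp
      have "i \<le> t" "t - i \<le> t" "t - Suc i < t" using Suc.prems by simp_all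
      then show ?case
        by (intro exec.WhileT[OF _ body[of "t - Suc i", unfolded e] Suc.IH]) (use Gj in auto)
    qed
    have 1: "exec m w (Pe ins b) (0, regs s) (0, regs (st 0))"
      unfolding st_def iter_simps by (rule implementsD(4)[OF Pe]) (fact * md)+
    have 4: "exec m w (clear_range (Suc b) (n - 1)) (0, regs (st t))
        (0, regs (\<lambda>r. if Suc b \<le> r \<and> r < Suc b + (n - 1) then 0 else st t r))"
      by (rule exec_clear_range) (simp_all add: stlt)
    have 5: "(\<lambda>r. if Suc b \<le> r \<and> r < Suc b + (n - 1) then 0 else st t r) = store b (vals [h] w \<rho>) s"
    proof
      fix q
      have "ys \<noteq> []" using ys lY[of w \<rho> t] n by auto
      then show "(if Suc b \<le> q \<and> q < Suc b + (n - 1) then 0 else st t q) = store b (vals [h] w \<rho>) s q"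
        using n lY[of w \<rho> t] *(4)[of q] r(2)
        by (auto simp: store_single st_def store_def hd_conv_nth simp flip: ys)
    qed
    show "exec m w (?P ins b) (0, regs s) (0, regs (store b (vals [h] w \<rho>) s))"
      by (rule exec.Seq[OF 1 exec.Seq[OF g[of 0] exec.Seq[OF _ 4[unfolded 5]]]])
        (use loop[of t] in simp_all)
  qed
qed

lemma cpt_cong:
  assumes "cpt \<Sigma> f" "\<And>w \<rho>. w \<in> lists \<Sigma> \<Longrightarrow> f w \<rho> = g w \<rho>"
  shows "cpt \<Sigma> g"
proof -
  obtain P k d where P: "implements \<Sigma> P k d [f]" using assms(1) unfolding cpt_def by blast
  have v: "vals [g] w \<rho> = vals [f] w \<rho>" if "w \<in> lists \<Sigma>" for w \<rho>
    using assms(2)[OF that] by simp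
  have "implements \<Sigma> P k d [g]"
  proof (rule implementsI)
    show "well_formed (P ins b)" for ins b by (rule implementsD(1)[OF P])
    show "vals [g] w \<rho> = vals [g] w \<rho>'" if "w \<in> lists \<Sigma>" "\<And>i. i < k \<Longrightarrow> \<rho> i = \<rho>' i" for w \<rho> \<rho>'
      unfolding v[OF that(1)] using that by (rule implementsD(2)[OF P])
    show "y \<le> msr w k \<rho> ^ d" if "w \<in> lists \<Sigma>" "y \<in> set (vals [g] w \<rho>)" for y w \<rho>
      using implementsD(3)[OF P that(1)] that(2) unfolding v[OF that(1)] .
  next
    fix w :: "'a list" and ins :: "nat list" and b s m and \<rho> :: "nat \<Rightarrow> nat"
    assume *: "w \<in> lists \<Sigma>" "length ins = k" "set ins \<subseteq> {..<b}" "\<And>r. b \<le> r \<Longrightarrow> s r = 0"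
      "\<And>r. s r < 2 ^ m" "\<And>i. i < k \<Longrightarrow> \<rho> i = s (ins ! i)" "msr w k \<rho> ^ d < 2 ^ m"
    show "exec m w (P ins b) (0, regs s) (0, regs (store b (vals [g] w \<rho>) s))"
      unfolding v[OF *(1)] by (rule implementsD(4)[OF P]) (fact *)+
  qed
  then show ?thesis by (rule cptI)
qed

section \<open>Polynomial bounds, recursion and arithmetic\<close>

lemma poly_bounded_mono:
  assumes "poly_bounded \<Sigma> g" "\<And>w \<rho>. w \<in> lists \<Sigma> \<Longrightarrow> f w \<rho> \<le> g w \<rho>"
  shows "poly_bounded \<Sigma> f"
proof -
  obtain k d where "\<forall>w \<in> lists \<Sigma>. \<forall>\<rho>. g w \<rho> \<le> msr w k \<rho> ^ d"
    using assms(1) unfolding poly_bounded_def by blast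
  then have "\<forall>w \<in> lists \<Sigma>. \<forall>\<rho>. f w \<rho> \<le> msr w k \<rho> ^ d" using assms(2) by (meson order_trans)
  then show ?thesis unfolding poly_bounded_def by blast
qed

lemma poly_bounded_msr: "poly_bounded \<Sigma> (\<lambda>w \<rho>. msr w k \<rho>)"
  unfolding poly_bounded_def by (intro exI[of _ k] exI[of _ 1]) simp

lemma poly_bounded2:
  assumes "poly_bounded \<Sigma> f" "poly_bounded \<Sigma> g"
  obtains k d where "\<And>w \<rho>. w \<in> lists \<Sigma> \<Longrightarrow> f w \<rho> \<le> msr w k \<rho> ^ d"
    "\<And>w \<rho>. w \<in> lists \<Sigma> \<Longrightarrow> g w \<rho> \<le> msr w k \<rho> ^ d"
proof -
  obtain k d where f: "\<And>w \<rho>. w \<in> lists \<Sigma> \<Longrightarrow> f w \<rho> \<le> msr w k \<rho> ^ d"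
    using assms(1) unfolding poly_bounded_def by blast
  obtain k' d' where g: "\<And>w \<rho>. w \<in> lists \<Sigma> \<Longrightarrow> g w \<rho> \<le> msr w k' \<rho> ^ d'"
    using assms(2) unfolding poly_bounded_def by blast
  show thesis
    by (rule that[of "max k k'" "max d d'"])
      (rule order_trans[OF f msr_power_mono] order_trans[OF g msr_power_mono]; simp)+
qed

lemma poly_bounded_add:
  assumes "poly_bounded \<Sigma> f" "poly_bounded \<Sigma> g"
  shows "poly_bounded \<Sigma> (\<lambda>w \<rho>. f w \<rho> + g w \<rho>)"
proof -
  obtain k d where f: "\<And>w \<rho>. w \<in> lists \<Sigma> \<Longrightarrow> f w \<rho> \<le> msr w k \<rho> ^ d"
    and g: "\<And>w \<rho>. w \<in> lists \<Sigma> \<Longrightarrow> g w \<rho> \<le> msr w k \<rho> ^ d"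
    using poly_bounded2[OF assms] by metis
  have "f w \<rho> + g w \<rho> \<le> msr w k \<rho> ^ Suc d" if "w \<in> lists \<Sigma>" for w \<rho>
  proof -
    have "f w \<rho> + g w \<rho> \<le> 2 * msr w k \<rho> ^ d" using f[OF that, of \<rho>] g[OF that, of \<rho>] by simp
    also have "\<dots> \<le> msr w k \<rho> * msr w k \<rho> ^ d" by (intro mult_right_mono msr_ge_2) simp
    finally show ?thesis by simp
  qed
  then show ?thesis unfolding poly_bounded_def by blast
qed

lemma poly_bounded_mult:
  assumes "poly_bounded \<Sigma> f" "poly_bounded \<Sigma> g"
  shows "poly_bounded \<Sigma> (\<lambda>w \<rho>. f w \<rho> * g w \<rho>)"
proof -
  obtain k d where f: "\<And>w \<rho>. w \<in> lists \<Sigma> \<Longrightarrow> f w \<rho> \<le> msr w k \<rho> ^ d"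
    and g: "\<And>w \<rho>. w \<in> lists \<Sigma> \<Longrightarrow> g w \<rho> \<le> msr w k \<rho> ^ d"
    using poly_bounded2[OF assms] by metis
  have "f w \<rho> * g w \<rho> \<le> msr w k \<rho> ^ (d + d)" if "w \<in> lists \<Sigma>" for w \<rho>
    unfolding power_add by (intro mult_mono f g that) simp_all
  then show ?thesis unfolding poly_bounded_def by blast
qed

lemma poly_bounded_power: "poly_bounded \<Sigma> f \<Longrightarrow> poly_bounded \<Sigma> (\<lambda>w \<rho>. f w \<rho> ^ e)"
proof (induction e)
  case 0
  show ?case unfolding poly_bounded_def by (intro exI[of _ 0]) simp
next
  case (Suc e)
  then show ?case by (simp add: poly_bounded_mult)
qed

lemma poly_bounded_length: "poly_bounded \<Sigma> (\<lambda>w \<rho>. length w)"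
  by (rule poly_bounded_mono[OF poly_bounded_msr[of _ 0]]) (simp add: msr_def)

lemma poly_bounded_const: "poly_bounded \<Sigma> (\<lambda>w \<rho>. c)"
proof (induction c)
  case 0
  show ?case by (rule poly_bounded_mono[OF poly_bounded_msr[of _ 0]]) simp
next
  case (Suc c)
  then show ?case
    by (rule poly_bounded_mono[OF poly_bounded_add[OF _ poly_bounded_msr[of _ 0]]]) (simp add: msr_def)
qed

lemma cpt_pred_var: "cpt \<Sigma> (\<lambda>w \<rho>. \<rho> i - 1)"
proof (rule cptI[of _ "\<lambda>ins b. copy_reg (ins ! i) b (Suc b) ;; Cond (nonzero b) (dec_reg b) (Move Stay)"
      "Suc i" 1], rule implementsI)
  show "v \<le> msr w (Suc i) \<rho> ^ 1" if "v \<in> set (vals [\<lambda>(w :: 'a list) \<rho>. \<rho> i - 1] w \<rho>)" for v w \<rho>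
    using that by (simp add: msr_def)
next
  fix w :: "'a list" and ins :: "nat list" and b s m and \<rho> :: "nat \<Rightarrow> nat"
  assume *: "length ins = Suc i" "set ins \<subseteq> {..<b}" "\<And>r. b \<le> r \<Longrightarrow> s r = 0"
    "\<And>r. s r < 2 ^ m" "\<And>j. j < Suc i \<Longrightarrow> \<rho> j = s (ins ! j)" "msr w (Suc i) \<rho> ^ 1 < 2 ^ m"
  have "ins ! i < b" using nth_less[OF *(2)] *(1) by simp
  then have 1: "exec m w (copy_reg (ins ! i) b (Suc b)) (0, regs s) (0, regs (s(b := \<rho> i)))"
    using exec_copy_reg[of "ins ! i" b "Suc b" s m w 0] * by simp
  have 2: "exec m w (Cond (nonzero b) (dec_reg b) (Move Stay)) (0, regs (s(b := \<rho> i)))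
      (0, regs (s(b := \<rho> i - 1)))"
  proof (cases "\<rho> i = 0")
    case True
    then show ?thesis using exec_skip[of 0 w m "regs (s(b := \<rho> i))"] by (intro exec.IfF) simp_all
  next
    case False
    have "exec m w (dec_reg b) (0, regs (s(b := \<rho> i))) (0, regs ((s(b := \<rho> i))(b := (s(b := \<rho> i)) b - 1)))"
      by (rule exec_dec_reg) (use False *(4,5) in simp_all)
    then have "exec m w (dec_reg b) (0, regs (s(b := \<rho> i))) (0, regs (s(b := \<rho> i - 1)))"
      by (simp only: fun_upd_upd fun_upd_same)
    then show ?thesis by (rule exec.IfT[rotated]) (simp add: False)
  qed
  show "exec m w (copy_reg (ins ! i) b (Suc b) ;; Cond (nonzero b) (dec_reg b) (Move Stay)) (0, regs s)
      (0, regs (store b (vals [\<lambda>(w :: 'a list) \<rho>. \<rho> i - 1] w \<rho>) s))"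
    unfolding vals_simps store_single by (rule exec.Seq[OF 1 2])
qed auto

lemma cpt_reindex: "cpt \<Sigma> f \<Longrightarrow> cpt \<Sigma> (\<lambda>w \<rho>. f w (\<lambda>i. \<rho> (\<theta> i)))"
  by (rule cpt_comp[of _ f "\<lambda>i w \<rho>. \<rho> (\<theta> i)"]) (simp_all add: cpt_var)

lemma cpt_fun1: "cpt \<Sigma> (\<lambda>w \<rho>. F w (\<rho> 0)) \<Longrightarrow> cpt \<Sigma> e \<Longrightarrow> cpt \<Sigma> (\<lambda>w \<rho>. F w (e w \<rho>))"
  by (rule cpt_comp[of _ "\<lambda>w \<rho>. F w (\<rho> 0)" "\<lambda>i. e"])

lemma cpt_fun2:
  assumes "cpt \<Sigma> (\<lambda>w \<rho>. F (\<rho> 0) (\<rho> 1))" "cpt \<Sigma> e" "cpt \<Sigma> e'"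
  shows "cpt \<Sigma> (\<lambda>w \<rho>. F (e w \<rho>) (e' w \<rho>))"
  using cpt_comp[OF assms(1), of "\<lambda>i. if i = 0 then e else e'"] assms(2,3) by simp

lemma cpt_Suc: "cpt \<Sigma> e \<Longrightarrow> cpt \<Sigma> (\<lambda>w \<rho>. Suc (e w \<rho>))"
  using cpt_fun1[OF cpt_Suc_var[of _ 0], of _ e] .

lemma cpt_const: "cpt \<Sigma> (\<lambda>w \<rho>. c)"
  by (induction c) (simp_all add: cpt_zero cpt_Suc)

lemma cpt_in_read: "finite \<Sigma> \<Longrightarrow> cpt \<Sigma> e \<Longrightarrow> cpt \<Sigma> (\<lambda>w \<rho>. \<phi> (in_read w (e w \<rho>)))"
  using cpt_fun1[OF cpt_read_var[of _ \<phi> 0], of _ e] .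

text \<open>
  In the rules for loops, sums and quantifiers, the premise for the body binds in the style of de
  Bruijn: the bound variables come first in the environment and the old ones are shifted.
\<close>

fun iter2 :: "(nat \<Rightarrow> nat \<Rightarrow> nat \<Rightarrow> nat) \<Rightarrow> (nat \<Rightarrow> nat \<Rightarrow> nat \<Rightarrow> nat) \<Rightarrow> nat \<Rightarrow> nat \<Rightarrow> nat \<Rightarrow> nat \<times> nat" where
  "iter2 f g x y 0 = (x, y)"
| "iter2 f g x y (Suc j) = (case iter2 f g x y j of (x', y') \<Rightarrow> (f j x' y', g j x' y'))"

lemma cpt_iter2:
  assumes a: "cpt \<Sigma> a" and b: "cpt \<Sigma> b" and n: "cpt \<Sigma> n"
    and f: "cpt \<Sigma> (\<lambda>w \<rho>. f w (\<rho> 0) (\<rho> 1) (\<rho> 2) (\<lambda>i. \<rho> (i + 3)))"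
    and g: "cpt \<Sigma> (\<lambda>w \<rho>. g w (\<rho> 0) (\<rho> 1) (\<rho> 2) (\<lambda>i. \<rho> (i + 3)))"
    and u: "poly_bounded \<Sigma> u"
    and le: "\<And>w \<rho> j. w \<in> lists \<Sigma> \<Longrightarrow> j \<le> n w \<rho> \<Longrightarrow>
      fst (iter2 (\<lambda>j x y. f w j x y \<rho>) (\<lambda>j x y. g w j x y \<rho>) (a w \<rho>) (b w \<rho>) j) \<le> u w \<rho> \<and>
      snd (iter2 (\<lambda>j x y. f w j x y \<rho>) (\<lambda>j x y. g w j x y \<rho>) (a w \<rho>) (b w \<rho>) j) \<le> u w \<rho>"
  shows "cpt \<Sigma> (\<lambda>w \<rho>. fst (iter2 (\<lambda>j x y. f w j x y \<rho>) (\<lambda>j x y. g w j x y \<rho>) (a w \<rho>) (b w \<rho>) (n w \<rho>)))"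
proof -
  let ?I = "\<lambda>w \<rho>. iter2 (\<lambda>j x y. f w j x y \<rho>) (\<lambda>j x y. g w j x y \<rho>) (a w \<rho>) (b w \<rho>)"
  \<comment> \<open>The loop keeps \<open>x\<close> and \<open>y\<close> in front because its result
    is the first variable, whereas the bodies bind the counter first; \<open>\<theta>\<close>
    reorders them and skips the countdown kept in variable 3.\<close>
  define \<theta> :: "nat \<Rightarrow> nat" where "\<theta> i = (if i = 0 then 2 else if i = 1 then 0 else if i = 2 then 1 else Suc i)" for i
  let ?es = "[a, b, \<lambda>w \<rho>. 0, n]"
  let ?fs = "[\<lambda>w \<rho>. f w (\<rho> 2) (\<rho> 0) (\<rho> 1) (\<lambda>i. \<rho> (Suc (i + 3))),
    \<lambda>w \<rho>. g w (\<rho> 2) (\<rho> 0) (\<rho> 1) (\<lambda>i. \<rho> (Suc (i + 3))), \<lambda>w \<rho>. Suc (\<rho> 2), \<lambda>w \<rho>. \<rho> 3 - 1]"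
  have Y: "iter ?fs w \<rho> j (vals ?es w \<rho>) = [fst (?I w \<rho> j), snd (?I w \<rho> j), j, n w \<rho> - j]" for w \<rho> j
    by (induction j) (simp_all add: push_def numeral_2_eq_2 numeral_3_eq_3 split_beta)
  show ?thesis
  proof (rule cpt_while[where es = ?es and fs = ?fs and g = "\<lambda>w \<rho>. \<rho> 3" and u = "\<lambda>w \<rho>. u w \<rho> + n w \<rho>"])
    show "cpt \<Sigma> e" if "e \<in> set ?es" for e using that a b n cpt_zero by auto
    have "cpt \<Sigma> (\<lambda>w \<rho>. f w (\<rho> 2) (\<rho> 0) (\<rho> 1) (\<lambda>i. \<rho> (Suc (i + 3))))"
      using cpt_reindex[OF f, of \<theta>] by (simp add: \<theta>_def)
    moreover have "cpt \<Sigma> (\<lambda>w \<rho>. g w (\<rho> 2) (\<rho> 0) (\<rho> 1) (\<lambda>i. \<rho> (Suc (i + 3))))"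
      using cpt_reindex[OF g, of \<theta>] by (simp add: \<theta>_def)
    ultimately show "cpt \<Sigma> e" if "e \<in> set ?fs" for e
      using that cpt_Suc_var[of \<Sigma> 2] cpt_pred_var[of \<Sigma> 3] by auto
    show "cpt \<Sigma> (\<lambda>w \<rho>. \<rho> 3)" by (rule cpt_var)
    show "poly_bounded \<Sigma> (\<lambda>w \<rho>. u w \<rho> + n w \<rho>)"
      by (intro poly_bounded_add u cpt_poly_bounded n)
  next
    fix w \<rho> assume w: "w \<in> lists \<Sigma>"
    show "\<exists>t ys. loop_result ?es (\<lambda>w \<rho>. \<rho> 3) ?fs w \<rho> t ys \<and> fst (?I w \<rho> (n w \<rho>)) = hd ys \<and>
      (\<forall>j\<le>t. \<forall>y \<in> set (iter ?fs w \<rho> j (vals ?es w \<rho>)). y \<le> u w \<rho> + n w \<rho>)"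
      unfolding loop_result_def Y
      by (intro exI[of _ "n w \<rho>"] exI) (use le[OF w, of _ \<rho>] in \<open>auto simp: push_def intro: trans_le_add1\<close>)
  qed simp_all
qed

lemma cpt_rec:
  assumes a: "cpt \<Sigma> a" and n: "cpt \<Sigma> n" and f: "cpt \<Sigma> (\<lambda>w \<rho>. f w (\<rho> 0) (\<rho> 1) (\<lambda>i. \<rho> (Suc (Suc i))))"
    and u: "poly_bounded \<Sigma> u"
    and le: "\<And>w \<rho> j. w \<in> lists \<Sigma> \<Longrightarrow> j \<le> n w \<rho> \<Longrightarrow> rec_nat (a w \<rho>) (\<lambda>j x. f w j x \<rho>) j \<le> u w \<rho>"
  shows "cpt \<Sigma> (\<lambda>w \<rho>. rec_nat (a w \<rho>) (\<lambda>j x. f w j x \<rho>) (n w \<rho>))"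
proof -
  have *: "iter2 (\<lambda>j x y. f w j x \<rho>) (\<lambda>j x y. 0) (a w \<rho>) 0 j = (rec_nat (a w \<rho>) (\<lambda>j x. f w j x \<rho>) j, 0)" for w \<rho> j
    by (induction j) simp_all
  have "cpt \<Sigma> (\<lambda>w \<rho>. f w (\<rho> 0) (\<rho> 1) (\<lambda>i. \<rho> (i + 3)))"
    using cpt_reindex[OF f, of "\<lambda>i. if i < 2 then i else Suc i"] by (simp add: numeral_3_eq_3)
  from cpt_iter2[OF a cpt_zero n this cpt_zero u] le show ?thesis by (simp add: *)
qed

lemmas poly_bounded_var = cpt_poly_bounded[OF cpt_var]

lemma cpt_add: assumes "cpt \<Sigma> e" "cpt \<Sigma> e'" shows "cpt \<Sigma> (\<lambda>w \<rho>. e w \<rho> + e' w \<rho>)"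
proof (rule cpt_fun2[OF _ assms])
  have *: "rec_nat x (\<lambda>_. Suc) y = x + y" for x y :: nat by (induction y) simp_all
  have "cpt \<Sigma> (\<lambda>w \<rho>. rec_nat (\<rho> 0) (\<lambda>_. Suc) (\<rho> 1))"
    by (rule cpt_rec[where u = "\<lambda>w \<rho>. \<rho> 0 + \<rho> 1"])
      (rule cpt_var cpt_Suc_var poly_bounded_add poly_bounded_var | simp add: *)+
  then show "cpt \<Sigma> (\<lambda>w \<rho>. \<rho> 0 + \<rho> 1)" by (simp add: *)
qed

lemma cpt_mult: assumes "cpt \<Sigma> e" "cpt \<Sigma> e'" shows "cpt \<Sigma> (\<lambda>w \<rho>. e w \<rho> * e' w \<rho>)"
proof (rule cpt_fun2[OF _ assms])
  have *: "rec_nat 0 (\<lambda>_ z. z + x) y = x * y" for x y :: nat by (induction y) simp_all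
  have "cpt \<Sigma> (\<lambda>w \<rho>. rec_nat 0 (\<lambda>_ z. z + \<rho> 0) (\<rho> 1))"
    by (rule cpt_rec[where u = "\<lambda>w \<rho>. \<rho> 0 * \<rho> 1"])
      (rule cpt_var cpt_zero cpt_add poly_bounded_mult poly_bounded_var | simp add: *)+
  then show "cpt \<Sigma> (\<lambda>w \<rho>. \<rho> 0 * \<rho> 1)" by (simp add: *)
qed

lemma cpt_diff: assumes "cpt \<Sigma> e" "cpt \<Sigma> e'" shows "cpt \<Sigma> (\<lambda>w \<rho>. e w \<rho> - e' w \<rho>)"
proof (rule cpt_fun2[OF _ assms])
  have *: "rec_nat x (\<lambda>_ z. z - 1) y = x - y" for x y :: nat by (induction y) simp_all
  have "cpt \<Sigma> (\<lambda>w \<rho>. rec_nat (\<rho> 0) (\<lambda>_ z. z - 1) (\<rho> 1))"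
    by (rule cpt_rec[where u = "\<lambda>w \<rho>. \<rho> 0"], unfold *)
      (rule cpt_var cpt_pred_var poly_bounded_var | simp)+
  then show "cpt \<Sigma> (\<lambda>w \<rho>. \<rho> 0 - \<rho> 1)" by (simp add: * del: One_nat_def)
qed

section \<open>Predicates, bounded sums and bounded search\<close>

definition cptp :: "'a set \<Rightarrow> ('a list \<Rightarrow> (nat \<Rightarrow> nat) \<Rightarrow> bool) \<Rightarrow> bool" where
  "cptp \<Sigma> Q \<longleftrightarrow> cpt \<Sigma> (\<lambda>w \<rho>. of_bool (Q w \<rho>))"

lemma cptp_zero: assumes "cpt \<Sigma> e" shows "cptp \<Sigma> (\<lambda>w \<rho>. e w \<rho> = 0)"
proof -
  have "(of_bool (x = 0) :: nat) = 1 - x" for x :: nat by simp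
  then show ?thesis unfolding cptp_def by (simp only:) (intro cpt_diff cpt_const assms)
qed

lemma cptp_le: assumes "cpt \<Sigma> e" "cpt \<Sigma> e'" shows "cptp \<Sigma> (\<lambda>w \<rho>. e w \<rho> \<le> e' w \<rho>)"
  using cptp_zero[OF cpt_diff[OF assms]] by simp

lemma cptp_not: assumes "cptp \<Sigma> Q" shows "cptp \<Sigma> (\<lambda>w \<rho>. \<not> Q w \<rho>)"
  using cptp_zero[OF assms[unfolded cptp_def]] by simp

lemma cptp_conj: assumes "cptp \<Sigma> Q" "cptp \<Sigma> R" shows "cptp \<Sigma> (\<lambda>w \<rho>. Q w \<rho> \<and> R w \<rho>)"
  using assms cpt_mult unfolding cptp_def of_bool_conj by blast

lemma cptp_less: assumes "cpt \<Sigma> e" "cpt \<Sigma> e'" shows "cptp \<Sigma> (\<lambda>w \<rho>. e w \<rho> < e' w \<rho>)"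
  using cptp_not[OF cptp_le[OF assms(2,1)]] by (simp add: not_le)

lemma cptp_eq: assumes "cpt \<Sigma> e" "cpt \<Sigma> e'" shows "cptp \<Sigma> (\<lambda>w \<rho>. e w \<rho> = e' w \<rho>)"
  using cptp_conj[OF cptp_le[OF assms] cptp_le[OF assms(2,1)]] by (simp add: eq_iff)

lemma cpt_if:
  assumes "cptp \<Sigma> Q" "cpt \<Sigma> e" "cpt \<Sigma> e'" shows "cpt \<Sigma> (\<lambda>w \<rho>. if Q w \<rho> then e w \<rho> else e' w \<rho>)"
proof -
  have "(if q then x else y) = of_bool q * x + (1 - of_bool q) * y" for q and x y :: nat by simp
  then show ?thesis using assms(1) unfolding cptp_def
    by (simp only:) (intro cpt_add cpt_mult cpt_diff cpt_const assms)
qed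

lemma cpt_sum:
  assumes n: "cpt \<Sigma> n" and f: "cpt \<Sigma> (\<lambda>w \<rho>. f w (\<rho> 0) (\<lambda>i. \<rho> (Suc i)))"
  shows "cpt \<Sigma> (\<lambda>w \<rho>. \<Sum>j<n w \<rho>. f w j \<rho>)"
proof -
  have *: "rec_nat 0 (\<lambda>j x. x + h j) n = (\<Sum>j<n. h j)" for h :: "nat \<Rightarrow> nat" and n
    by (induction n) simp_all
  obtain k d where kd: "\<And>w \<rho>. w \<in> lists \<Sigma> \<Longrightarrow> f w (\<rho> 0) (\<lambda>i. \<rho> (Suc i)) \<le> msr w k \<rho> ^ d"
    using cpt_poly_bounded[OF f] unfolding poly_bounded_def by blast
  \<comment> \<open>Pushing an index below \<open>n w \<rho>\<close> onto the environment raises the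
    measure by at most \<open>n w \<rho>\<close>.\<close>
  let ?u = "\<lambda>w \<rho>. n w \<rho> * (n w \<rho> + msr w k \<rho>) ^ d"
  have le: "(\<Sum>i<j. f w i \<rho>) \<le> ?u w \<rho>" if "w \<in> lists \<Sigma>" "j \<le> n w \<rho>" for w \<rho> j
  proof -
    have "f w i \<rho> \<le> (n w \<rho> + msr w k \<rho>) ^ d" if "i < j" for i
    proof -
      have "f w i \<rho> \<le> msr w k (case_nat i \<rho>) ^ d"
        using kd[OF \<open>w \<in> lists \<Sigma>\<close>, of "case_nat i \<rho>"] by simp
      also have "msr w k (case_nat i \<rho>) \<le> n w \<rho> + msr w k \<rho>"
      proof (cases k)
        case (Suc l)
        have "(\<Sum>m<Suc l. case_nat i \<rho> m) = i + (\<Sum>m<l. \<rho> m)"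
          by (simp only: sum.lessThan_Suc_shift) simp
        then show ?thesis using \<open>i < j\<close> \<open>j \<le> n w \<rho>\<close> by (simp add: msr_def Suc)
      qed (simp add: msr_def)
      then have "msr w k (case_nat i \<rho>) ^ d \<le> (n w \<rho> + msr w k \<rho>) ^ d" by (intro power_mono) simp_all
      finally show ?thesis .
    qed
    then have "(\<Sum>i<j. f w i \<rho>) \<le> j * (n w \<rho> + msr w k \<rho>) ^ d"
      using sum_bounded_above[of "{..<j}" "\<lambda>i. f w i \<rho>"] by simp
    also have "\<dots> \<le> ?u w \<rho>" using that(2) by (intro mult_right_mono) simp_all
    finally show ?thesis .
  qed
  have "cpt \<Sigma> (\<lambda>w \<rho>. rec_nat 0 (\<lambda>j x. x + f w j \<rho>) (n w \<rho>))"
  proof (rule cpt_rec[OF cpt_zero n])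
    have "cpt \<Sigma> (\<lambda>w \<rho>. f w (\<rho> 0) (\<lambda>i. \<rho> (Suc (Suc i))))"
      using cpt_reindex[OF f, of "\<lambda>i. if i = 0 then 0 else Suc i"] by simp
    then show "cpt \<Sigma> (\<lambda>w \<rho>. \<rho> 1 + f w (\<rho> 0) (\<lambda>i. \<rho> (Suc (Suc i))))"
      by (intro cpt_add cpt_var)
    show "poly_bounded \<Sigma> ?u"
      by (intro poly_bounded_mult poly_bounded_power poly_bounded_add cpt_poly_bounded[OF n] poly_bounded_msr)
    show "rec_nat 0 (\<lambda>j x. x + f w j \<rho>) j \<le> ?u w \<rho>" if "w \<in> lists \<Sigma>" "j \<le> n w \<rho>" for w \<rho> j
      unfolding * using that by (rule le)
  qed
  then show ?thesis by (simp add: *)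
qed

lemma cptp_all:
  assumes n: "cpt \<Sigma> n" and Q: "cptp \<Sigma> (\<lambda>w \<rho>. Q w (\<rho> 0) (\<lambda>i. \<rho> (Suc i)))"
  shows "cptp \<Sigma> (\<lambda>w \<rho>. \<forall>j<n w \<rho>. Q w j \<rho>)"
proof -
  have "cptp \<Sigma> (\<lambda>w \<rho>. (\<Sum>j<n w \<rho>. of_bool (\<not> Q w j \<rho>) :: nat) = 0)"
    by (intro cptp_zero cpt_sum n) (use cptp_not[OF Q] in \<open>simp add: cptp_def\<close>)
  moreover have "(\<Sum>j<n w \<rho>. of_bool (\<not> Q w j \<rho>) :: nat) = 0 \<longleftrightarrow> (\<forall>j<n w \<rho>. Q w j \<rho>)" for w \<rho>
    by auto
  ultimately show ?thesis by (simp only:)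
qed

text \<open>The least witness equals the number of indices up to which no witness has appeared,
  which turns minimisation into a bounded sum.\<close>

lemma Least_eq_sum:
  fixes n :: nat assumes "Q n"
  shows "(LEAST j. Q j) = (\<Sum>j<n. of_bool (\<forall>i<Suc j. \<not> Q i))"
proof -
  define l where "l = (LEAST j. Q j)"
  have l: "Q l" "\<And>i. Q i \<Longrightarrow> l \<le> i" unfolding l_def using assms by (auto intro: LeastI Least_le)
  have "(\<forall>i<Suc j. \<not> Q i) \<longleftrightarrow> j < l" for j
    using l by (metis less_Suc_eq_le not_le order_trans)
  then have "(\<Sum>j<n. of_bool (\<forall>i<Suc j. \<not> Q i)) = card {j \<in> {..<n}. j < l}"
    by (simp add: sum_of_bool_eq Int_def)
  also have "{j \<in> {..<n}. j < l} = {..<l}" using l(2)[OF assms] by auto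
  finally show ?thesis by (simp add: l_def)
qed

lemma cpt_Least:
  assumes n: "cpt \<Sigma> n" and Q: "cptp \<Sigma> (\<lambda>w \<rho>. Q w (\<rho> 0) (\<lambda>i. \<rho> (Suc i)))"
    and ex: "\<And>w \<rho>. w \<in> lists \<Sigma> \<Longrightarrow> Q w (n w \<rho>) \<rho>"
  shows "cpt \<Sigma> (\<lambda>w \<rho>. LEAST j. Q w j \<rho>)"
proof (rule cpt_cong)
  have "cptp \<Sigma> (\<lambda>w \<rho>. Q w (\<rho> 0) (\<lambda>i. \<rho> (Suc (Suc i))))"
    unfolding cptp_def
    using cpt_reindex[OF Q[unfolded cptp_def], of "\<lambda>i. if i = 0 then 0 else Suc i"] by simp
  then have "cptp \<Sigma> (\<lambda>w \<rho>. \<forall>i<Suc (\<rho> 0). \<not> Q w i (\<lambda>i. \<rho> (Suc i)))"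
    by (intro cptp_all cptp_not cpt_Suc_var)
  then show "cpt \<Sigma> (\<lambda>w \<rho>. \<Sum>j<n w \<rho>. of_bool (\<forall>i<Suc j. \<not> Q w i \<rho>))"
    unfolding cptp_def by (intro cpt_sum n)
  show "(\<Sum>j<n w \<rho>. of_bool (\<forall>i<Suc j. \<not> Q w i \<rho>)) = (LEAST j. Q w j \<rho>)" if "w \<in> lists \<Sigma>" for w \<rho>
    using Least_eq_sum[of "\<lambda>j. Q w j \<rho>", OF ex[OF that]] by simp
qed

lemma cpt_mod: assumes "cpt \<Sigma> e" "cpt \<Sigma> e'" shows "cpt \<Sigma> (\<lambda>w \<rho>. e w \<rho> mod e' w \<rho>)"
proof (rule cpt_fun2[OF _ assms])
  \<comment> \<open>A cyclic counter. For \<open>y = 0\<close> it never wraps and ends at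
    \<open>x\<close>, in agreement with \<open>x mod 0 = x\<close>.\<close>
  have *: "rec_nat 0 (\<lambda>_ z. if Suc z = y then 0 else Suc z) x = x mod y" for x y :: nat
    by (induction x) (simp_all add: mod_Suc)
  have "cpt \<Sigma> (\<lambda>w \<rho>. rec_nat 0 (\<lambda>_ z. if Suc z = \<rho> 1 then 0 else Suc z) (\<rho> 0))"
    by (rule cpt_rec[where u = "\<lambda>w \<rho>. \<rho> 0"], unfold *)
      (rule cpt_var cpt_zero cpt_if cptp_eq cpt_Suc_var poly_bounded_var |
        simp add: order_trans[OF mod_less_eq_dividend])+
  then show "cpt \<Sigma> (\<lambda>w \<rho>. \<rho> 0 mod \<rho> 1)" by (simp add: *)
qed

lemma cpt_div: assumes "cpt \<Sigma> e" "cpt \<Sigma> e'" shows "cpt \<Sigma> (\<lambda>w \<rho>. e w \<rho> div e' w \<rho>)"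
proof (rule cpt_fun2[OF _ assms])
  \<comment> \<open>The multiples of \<open>y\<close> among 1 to \<open>x\<close> are counted; for
    \<open>y = 0\<close> there are none, in agreement with \<open>x div 0 = 0\<close>.\<close>
  have "(\<Sum>j<x. of_bool (Suc j mod y = 0)) = x div y" for x y :: nat
    by (induction x) (simp_all add: div_Suc)
  moreover have "cpt \<Sigma> (\<lambda>w \<rho>. \<Sum>j<\<rho> 0. of_bool (Suc j mod \<rho> 1 = 0))"
    by (intro cpt_sum cpt_var cptp_zero[unfolded cptp_def] cpt_mod cpt_Suc_var)
  ultimately show "cpt \<Sigma> (\<lambda>w \<rho>. \<rho> 0 div \<rho> 1)" by simp
qed

lemma cpt_sum_const:
  fixes C :: nat
  assumes "\<And>c. c < C \<Longrightarrow> cpt \<Sigma> (f c)" shows "cpt \<Sigma> (\<lambda>w \<rho>. \<Sum>c<C. f c w \<rho>)"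
  using assms by (induction C) (simp_all add: cpt_zero cpt_add)

text \<open>Arguments below a constant form finitely many lists, so an arbitrary \<open>F\<close>
  becomes a finite case distinction. This is how the transition function of a machine, about which
  nothing else is known, enters a program.\<close>

lemma cpt_table:
  assumes "\<And>e. e \<in> set es \<Longrightarrow> cpt \<Sigma> e"
    and "\<And>w \<rho> x. w \<in> lists \<Sigma> \<Longrightarrow> x \<in> set (vals es w \<rho>) \<Longrightarrow> x < C"
  shows "cpt \<Sigma> (\<lambda>w \<rho>. F (vals es w \<rho>))"
  using assms
proof (induction es arbitrary: F)
  case Nil
  show ?case by (simp add: cpt_const)
next
  case (Cons e es)
  have IH: "cpt \<Sigma> (\<lambda>w \<rho>. F (c # vals es w \<rho>))" for c
  proof (rule Cons.IH[of "\<lambda>xs. F (c # xs)"])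
    show "x < C" if "w \<in> lists \<Sigma>" "x \<in> set (vals es w \<rho>)" for w x \<rho>
      using that by (intro Cons.prems(2)[of w x \<rho>]) simp_all
  qed (use Cons.prems(1) in simp)
  show ?case
  proof (rule cpt_cong)
    show "cpt \<Sigma> (\<lambda>w \<rho>. \<Sum>c<C. if e w \<rho> = c then F (c # vals es w \<rho>) else 0)"
      by (intro cpt_sum_const cpt_if cptp_eq cpt_const IH) (use Cons.prems in simp)
    show "(\<Sum>c<C. if e w \<rho> = c then F (c # vals es w \<rho>) else 0) = F (vals (e # es) w \<rho>)"
      if "w \<in> lists \<Sigma>" for w \<rho>
      using Cons.prems(2)[of w "e w \<rho>" \<rho>] that by simp
  qed
qed

lemma cpt_length:
  assumes "finite \<Sigma>" shows "cpt \<Sigma> (\<lambda>w \<rho>. length w)"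
proof (rule cpt_while[where es = "[\<lambda>w \<rho>. 0]" and fs = "[\<lambda>w \<rho>. Suc (\<rho> 0)]" and u = "\<lambda>w \<rho>. length w"
      and g = "\<lambda>w \<rho>. of_bool (in_read w (Suc (\<rho> 0)) \<noteq> RightEnd)"])
  show "cpt \<Sigma> (\<lambda>w \<rho>. of_bool (in_read w (Suc (\<rho> 0)) \<noteq> RightEnd))"
    by (rule cpt_in_read[OF assms cpt_Suc_var])
next
  fix w :: "'a list" and \<rho> :: "nat \<Rightarrow> nat"
  have Y: "iter [\<lambda>w \<rho>. Suc (\<rho> 0)] w \<rho> j (vals [\<lambda>w \<rho>. 0] w \<rho>) = [j]" for j
    by (induction j) (simp_all add: push_def)
  show "\<exists>t ys. loop_result [\<lambda>w \<rho>. 0] (\<lambda>w \<rho>. of_bool (in_read w (Suc (\<rho> 0)) \<noteq> RightEnd))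
      [\<lambda>w \<rho>. Suc (\<rho> 0)] w \<rho> t ys \<and> length w = hd ys \<and>
      (\<forall>j\<le>t. \<forall>y\<in>set (iter [\<lambda>w \<rho>. Suc (\<rho> 0)] w \<rho> j (vals [\<lambda>w \<rho>. 0] w \<rho>)). y \<le> length w)"
    unfolding loop_result_def Y
    by (intro exI[of _ "length w"] exI[of _ "[length w]"]) (simp add: push_def in_read_def)
qed (auto intro: cpt_zero cpt_Suc_var poly_bounded_length)

section \<open>From programs to machines\<close>

text \<open>\<open>machine_over\<close> asks for legal targets and symbols in every state and for
  every reading, whether or not it is reachable.\<close>

lemma compile_safe:
  assumes "wf_prog N c" "I \<in> set (compile a c)" "a + code_size c \<le> L" "\<And>i. y i < 5"
  shows "case I x y of (q, d, f) \<Rightarrow> q \<le> L \<and> (\<forall>i. fst (f i) < 5)"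
  using assms(1-3)
proof (induction c arbitrary: a)
  case (Write r f)
  then show ?case using assms(4) by auto
qed (use assms(4) in \<open>auto simp: branch_def goto_def\<close>)

text \<open>\<open>runs_in_space\<close> speaks about all times. A halted configuration repeats
  forever, so the bound up to the halting time is enough.\<close>

lemma reaches_halt:
  assumes "reaches M w m (init_config M) c" "step M w c = c"
  shows "\<exists>t. run M w t = c" "heads_le m (run M w t)"
proof -
  obtain t0 where t0: "(step M w ^^ t0) (init_config M) = c"
    "\<And>t. t \<le> t0 \<Longrightarrow> heads_le m ((step M w ^^ t) (init_config M))"
    using assms(1) by (auto simp: reaches_def)
  then show "\<exists>t. run M w t = c" by (auto simp: run_def)
  have "(step M w ^^ n) c = c" for n by (induction n) (simp_all add: assms(2))
  then have "(step M w ^^ (n + t0)) (init_config M) = c" for n by (simp add: funpow_add t0(1))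
  then have "run M w t = c" if "t0 \<le> t" for t
    using that unfolding run_def by (metis le_add_diff_inverse2)
  then show "heads_le m (run M w t)"
    using t0(2)[of t] t0(2)[of t0] t0(1) by (cases "t \<le> t0") (simp_all add: run_def)
qed

lemma log_space_bound:
  "(\<lambda>n. real (Suc (Suc (d * nat \<lceil>log 2 (real (n + 2))\<rceil>)))) \<in> O(\<lambda>n. ln (real n))"
proof (rule bigoI[of _ "(2 + 3 * real d) / ln 2"], rule eventually_mono[OF eventually_ge_at_top[of 2]])
  fix n :: nat assume n: "2 \<le> n"
  \<comment> \<open>From \<open>n = 2\<close> on, \<open>n + 2\<close> is at most the square of
    \<open>n\<close>, which replaces its logarithm by twice that of \<open>n\<close>.\<close>
  have "real (n + 2) \<le> real n * real n"
  proof -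
    have "n + 2 \<le> 2 * n" using n by simp
    also have "\<dots> \<le> n * n" using n by simp
    finally show ?thesis by (simp flip: of_nat_mult)
  qed
  then have "ln (real (n + 2)) \<le> ln (real n * real n)" using n by (subst ln_le_cancel_iff) auto
  also have "\<dots> = 2 * ln (real n)" using n by (simp add: ln_mult)
  finally have l: "log 2 (real (n + 2)) \<le> 2 * (ln (real n) / ln 2)"
    by (simp add: log_def divide_right_mono)
  have one: "1 \<le> ln (real n) / ln 2" using n by simp
  have "0 \<le> log 2 (real (n + 2))" by simp
  then have "real (nat \<lceil>log 2 (real (n + 2))\<rceil>) \<le> log 2 (real (n + 2)) + 1" by linarith
  also have "\<dots> \<le> 3 * (ln (real n) / ln 2)" using l one by linarith
  finally have "real d * real (nat \<lceil>log 2 (real (n + 2))\<rceil>) \<le> real d * (3 * (ln (real n) / ln 2))"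
    by (rule mult_left_mono) simp
  moreover have "real (Suc (Suc (d * nat \<lceil>log 2 (real (n + 2))\<rceil>))) =
      2 + real d * real (nat \<lceil>log 2 (real (n + 2))\<rceil>)" by (simp only: of_nat_Suc of_nat_mult)
  ultimately have "real (Suc (Suc (d * nat \<lceil>log 2 (real (n + 2))\<rceil>))) \<le>
      2 * (ln (real n) / ln 2) + real d * (3 * (ln (real n) / ln 2))"
    using one by linarith
  also have "\<dots> = (2 + 3 * real d) / ln 2 * ln (real n)" by (simp add: field_simps)
  finally show "norm (real (Suc (Suc (d * nat \<lceil>log 2 (real (n + 2))\<rceil>)))) \<le>
      (2 + 3 * real d) / ln 2 * norm (ln (real n))"
    using n by (simp only: norm_of_nat) simp
qed

theorem cpt_in_logspace:
  assumes fin: "finite \<Sigma>" and f: "cpt \<Sigma> f"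
  shows "in_logspace \<Sigma> {w \<in> lists \<Sigma>. f w (\<lambda>_. 0) \<noteq> 0}"
proof -
  obtain P k d where P: "implements \<Sigma> P k d [f]" using f unfolding cpt_def by blast
  define c where "c = P [0..<k] k"
  obtain N0 where N0: "wf_prog N0 c" using implementsD(1)[OF P] by (auto simp: c_def well_formed_def)
  define N where "N = max N0 (Suc k)"
  have N: "wf_prog N c" "wf_test N (nonzero k)" "k < N"
    using wf_prog_mono[OF N0] by (auto simp: N_def nonzero_def)
  define L where "L = code_size c"
  \<comment> \<open>The program leaves its value in register \<open>k\<close>; the appended branch
    turns a nonzero value into the accepting address and zero into the rejecting one.\<close>
  define C where "C = compile 0 c @ [branch (nonzero k) (Suc L) (Suc (Suc L))]"
  define M where "M = code_machine N C"
  have lC: "length C = Suc L" by (simp add: C_def L_def)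
  have M_simps: "num_states M = L + 3" "num_symbols M = 5" "num_tapes M = N" "start_state M = 0"
    "accept_state M = Suc L" "reject_state M = Suc (Suc L)"
    by (simp_all add: M_def code_machine_def lC)
  have safe: "case I x y of (q, d, g) \<Rightarrow> q < L + 3 \<and> (\<forall>i. fst (g i) < 5)"
    if I: "I \<in> set C" "\<forall>i. y i < 5" for I x y
  proof -
    have "case I x y of (q, d, g) \<Rightarrow> q \<le> L + 2 \<and> (\<forall>i. fst (g i) < 5)"
    proof (cases "I \<in> set (compile 0 c)")
      case True
      show ?thesis by (rule compile_safe[OF N(1) True]) (simp_all add: L_def I(2))
    next
      case False
      then show ?thesis using I by (auto simp: C_def branch_def)
    qed
    then show ?thesis by auto
  qed
  have "machine_over \<Sigma> M"
    unfolding machine_over_def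
  proof (intro conjI allI ballI impI)
    fix q x ys assume q: "q < num_states M" and ys: "length ys = num_tapes M \<and> set ys \<subseteq> {..<num_symbols M}"
    show "case transition M q x ys of (q', d, acts) \<Rightarrow>
      q' < num_states M \<and> length acts = num_tapes M \<and> fst ` set acts \<subseteq> {..<num_symbols M}"
    proof (cases "q < length C")
      case True
      let ?y = "\<lambda>i. if i < N then ys ! i else 0"
      have "\<forall>i. ?y i < 5"
        using ys nth_less[of ys 5] by (auto simp: M_simps)
      from safe[OF nth_mem[OF True] this, of x]
      have s: "case (C ! q) x ?y of (q', d, g) \<Rightarrow> q' < L + 3 \<and> (\<forall>i. fst (g i) < 5)" .
      obtain q' d g where I: "(C ! q) x ?y = (q', d, g)" by (metis prod_cases3)
      then have "transition M q x ys = (q', d, map g [0..<N])"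
        using True by (simp add: M_def code_machine_def)
      then show ?thesis using s I by (auto simp: M_simps)
    next
      case False
      then show ?thesis using q ys by (auto simp: M_simps) (auto simp: M_def code_machine_def M_simps)
    qed
  qed (simp_all add: M_simps fin)
  \<comment> \<open>The successor makes the bound \<open>msr w k \<rho> ^ d < 2 ^ m\<close>
    strict.\<close>
  moreover define mm where "mm n = Suc (d * nat \<lceil>log 2 (real (n + 2))\<rceil>)" for n
  have main: "(\<exists>t. state (run M w t) = (if f w (\<lambda>_. 0) \<noteq> 0 then accept_state M else reject_state M)) \<and>
      (\<forall>t. heads_le (mm (length w)) (run M w t))" if w: "w \<in> lists \<Sigma>" for w
  proof -
    let ?m = "mm (length w)" and ?v = "f w (\<lambda>_. 0)"
    let ?s = "(\<lambda>_. 0)(k := ?v)"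
    have "msr w k (\<lambda>_. 0) \<le> 2 ^ nat \<lceil>log 2 (real (length w + 2))\<rceil>"
    proof -
      have "real (length w + 2) = 2 powr (log 2 (real (length w + 2)))" by simp
      also have "\<dots> \<le> 2 powr (real (nat \<lceil>log 2 (real (length w + 2))\<rceil>))"
        by (intro powr_mono) linarith+
      also have "\<dots> = real (2 ^ nat \<lceil>log 2 (real (length w + 2))\<rceil>)"
        by (simp only: powr_realpow[of 2] of_nat_power of_nat_numeral zero_less_numeral)
      finally show ?thesis by (simp only: of_nat_le_iff msr_def) simp
    qed
    then have "msr w k (\<lambda>_. 0) ^ d \<le> (2 ^ nat \<lceil>log 2 (real (length w + 2))\<rceil>) ^ d" by (rule power_mono) simp
    also have "\<dots> < 2 ^ ?m" by (simp add: mm_def mult.commute flip: power_mult)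
    finally have "exec ?m w c (0, regs (\<lambda>_. 0)) (0, regs (store k (vals [f] w (\<lambda>_. 0)) (\<lambda>_. 0)))"
      unfolding c_def by (intro implementsD(4)[OF P w]) auto
    then have "exec ?m w c (0, regs (\<lambda>_. 0)) (0, regs ?s)"
      by (simp only: vals_simps store_single)
    from compile_correct[OF this N(1), of C "[]"]
    have 1: "reaches M w ?m (cfg N 0 (0, regs (\<lambda>_. 0))) (cfg N L (0, regs ?s))"
      by (simp add: C_def L_def M_def regs_def)
    have "cfg N 0 (0, regs (\<lambda>_. 0)) = init_config M"
      by (simp add: cfg_def init_config_def M_simps regs_def map_replicate_const fun_eq_iff)
    note 1 = 1[unfolded this]
    let ?q = "if ?v \<noteq> 0 then Suc L else Suc (Suc L)"
    have "step M w (cfg N L (0, regs ?s)) = cfg N (if holds w (nonzero k) (0, regs ?s) then Suc L else Suc (Suc L)) (0, regs ?s)"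
      unfolding M_def by (rule step_branch) (simp_all add: lC N C_def L_def nth_append)
    then have "step M w (cfg N L (0, regs ?s)) = cfg N ?q (0, regs ?s)"
      by (simp only: holds_nonzero fun_upd_same)
    then have 2: "reaches M w ?m (cfg N L (0, regs ?s)) (cfg N ?q (0, regs ?s))"
      by (rule reaches_step) (simp_all add: heads_le_cfg regs_def)
    have 3: "step M w (cfg N ?q (0, regs ?s)) = cfg N ?q (0, regs ?s)"
      unfolding step_def by (simp add: M_simps cfg_def)
    note halt = reaches_halt[OF reaches_trans[OF 1 2] 3]
    from halt(1) obtain t where "run M w t = cfg N ?q (0, regs ?s)" by blast
    then have "state (run M w t) = ?q" by (simp add: cfg_def)
    then show ?thesis using halt(2) by (auto simp: M_simps)
  qed
  have "decides M \<Sigma> {w \<in> lists \<Sigma>. f w (\<lambda>_. 0) \<noteq> 0}"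
    unfolding decides_def using main by auto
  moreover have "\<forall>w \<in> lists \<Sigma>. runs_in_space M w (Suc (mm (length w)))"
    using main by (fastforce simp: runs_in_space_def heads_le_def)
  moreover have "(\<lambda>n. real (Suc (mm n))) \<in> O(\<lambda>n. ln (real n))"
    unfolding mm_def by (rule log_space_bound)
  ultimately show ?thesis
    unfolding in_logspace_def by (intro exI[of _ M] exI[of _ "\<lambda>n. Suc (mm n)"] conjI)
qed

section \<open>Simulation of machines\<close>

text \<open>A tape is a number in base \<open>K\<close>, and its head position \<open>h\<close> will
  be stored as the power \<open>K ^ h\<close>. Reading is then a division followed by a remainder,
  writing an addition and a subtraction, moving a multiplication or division by \<open>K\<close>;
  for logarithmic \<open>S\<close> all these numbers are polynomial.\<close>

definition tape_num :: "nat \<Rightarrow> nat \<Rightarrow> (nat \<Rightarrow> nat) \<Rightarrow> nat" where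
  "tape_num K S t = (\<Sum>l<S. t l * K ^ l)"

lemma tape_num_less: "(\<And>l. t l < K) \<Longrightarrow> tape_num K S t < K ^ S"
proof (induction S)
  case (Suc S)
  have "t S * K ^ S + K ^ S \<le> K * K ^ S"
    using Suc.prems[of S] mult_right_mono[of "Suc (t S)" K "K ^ S"] by simp
  then show ?case using Suc.IH[OF Suc.prems] by (simp add: tape_num_def)
qed (simp add: tape_num_def)

lemma tape_num_digit:
  assumes "h < S" "\<And>l. t l < K"
  shows "tape_num K S t div K ^ h mod K = t h"
proof -
  have "0 < K" using assms(2)[of 0] by simp
  define b where "b = (\<Sum>l=Suc h..<S. t l * K ^ (l - Suc h))"
  have "tape_num K S t = (\<Sum>l=0..<h. t l * K ^ l) + (\<Sum>l=h..<S. t l * K ^ l)"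
    unfolding tape_num_def lessThan_atLeast0 by (rule sum.atLeastLessThan_concat[symmetric]) (use assms(1) in auto)
  also have "(\<Sum>l=0..<h. t l * K ^ l) = tape_num K h t" by (simp add: tape_num_def lessThan_atLeast0)
  also have "(\<Sum>l=h..<S. t l * K ^ l) = t h * K ^ h + (\<Sum>l=Suc h..<S. t l * K ^ l)"
    using assms(1) by (rule sum.atLeast_Suc_lessThan)
  also have "(\<Sum>l=Suc h..<S. t l * K ^ l) = b * K ^ Suc h"
    unfolding b_def sum_distrib_right
  proof (rule sum.cong)
    fix l assume "l \<in> {Suc h..<S}"
    then have "K ^ l = K ^ (l - Suc h) * K ^ Suc h" using power_add[of K "l - Suc h" "Suc h"] by simp
    then show "t l * K ^ l = t l * K ^ (l - Suc h) * K ^ Suc h" by (simp only: mult.assoc)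
  qed simp
  finally have "tape_num K S t = tape_num K h t + (t h + b * K) * K ^ h" by (simp add: algebra_simps)
  moreover have "tape_num K h t < K ^ h" using assms(2) by (rule tape_num_less)
  moreover have "K ^ h \<noteq> 0" using \<open>0 < K\<close> by simp
  ultimately have "tape_num K S t div K ^ h = t h + b * K" by (simp only: div_mult_self1 div_less) simp
  then show ?thesis using assms(2)[of h] by simp
qed

lemma tape_num_upd:
  assumes "h < S" shows "tape_num K S (t(h := y)) = tape_num K S t + y * K ^ h - t h * K ^ h"
proof -
  have "tape_num K S t = t h * K ^ h + (\<Sum>l\<in>{..<S} - {h}. t l * K ^ l)" for t
    unfolding tape_num_def using assms by (intro sum.remove) auto
  from this[of t] this[of "t(h := y)"] show ?thesis by simp
qed

text \<open>The leftmost position is encoded by 1. There the quotient by \<open>K\<close> is 0, and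
  the head has to stay.\<close>

fun shift_pow :: "nat \<Rightarrow> dir \<Rightarrow> nat \<Rightarrow> nat" where
  "shift_pow K MoveL x = (if x div K = 0 then 1 else x div K)"
| "shift_pow K Stay x = x"
| "shift_pow K MoveR x = x * K"

lemma shift_pow: "2 \<le> K \<Longrightarrow> shift_pow K d (K ^ h) = K ^ shift d h"
  by (cases d; cases h) auto

lemma log_space_poly:
  assumes s: "(\<lambda>n. real (s n)) \<in> O(\<lambda>n. ln (real n))" and K: "2 \<le> K"
  shows "\<exists>e. \<forall>n. K ^ s n \<le> (n + 2) ^ e"
proof -
  obtain c where c: "c > 0" "\<forall>\<^sub>F n in at_top. norm (real (s n)) \<le> c * norm (ln (real n))"
    using landau_o.bigE[OF s] by blast
  then obtain n0 where n0: "\<And>n. n0 \<le> n \<Longrightarrow> real (s n) \<le> c * \<bar>ln (real n)\<bar>"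
    by (auto simp: eventually_at_top_linorder)
  define e1 where "e1 = nat \<lceil>c * ln (real K)\<rceil>"
  \<comment> \<open>The big-O bound is silent about finitely many lengths. On these,
    \<open>K ^ s n \<le> Z \<le> 2 ^ Z \<le> (n + 2) ^ Z\<close>; elsewhere \<open>K\<close> to the
    power \<open>c * ln n\<close> is \<open>n\<close> to the power \<open>c * ln K\<close>.\<close>
  define Z where "Z = (\<Sum>n<Suc n0. K ^ s n)"
  have K0: "0 < ln (real K)" using K by simp
  have "K ^ s n \<le> (n + 2) ^ max e1 Z" for n
  proof (cases "n \<le> n0 \<or> n = 0")
    case True
    then have "K ^ s n \<le> Z" unfolding Z_def by (intro member_le_sum) auto
    also have "Z \<le> 2 ^ Z" by simp
    also have "\<dots> \<le> (n + 2) ^ Z" by (rule power_mono) simp_all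
    also have "\<dots> \<le> (n + 2) ^ max e1 Z" by (rule power_increasing) simp_all
    finally show ?thesis .
  next
    case False
    then have n: "1 \<le> n" "n0 \<le> n" by auto
    have "real (s n) \<le> c * ln (real n)" using n0[OF n(2)] n(1) by simp
    also have "\<dots> \<le> c * ln (real (n + 2))" using c(1) n(1) by (intro mult_left_mono) auto
    finally have "real (s n) * ln (real K) \<le> c * ln (real (n + 2)) * ln (real K)"
      using K0 by (intro mult_right_mono) auto
    also have "\<dots> = (c * ln (real K)) * ln (real (n + 2))" by simp
    also have "\<dots> \<le> real e1 * ln (real (n + 2))"
      unfolding e1_def by (intro mult_right_mono real_nat_ceiling_ge) simp
    finally have "ln (real K ^ s n) \<le> ln (real (n + 2) ^ e1)"
      using K by (simp add: ln_realpow)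
    then have "real K ^ s n \<le> real (n + 2) ^ e1" using K by (subst (asm) ln_le_cancel_iff) auto
    then have "K ^ s n \<le> (n + 2) ^ e1" by (metis of_nat_le_iff of_nat_power)
    also have "\<dots> \<le> (n + 2) ^ max e1 Z" by (rule power_increasing) simp_all
    finally show ?thesis .
  qed
  then show ?thesis by blast
qed

locale bounded_run =
  fixes \<Gamma> :: "'b set" and M :: "'b machine" and v :: "'b list" and S :: nat
  assumes M: "machine_over \<Gamma> M" and v: "v \<in> lists \<Gamma>" and space: "runs_in_space M v S"
begin

definition ok :: "config \<Rightarrow> bool" where
  "ok c \<longleftrightarrow> state c < num_states M \<and> in_pos c \<le> Suc (length v) \<and> length (work c) = num_tapes M \<and>
     (\<forall>(t, h) \<in> set (work c). h < S \<and> (\<forall>l. t l < num_symbols M) \<and> (\<forall>l\<ge>S. t l = 0))"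

lemma in_read_syms: "in_read v p \<in> in_syms \<Gamma>"
  using v nth_mem[of "p - 1" v] by (auto simp: in_read_def in_syms_def in_lists_conv_set)

lemma transition_ok:
  assumes "ok c" "transition M (state c) (in_read v (in_pos c)) (map (\<lambda>(t, h). t h) (work c)) = (q, d, acts)"
  shows "q < num_states M" "length acts = num_tapes M" "\<And>a. a \<in> set acts \<Longrightarrow> fst a < num_symbols M"
proof -
  let ?ys = "map (\<lambda>(t, h). t h) (work c)"
  have ys: "length ?ys = num_tapes M \<and> set ?ys \<subseteq> {..<num_symbols M}" and q: "state c < num_states M"
    using assms(1) by (auto simp: ok_def)
  have "\<forall>q < num_states M. \<forall>x \<in> in_syms \<Gamma>. \<forall>ys. length ys = num_tapes M \<and> set ys \<subseteq> {..<num_symbols M} \<longrightarrow>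
        (case transition M q x ys of (q', d, acts) \<Rightarrow>
           q' < num_states M \<and> length acts = num_tapes M \<and> fst ` set acts \<subseteq> {..<num_symbols M})"
    using M unfolding machine_over_def by (elim conjE)
  from this[rule_format, OF q in_read_syms ys]
  have "case transition M (state c) (in_read v (in_pos c)) ?ys of (q', d, acts) \<Rightarrow>
      q' < num_states M \<and> length acts = num_tapes M \<and> fst ` set acts \<subseteq> {..<num_symbols M}" .
  then show "q < num_states M" "length acts = num_tapes M" "\<And>a. a \<in> set acts \<Longrightarrow> fst a < num_symbols M"
    using assms(2) by auto
qed

lemma ok_run: "ok (run M v j)"
proof (induction j)
  case 0
  have "0 < S" if "0 < num_tapes M"
    using space that unfolding runs_in_space_def by (auto dest!: spec[of _ 0] simp: run_def init_config_def)
  then show ?case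
    using M by (auto simp: ok_def run_def init_config_def machine_over_def)
next
  case (Suc j)
  define c where "c = run M v j"
  have ok: "ok c" using Suc by (simp add: c_def)
  have r: "run M v (Suc j) = step M v c" by (simp add: run_def c_def)
  have heads: "\<And>t h. (t, h) \<in> set (work (step M v c)) \<Longrightarrow> h < S"
    using space unfolding runs_in_space_def r[symmetric] by blast
  show ?case
  proof (cases "state c \<in> {accept_state M, reject_state M}")
    case True
    then show ?thesis using ok by (simp add: r step_def)
  next
    case False
    obtain q d acts where tr: "transition M (state c) (in_read v (in_pos c)) (map (\<lambda>(t, h). t h) (work c)) = (q, d, acts)"
      by (metis prod_cases3)
    note t = transition_ok[OF ok tr]
    have st: "step M v c = \<lparr>state = q, in_pos = min (shift d (in_pos c)) (Suc (length v)),
        work = map2 act_tape acts (work c)\<rparr>"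
      using False by (simp add: step_def tr)
    have "(\<forall>l. t' l < num_symbols M) \<and> (\<forall>l\<ge>S. t' l = 0)" if "(t', h') \<in> set (work (step M v c))" for t' h'
    proof -
      obtain a T where aT: "(a, T) \<in> set (zip acts (work c))" "(t', h') = act_tape a T"
        using \<open>(t', h') \<in> _\<close> by (auto simp: st)
      obtain y d where a: "a = (y, d)" by (cases a)
      obtain t0 h0 where T: "T = (t0, h0)" by (cases T)
      have "y < num_symbols M" using t(3) set_zip_leftD[OF aT(1)[unfolded a T]] by fastforce
      moreover have "h0 < S \<and> (\<forall>l. t0 l < num_symbols M) \<and> (\<forall>l\<ge>S. t0 l = 0)"
        using ok set_zip_rightD[OF aT(1)[unfolded a T]] by (auto simp: ok_def)
      moreover have "t' = t0(h0 := y)" using aT(2) by (simp add: a T act_tape_def)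
      ultimately show ?thesis by auto
    qed
    then have "\<forall>(t', h') \<in> set (work (step M v c)). h' < S \<and> (\<forall>l. t' l < num_symbols M) \<and> (\<forall>l\<ge>S. t' l = 0)"
      using heads by fast
    moreover have "length (work c) = num_tapes M" using ok by (simp add: ok_def)
    ultimately show ?thesis
      using t(1,2) unfolding r ok_def by (simp add: st)
  qed
qed

lemma run_halted:
  assumes "state (run M v j) \<in> {accept_state M, reject_state M}" "j \<le> j'"
  shows "run M v j' = run M v j"
  using assms(2)
proof (induction j' rule: dec_induct)
  case (step j')
  then have "run M v (Suc j') = Defs.step M v (run M v j)" by (simp add: run_def)
  also have "\<dots> = run M v j" using assms(1) by (simp add: step_def)
  finally show ?case .
qed simp

end

definition config_nums :: "nat \<Rightarrow> nat \<Rightarrow> nat \<Rightarrow> config \<Rightarrow> nat list" where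
  "config_nums K T S c = state c # in_pos c # map (\<lambda>i. tape_num K S (fst (work c ! i))) [0..<T] @
     map (\<lambda>i. K ^ snd (work c ! i)) [0..<T]"

lemma push_config_nums:
  "push (config_nums K T S c) \<rho> 0 = state c"
  "push (config_nums K T S c) \<rho> (Suc 0) = in_pos c"
  "i < T \<Longrightarrow> push (config_nums K T S c) \<rho> (2 + i) = tape_num K S (fst (work c ! i))"
  "i < T \<Longrightarrow> push (config_nums K T S c) \<rho> (2 + T + i) = K ^ snd (work c ! i)"
  "push (config_nums K T S c) \<rho> (2 + 2 * T + i) = \<rho> i"
  by (auto simp: push_def config_nums_def nth_append nth_Cons')

definition dir_num :: "dir \<Rightarrow> nat" where
  "dir_num d = (case d of MoveL \<Rightarrow> 0 | Stay \<Rightarrow> 1 | MoveR \<Rightarrow> 2)"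

text \<open>Logarithmic space is closed under composition: the word \<open>v w \<rho>\<close> is
  never written down, and the simulated machine has the letter under its input head recomputed at
  every step. The space function \<open>s\<close> occurs only in the polynomial bound of the loop,
  so it need not be computable.\<close>

theorem cptp_mem:
  fixes v :: "'a list \<Rightarrow> (nat \<Rightarrow> nat) \<Rightarrow> 'b list"
  assumes L: "in_logspace \<Gamma> L" and v: "\<And>w \<rho>. w \<in> lists \<Sigma> \<Longrightarrow> v w \<rho> \<in> lists \<Gamma>"
    and read: "\<And>\<phi> :: 'b in_sym \<Rightarrow> nat. cpt \<Sigma> (\<lambda>w \<rho>. \<phi> (in_read (v w (\<lambda>i. \<rho> (Suc i))) (\<rho> 0)))"
    and len: "poly_bounded \<Sigma> (\<lambda>w \<rho>. length (v w \<rho>))"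
  shows "cptp \<Sigma> (\<lambda>w \<rho>. v w \<rho> \<in> L)"
proof -
  obtain M s where M: "machine_over \<Gamma> M" and dec: "decides M \<Gamma> L"
    and space: "\<And>x. x \<in> lists \<Gamma> \<Longrightarrow> runs_in_space M x (s (length x))"
    and s: "(\<lambda>n. real (s n)) \<in> O(\<lambda>n. ln (real n))"
    using L unfolding in_logspace_def by blast
  \<comment> \<open>The successor makes the base at least 2, so that the powers of \<open>K\<close>
    really encode head positions.\<close>
  define K T Q where "K = Suc (num_symbols M)" and "T = num_tapes M" and "Q = num_states M"
  have K: "2 \<le> K" and Q: "start_state M < Q" "accept_state M < Q" "reject_state M < Q"
    and ar: "accept_state M \<noteq> reject_state M" and fin: "finite \<Gamma>"
    using M by (auto simp: K_def Q_def machine_over_def)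
  have "finite (in_syms \<Gamma>)" using fin by (simp add: in_syms_def)
  from finite_imp_inj_to_nat_seg[OF this] obtain n :: nat and cd :: "'b in_sym \<Rightarrow> nat"
    where cd: "cd ` in_syms \<Gamma> = {i. i < n}" "inj_on cd (in_syms \<Gamma>)" by blast
  define dcd where "dcd = inv_into (in_syms \<Gamma>) cd"
  have dcd: "dcd (cd x) = x" if "x \<in> in_syms \<Gamma>" for x
    using that cd(2) by (simp add: dcd_def)
  have cdn: "cd x < n" if "x \<in> in_syms \<Gamma>" for x using that cd(1) by blast
  have inread: "in_read (v w \<rho>) p \<in> in_syms \<Gamma>" if "w \<in> lists \<Sigma>" for w \<rho> p
    using v[OF that, of \<rho>] nth_mem[of "p - 1" "v w \<rho>"]
    by (auto simp: in_read_def in_syms_def in_lists_conv_set)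
  define tr where "tr as = transition M (as ! 0) (dcd (as ! 1)) (drop 2 as)" for as
  define inp where "inp = (\<lambda>w \<rho>. cd (in_read (v w (\<lambda>i. \<rho> (2 + 2 * T + i))) (\<rho> (Suc 0))))"
  define sy where "sy i = (\<lambda>(w :: 'a list) \<rho>. \<rho> (2 + i) div \<rho> (2 + T + i) mod K)" for i
  \<comment> \<open>On encoded configurations the remainder modulo \<open>Q\<close> changes nothing;
    it is taken because \<open>cpt_table\<close> wants a constant bound in every
    environment.\<close>
  define args where "args = (\<lambda>w \<rho>. \<rho> 0 mod Q) # inp # map sy [0..<T]"
  have inp: "cpt \<Sigma> inp"
    unfolding inp_def
    using cpt_reindex[OF read[of cd], of "\<lambda>i. case i of 0 \<Rightarrow> Suc 0 | Suc i \<Rightarrow> 2 + 2 * T + i"] by simp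
  have tab: "cpt \<Sigma> (\<lambda>w \<rho>. F (vals args w \<rho>))" for F
  proof (rule cpt_table)
    show "cpt \<Sigma> e" if "e \<in> set args" for e
      using that inp by (auto simp: args_def sy_def intro!: cpt_mod cpt_div cpt_var cpt_const)
    show "x < Q + n + K" if "w \<in> lists \<Sigma>" "x \<in> set (vals args w \<rho>)" for x w \<rho>
    proof -
      have "inp w \<rho> < Q + n + K" unfolding inp_def using cdn[OF inread[OF that(1)]] by (simp add: trans_less_add1 trans_less_add2)
      moreover have "sy i w \<rho> < Q + n + K" for i
        unfolding sy_def using K by (intro trans_less_add2 mod_less_divisor) simp
      moreover have "\<rho> 0 mod Q < Q + n + K"
        using Q(1) by (intro trans_less_add1 mod_less_divisor) simp
      ultimately show ?thesis using that(2) by (auto simp: args_def vals_def)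
    qed
  qed
  \<comment> \<open>\<open>step\<close> does not let the input head pass the right end marker, so a
    right move on that marker counts as no move.\<close>
  define idir where "idir as = (let d = fst (snd (tr as)) in
      if d = MoveR \<and> dcd (as ! 1) = RightEnd then 1 else dir_num d)" for as
  define fq where "fq = (\<lambda>w \<rho>. fst (tr (vals args w \<rho>)))"
  define fp where "fp = (\<lambda>w \<rho>. if idir (vals args w \<rho>) = 0 then \<rho> (Suc 0) - 1
      else if idir (vals args w \<rho>) = 1 then \<rho> (Suc 0) else Suc (\<rho> (Suc 0)))"
  define fT where "fT i = (\<lambda>w \<rho>. \<rho> (2 + i) + fst (snd (snd (tr (vals args w \<rho>))) ! i) * \<rho> (2 + T + i)
      - sy i w \<rho> * \<rho> (2 + T + i))" for i
  define fP where "fP i = (\<lambda>w \<rho>. if dir_num (snd (snd (snd (tr (vals args w \<rho>))) ! i)) = 0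
      then (if \<rho> (2 + T + i) div K = 0 then 1 else \<rho> (2 + T + i) div K)
      else if dir_num (snd (snd (snd (tr (vals args w \<rho>))) ! i)) = 1 then \<rho> (2 + T + i)
      else \<rho> (2 + T + i) * K)" for i
  let ?fs = "fq # fp # map fT [0..<T] @ map fP [0..<T]"
  let ?es = "(\<lambda>(w :: 'a list) (\<rho> :: nat \<Rightarrow> nat). start_state M) # (\<lambda>w \<rho>. 0) # map (\<lambda>i w \<rho>. 0) [0..<T] @ map (\<lambda>i w \<rho>. 1) [0..<T]"
  let ?g = "\<lambda>(w :: 'a list) \<rho>. of_bool (\<rho> 0 \<noteq> accept_state M \<and> \<rho> 0 \<noteq> reject_state M) :: nat"
  let ?h = "\<lambda>w \<rho>. if v w \<rho> \<in> L then accept_state M else reject_state M"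
  obtain e where e: "\<And>n. K ^ s n \<le> (n + 2) ^ e" using log_space_poly[OF s K] by blast
  let ?u = "\<lambda>w \<rho>. Q + (length (v w \<rho>) + 1) + (length (v w \<rho>) + 2) ^ e"
  have "cpt \<Sigma> ?h"
  proof (rule cpt_while[where es = ?es and fs = ?fs and g = ?g and u = ?u])
    show "cpt \<Sigma> f" if "f \<in> set ?es" for f
      using that by (auto intro: cpt_const cpt_zero)
    have "cpt \<Sigma> fq" unfolding fq_def by (rule tab)
    moreover have "cpt \<Sigma> fp" unfolding fp_def
      by (intro cpt_if cptp_eq cpt_const tab cpt_var cpt_pred_var cpt_Suc_var)
    moreover have "cpt \<Sigma> (fT i)" for i
      unfolding fT_def sy_def by (intro cpt_diff cpt_add cpt_mult cpt_mod cpt_div cpt_const cpt_var tab)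
    moreover have "cpt \<Sigma> (fP i)" for i
      unfolding fP_def by (intro cpt_if cptp_eq cpt_const cpt_mult cpt_div cpt_var tab)
    ultimately show "cpt \<Sigma> f" if "f \<in> set ?fs" for f using that by auto
    show "cpt \<Sigma> ?g"
      by (intro cptp_conj[unfolded cptp_def] cptp_not[unfolded cptp_def] cptp_eq[unfolded cptp_def] cpt_var cpt_const)
    show "poly_bounded \<Sigma> ?u"
      by (intro poly_bounded_add poly_bounded_power poly_bounded_const len)
    show "length ?es = length ?fs" "0 < length ?fs" by simp_all
  next
    fix w :: "'a list" and \<rho> :: "nat \<Rightarrow> nat"
    assume w: "w \<in> lists \<Sigma>"
    define V where "V = v w \<rho>"
    define S where "S = s (length V)"
    have V: "V \<in> lists \<Gamma>" unfolding V_def by (rule v[OF w])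
    interpret R: bounded_run \<Gamma> M V S
      by unfold_locales (use M V space[OF V] in \<open>simp_all add: S_def\<close>)
    let ?enc = "config_nums K T S"
    have stp: "vals ?fs w (push (?enc c) \<rho>) = ?enc (step M V c)"
      if ok: "R.ok c" and run: "state c \<notin> {accept_state M, reject_state M}" for c
    proof -
      let ?\<sigma> = "push (?enc c) \<rho>"
      note \<sigma> = push_config_nums[where K = K and T = T and S = S and c = c and \<rho> = \<rho>]
      have lw: "length (work c) = T" using ok by (simp add: R.ok_def T_def)
      have tape: "snd (work c ! i) < S" "\<And>l. fst (work c ! i) l < K" if "i < T" for i
      proof -
        have "work c ! i \<in> set (work c)" using that lw by simp
        then show "snd (work c ! i) < S" "\<And>l. fst (work c ! i) l < K"
          using ok by (auto simp: R.ok_def K_def split_beta intro: less_SucI)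
      qed
      have sy: "sy i w ?\<sigma> = fst (work c ! i) (snd (work c ! i))" if "i < T" for i
        unfolding sy_def \<sigma>(3)[OF that] \<sigma>(4)[OF that] by (rule tape_num_digit) (use tape[OF that] in auto)
      have inp_eq: "inp w ?\<sigma> = cd (in_read V (in_pos c))"
        by (simp only: inp_def \<sigma> V_def)
      let ?x = "in_read V (in_pos c)" and ?ys = "map (\<lambda>(t, h). t h) (work c)"
      have "map (\<lambda>f. f w ?\<sigma>) (map sy [0..<T]) = ?ys"
        by (rule nth_equalityI) (simp_all add: lw sy split_beta)
      then have args: "vals args w ?\<sigma> = state c # cd ?x # ?ys"
        using ok by (simp add: args_def vals_def inp_eq \<sigma> Q_def R.ok_def)
      have dx: "dcd (cd ?x) = ?x" by (rule dcd[OF R.in_read_syms])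
      obtain q d acts where t: "transition M (state c) ?x ?ys = (q, d, acts)" by (metis prod_cases3)
      have tr: "tr (vals args w ?\<sigma>) = (q, d, acts)"
        by (simp add: tr_def args dx t)
      have la: "length acts = T" using R.transition_ok(2)[OF ok t] by (simp add: T_def)
      have st: "step M V c = \<lparr>state = q, in_pos = min (shift d (in_pos c)) (Suc (length V)),
          work = map2 act_tape acts (work c)\<rparr>"
        using run by (simp add: step_def t)
      have wk: "work (step M V c) ! i = act_tape (acts ! i) (work c ! i)" if "i < T" for i
        using that la lw by (simp add: st)
      have pos: "fp w ?\<sigma> = min (shift d (in_pos c)) (Suc (length V))"
      proof -
        have "dcd (vals args w ?\<sigma> ! 1) = ?x" by (simp add: args dx)
        then show ?thesis
          using ok unfolding fp_def idir_def tr
          by (cases d) (auto simp: dir_num_def \<sigma> R.ok_def in_read_def min_def simp del: One_nat_def)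
      qed
      have T: "fT i w ?\<sigma> = tape_num K S (fst (work (step M V c) ! i))" if "i < T" for i
        unfolding fT_def tr sy[OF that] wk[OF that] \<sigma>(3)[OF that] \<sigma>(4)[OF that]
        using tape_num_upd[OF tape(1)[OF that], of K "fst (work c ! i)"]
        by (simp add: act_tape_def split_beta)
      have P: "fP i w ?\<sigma> = K ^ snd (work (step M V c) ! i)" if "i < T" for i
      proof -
        have "fP i w ?\<sigma> = shift_pow K (snd (acts ! i)) (K ^ snd (work c ! i))"
          unfolding fP_def tr \<sigma>(4)[OF that] by (cases "snd (acts ! i)") (simp_all add: dir_num_def)
        then show ?thesis unfolding shift_pow[OF K] wk[OF that] by (simp add: act_tape_def split_beta)
      qed
      have "vals ?fs w ?\<sigma> = fq w ?\<sigma> # fp w ?\<sigma> # map (\<lambda>i. fT i w ?\<sigma>) [0..<T] @ map (\<lambda>i. fP i w ?\<sigma>) [0..<T]"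
        by (simp add: vals_def comp_def)
      also have "map (\<lambda>i. fT i w ?\<sigma>) [0..<T] = map (\<lambda>i. tape_num K S (fst (work (step M V c) ! i))) [0..<T]"
        using T by simp
      also have "map (\<lambda>i. fP i w ?\<sigma>) [0..<T] = map (\<lambda>i. K ^ snd (work (step M V c) ! i)) [0..<T]"
        using P by simp
      also have "fq w ?\<sigma> = state (step M V c)" by (simp add: fq_def tr st)
      also have "fp w ?\<sigma> = in_pos (step M V c)" by (simp add: pos st)
      finally show ?thesis by (simp only: config_nums_def[of K T S "step M V c"])
    qed
    have run_nums: "iter ?fs w \<rho> j (vals ?es w \<rho>) = ?enc (run M V j)"
      if "\<And>i. i < j \<Longrightarrow> state (run M V i) \<notin> {accept_state M, reject_state M}" for j
      using that
    proof (induction j)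
      case 0
      show ?case
        by (simp add: config_nums_def run_def init_config_def vals_def comp_def tape_num_def T_def)
    next
      case (Suc j)
      have "vals ?fs w (push (?enc (run M V j)) \<rho>) = ?enc (step M V (run M V j))"
        by (rule stp[OF R.ok_run]) (use Suc.prems in blast)
      then show ?case using Suc by (simp add: run_def)
    qed
    obtain t0 where t0: "state (run M V t0) = ?h w \<rho>"
      using dec V unfolding decides_def V_def by blast
    let ?halt = "\<lambda>t. state (run M V t) \<in> {accept_state M, reject_state M}"
    \<comment> \<open>The loop stops at the first halting time, as its guard has to be nonzero at
      all earlier ones.\<close>
    define t where "t = (LEAST t. ?halt t)"
    have h0: "?halt t0" using t0 by auto
    have t: "?halt t" "t \<le> t0" "\<And>i. i < t \<Longrightarrow> \<not> ?halt i"
      unfolding t_def by (rule LeastI[of ?halt, OF h0], rule Least_le[of ?halt, OF h0],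
        rule not_less_Least[of _ ?halt])
    have ht: "?h w \<rho> = state (run M V t)"
      using R.run_halted[OF t(1,2)] t0 by simp
    have nums: "iter ?fs w \<rho> j (vals ?es w \<rho>) = ?enc (run M V j)" if "j \<le> t" for j
      by (rule run_nums) (use t(3) that in auto)
    have bnd: "y \<le> ?u w \<rho>" if "y \<in> set (?enc (run M V j))" for y j
    proof -
      have ok: "R.ok (run M V j)" by (rule R.ok_run)
      have KS: "K ^ S \<le> (length V + 2) ^ e" unfolding S_def by (rule e)
      have "state (run M V j) < Q" "in_pos (run M V j) \<le> length V + 1"
        using ok by (simp_all add: R.ok_def Q_def)
      then have "state (run M V j) \<le> ?u w \<rho>" "in_pos (run M V j) \<le> ?u w \<rho>"
        unfolding V_def by linarith+
      moreover have "tape_num K S (fst (work (run M V j) ! i)) \<le> ?u w \<rho>"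
        "K ^ snd (work (run M V j) ! i) \<le> ?u w \<rho>" if "i < T" for i
      proof -
        have "work (run M V j) ! i \<in> set (work (run M V j))"
          using that ok by (simp add: R.ok_def T_def)
        then have h: "snd (work (run M V j) ! i) < S" "\<And>l. fst (work (run M V j) ! i) l < K"
          using ok by (auto simp: R.ok_def K_def split_beta intro: less_SucI)
        have "tape_num K S (fst (work (run M V j) ! i)) \<le> K ^ S"
          by (intro less_imp_le tape_num_less h(2))
        moreover have "K ^ snd (work (run M V j) ! i) \<le> K ^ S"
          using h(1) K by (intro power_increasing) auto
        ultimately show "tape_num K S (fst (work (run M V j) ! i)) \<le> ?u w \<rho>"
          "K ^ snd (work (run M V j) ! i) \<le> ?u w \<rho>"
          using KS unfolding V_def by linarith+
      qed
      ultimately show ?thesis using that by (auto simp: config_nums_def)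
    qed
    have "loop_result ?es ?g ?fs w \<rho> t (?enc (run M V t))"
      unfolding loop_result_def using t nums by (auto simp: push_config_nums)
    moreover have "?h w \<rho> = hd (?enc (run M V t))" using ht by (simp add: config_nums_def)
    ultimately show "\<exists>t ys. loop_result ?es ?g ?fs w \<rho> t ys \<and> ?h w \<rho> = hd ys \<and>
        (\<forall>j\<le>t. \<forall>y \<in> set (iter ?fs w \<rho> j (vals ?es w \<rho>)). y \<le> ?u w \<rho>)"
      using bnd nums by (intro exI[of _ t] exI[of _ "?enc (run M V t)"]) auto
  qed
  then have "cptp \<Sigma> (\<lambda>w \<rho>. ?h w \<rho> = accept_state M)" by (intro cptp_eq cpt_const)
  moreover have "(?h w \<rho> = accept_state M) = (v w \<rho> \<in> L)" for w \<rho> using ar by simp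
  ultimately show ?thesis by (simp only:)
qed

section \<open>Integers with many divisors\<close>

text \<open>
  The entries \<open>1 / ((n + 1) (n choose k))\<close> of Leibniz's harmonic triangle are integer combinations
  of \<open>1, 1/2, \<dots>, 1/(n + 1)\<close>.
\<close>

lemma leibniz_triangle:
  fixes z :: int
  assumes "\<And>m. 1 \<le> m \<Longrightarrow> m \<le> N \<Longrightarrow> int m dvd z" "k \<le> n" "Suc n \<le> N"
  shows "real_of_int z * (fact k * fact (n - k) / fact (Suc n)) \<in> \<int>"
  using assms(2,3)
proof (induction k arbitrary: n)
  case 0
  obtain c where c: "z = int (Suc n) * c" using assms(1)[of "Suc n"] 0 by (auto elim: dvdE)
  have "fact n / (fact (Suc n) :: real) = 1 / real (Suc n)"
    by (subst fact_Suc) (simp del: fact_Suc of_nat_Suc)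
  then have "real_of_int z * (fact 0 * fact (n - 0) / fact (Suc n)) = real_of_int c"
    by (simp add: c del: fact_Suc of_nat_Suc)
  then show ?case by simp
next
  case (Suc k)
  then obtain n' where n: "n = Suc n'" by (cases n) auto
  have frac: "a / d = c / u - b / d" if "a + b = c * m" "d = m * u" "m \<noteq> 0" for a b c d m u :: real
  proof -
    have "a = c * m - b" using that(1) by simp
    then show ?thesis using that(3) by (simp add: that(2) diff_divide_distrib)
  qed
  have kn: "k \<le> n'" using Suc.prems by (simp add: n)
  have "fact (Suc n' - k) = (real (Suc n' - k) * fact (n' - k) :: real)"
    using kn by (simp add: Suc_diff_le)
  moreover have "real (Suc n' - k) + real (Suc k) = real n' + 2" using kn by (simp add: of_nat_diff)
  ultimately have "fact (Suc k) * fact (n' - k) + fact k * fact (Suc n' - k) =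
      (fact k * fact (n' - k) * (real n' + 2) :: real)"
    by (simp add: algebra_simps) (metis distrib_left mult.commute)
  moreover have "real n' + 2 \<noteq> 0" by linarith
  moreover have "fact (Suc (Suc n')) = (real n' + 2) * (fact (Suc n') :: real)"
    by (simp add: algebra_simps)
  \<comment> \<open>The recurrence of the triangle: an entry is the entry diagonally above it minus
    its left neighbour, which makes integrality pass from the edge \<open>k = 0\<close> to all
    columns.\<close>
  ultimately have "fact (Suc k) * fact (n' - k) / fact (Suc (Suc n')) =
      fact k * fact (n' - k) / fact (Suc n') - (fact k * fact (Suc n' - k) / fact (Suc (Suc n')) :: real)"
    by (intro frac)
  then have "real_of_int z * (fact (Suc k) * fact (n - Suc k) / fact (Suc n)) =
      real_of_int z * (fact k * fact (n' - k) / fact (Suc n')) -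
      real_of_int z * (fact k * fact (n - k) / fact (Suc n))"
    by (simp add: n right_diff_distrib del: fact_Suc)
  moreover have "real_of_int z * (fact k * fact (n' - k) / fact (Suc n')) \<in> \<int>"
    using Suc.prems n by (intro Suc.IH) auto
  moreover have "real_of_int z * (fact k * fact (n - k) / fact (Suc n)) \<in> \<int>"
    using Suc.prems by (intro Suc.IH) auto
  ultimately show ?case by simp
qed

text \<open>Every entry of row \<open>n\<close> of the triangle times \<open>z\<close> is a nonzero
  integer, so \<bar>z\<bar> is at least \<open>(n + 1) * (n choose k)\<close> for each
  \<open>k\<close>. Averaging over the \<open>n + 1\<close> values of \<open>k\<close> gives the row
  sum \<open>2 ^ n\<close>.\<close>

lemma power_le_if_many_divisors:
  fixes z :: int
  assumes "\<And>m. 1 \<le> m \<Longrightarrow> m \<le> Suc n \<Longrightarrow> int m dvd z" "z \<noteq> 0"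
  shows "2 ^ n \<le> \<bar>z\<bar>"
proof -
  have "real (Suc n) * real (n choose k) \<le> \<bar>real_of_int z\<bar>" if "k \<le> n" for k
  proof -
    have f: "fact k * fact (n - k) * real (n choose k) = fact n"
      using binomial_fact_lemma[OF that] by (metis of_nat_fact of_nat_mult)
    let ?q = "real_of_int z * (fact k * fact (n - k) / fact (Suc n))"
    have "?q \<in> \<int>" by (rule leibniz_triangle[OF assms(1) that order_refl])
    moreover have "?q \<noteq> 0" using assms(2) by simp
    ultimately have "1 \<le> \<bar>?q\<bar>" by (rule Ints_nonzero_abs_ge1)
    then have "1 * (real (Suc n) * real (n choose k)) \<le> \<bar>?q\<bar> * (real (Suc n) * real (n choose k))"
      by (rule mult_right_mono) simp
    then have "real (Suc n) * real (n choose k) \<le> \<bar>?q\<bar> * (real (Suc n) * real (n choose k))"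
      by (simp only: mult_1_left)
    also have "\<dots> = \<bar>real_of_int z\<bar> * (real (Suc n) * (fact k * fact (n - k) * real (n choose k)) / fact (Suc n))"
      by (simp add: abs_mult del: fact_Suc)
    also have "\<dots> = \<bar>real_of_int z\<bar>" unfolding f fact_Suc by (simp del: fact_Suc of_nat_Suc)
    finally show ?thesis .
  qed
  then have "(\<Sum>k\<le>n. real (Suc n) * real (n choose k)) \<le> (\<Sum>k\<le>n. \<bar>real_of_int z\<bar>)"
    by (intro sum_mono) auto
  then have "real (Suc n) * (\<Sum>k\<le>n. real (n choose k)) \<le> real (Suc n) * \<bar>real_of_int z\<bar>"
    by (simp add: sum_distrib_left)
  then have "(\<Sum>k\<le>n. real (n choose k)) \<le> \<bar>real_of_int z\<bar>" by simp
  moreover have "(\<Sum>k\<le>n. real (n choose k)) = 2 ^ n"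
    using choose_row_sum[of n] by (metis of_nat_numeral of_nat_power of_nat_sum)
  ultimately have "real_of_int (2 ^ n) \<le> real_of_int \<bar>z\<bar>" by simp
  then show ?thesis by linarith
qed

section \<open>A faithful action on integer vectors\<close>

text \<open>
  With \<open>a = ((1, 2), (0, 1))\<close> and \<open>b = ((1, 0), (2, 1))\<close>, which generate a free group, this is the
  action of the matrix \<open>a\<^sup>-\<^sup>k b\<^sup>d a\<^sup>k\<close>.
\<close>

definition shear :: "int \<Rightarrow> int \<Rightarrow> int \<times> int \<Rightarrow> int \<times> int" where
  "shear k d = (\<lambda>(x, y). let x1 = x + 2 * k * y; y1 = y + 2 * d * x1 in (x1 - 2 * k * y1, y1))"

lemma shear_add: "shear k d' (shear k d v) = shear k (d + d') v"
  by (cases v) (simp add: shear_def Let_def algebra_simps)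

lemma shear_0 [simp]: "shear k 0 v = v"
  by (cases v) (simp add: shear_def)

text \<open>One round of ping-pong. The first hypothesis says that \<open>a^k\<close> takes the
  vector into the region \<bar>x\<bar> < \<bar>y\<bar>. A further nonzero power of \<open>a\<close>
  takes it to \<bar>x\<bar> > \<bar>y\<bar>, and \<open>b^d\<close> back to \<bar>x\<bar> <
  \<bar>y\<bar>; the conclusion is phrased relative to the new \<open>k'\<close>. The vector (1, 0)
  is fixed by \<open>a\<close> and may therefore start with any \<open>k'\<close>.\<close>

lemma shear_expands:
  assumes "\<bar>x + 2 * k * y\<bar> < \<bar>y\<bar> \<or> x = 1 \<and> y = 0" "k' \<noteq> k \<or> y = 0" "d \<noteq> 0" "shear k' d (x, y) = (x', y')"
  shows "\<bar>x' + 2 * k' * y'\<bar> < \<bar>y'\<bar>"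
proof -
  define x1 where "x1 = x + 2 * k' * y"
  have y': "y' = y + 2 * d * x1" and x': "x' = x1 - 2 * k' * y'"
    using assms(4) by (auto simp: shear_def Let_def x1_def)
  have "\<bar>y\<bar> < \<bar>x1\<bar>"
  proof (cases "y = 0")
    case True
    then show ?thesis using assms(1) by (auto simp: x1_def)
  next
    case False
    then have k: "k' \<noteq> k" "\<bar>x + 2 * k * y\<bar> < \<bar>y\<bar>" using assms(1,2) by auto
    have "x1 = (x + 2 * k * y) + 2 * ((k' - k) * y)" by (simp add: x1_def algebra_simps)
    moreover have "1 * \<bar>y\<bar> \<le> \<bar>(k' - k) * y\<bar>"
      unfolding abs_mult using k(1) by (intro mult_right_mono) auto
    ultimately show ?thesis using k(2) by linarith
  qed
  moreover have "1 * \<bar>x1\<bar> \<le> \<bar>d * x1\<bar>" unfolding abs_mult using assms(3) by (intro mult_right_mono) auto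
  moreover have "x' + 2 * k' * y' = x1" by (simp add: x')
  moreover have "y' = y + 2 * (d * x1)" by (simp add: y')
  ultimately show ?thesis by linarith
qed

locale tree_action = P: group P + B: group B + A: subgroup A P
  for P :: "('p, 'm) monoid_scheme" and B :: "('b, 'n) monoid_scheme" and A :: "'p set"
begin

abbreviation "D \<equiv> P\<lparr>carrier := A\<rparr> \<times>\<times> B"

sublocale amalgam P D A "\<lambda>a. a" "\<lambda>a. (a, \<one>\<^bsub>B\<^esub>)"
  by (rule amalgam_direct[OF P.group_axioms B.group_axioms A.subgroup_axioms])

definition move :: "('p set \<Rightarrow> int) \<Rightarrow> ('b \<Rightarrow> int) \<Rightarrow> 'p \<times> 'b \<Rightarrow> 'p \<times> 'b \<times> int \<times> int \<Rightarrow> 'p \<times> 'b \<times> int \<times> int" where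
  "move \<kappa> \<nu> = (\<lambda>(p, b) (\<pi>, \<beta>, v).
     (\<pi> \<otimes>\<^bsub>P\<^esub> p, \<beta> \<otimes>\<^bsub>B\<^esub> b, shear (\<kappa> (\<pi> \<otimes>\<^bsub>P\<^esub> p <#\<^bsub>P\<^esub> A)) (\<nu> (\<beta> \<otimes>\<^bsub>B\<^esub> b) - \<nu> \<beta>) v))"

definition letter_pair :: "'p + 'p \<times> 'b \<Rightarrow> 'p \<times> 'b" where
  "letter_pair = case_sum (\<lambda>p. (p, \<one>\<^bsub>B\<^esub>)) (\<lambda>q. q)"

definition run_word :: "('p set \<Rightarrow> int) \<Rightarrow> ('b \<Rightarrow> int) \<Rightarrow> ('p + 'p \<times> 'b) list \<Rightarrow> 'p \<times> 'b \<times> int \<times> int \<Rightarrow> 'p \<times> 'b \<times> int \<times> int" where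
  "run_word \<kappa> \<nu> u = fold (move \<kappa> \<nu>) (map letter_pair u)"

lemma lcoset_absorb: "\<pi> \<in> carrier P \<Longrightarrow> a \<in> A \<Longrightarrow> \<pi> \<otimes>\<^bsub>P\<^esub> a <#\<^bsub>P\<^esub> A = \<pi> <#\<^bsub>P\<^esub> A"
  using P.lcos_m_assoc[OF A.subset, of \<pi> a] P.coset_join3[of a A] A.subgroup_axioms A.mem_carrier
  by (simp add: A.subset)

lemma run_word_simps:
  "run_word \<kappa> \<nu> [] s = s"
  "run_word \<kappa> \<nu> (e # u) s = run_word \<kappa> \<nu> u (move \<kappa> \<nu> (letter_pair e) s)"
  "run_word \<kappa> \<nu> (u @ u') s = run_word \<kappa> \<nu> u' (run_word \<kappa> \<nu> u s)"
  by (simp_all add: run_word_def)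

definition states :: "('p \<times> 'b \<times> int \<times> int) set" where
  "states = carrier P \<times> carrier B \<times> UNIV"

lemma letter_pair_closed: "[e] \<in> W \<Longrightarrow> letter_pair e \<in> carrier P \<times> carrier B"
  using A.mem_carrier by (cases e) (auto simp: letter_pair_def)

lemma move_closed: "q \<in> carrier P \<times> carrier B \<Longrightarrow> s \<in> states \<Longrightarrow> move \<kappa> \<nu> q s \<in> states"
  by (auto simp: move_def states_def)

lemma run_word_closed: "u \<in> W \<Longrightarrow> s \<in> states \<Longrightarrow> run_word \<kappa> \<nu> u s \<in> states"
proof (induction u arbitrary: s)
  case (Cons e u)
  then have "[e] \<in> W" "u \<in> W" by (auto simp: amalg_words_def)
  then show ?case using Cons move_closed[OF letter_pair_closed] by (simp add: run_word_simps)
qed (simp add: run_word_simps)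

text \<open>Two cases of merging: for \<open>p' \<in> A\<close> both shears belong to the same coset
  and their exponents telescope; for \<open>b = 1\<close> the first shear has exponent 0.\<close>

lemma move_mult:
  assumes "p \<in> carrier P" "p' \<in> carrier P" "b \<in> carrier B" "b' \<in> carrier B" "s \<in> states"
    and "p' \<in> A \<or> b = \<one>\<^bsub>B\<^esub>"
  shows "move \<kappa> \<nu> (p', b') (move \<kappa> \<nu> (p, b) s) = move \<kappa> \<nu> (p \<otimes>\<^bsub>P\<^esub> p', b \<otimes>\<^bsub>B\<^esub> b') s"
proof -
  obtain \<pi> \<beta> v where s: "s = (\<pi>, \<beta>, v)" "\<pi> \<in> carrier P" "\<beta> \<in> carrier B"
    using assms(5) by (auto simp: states_def)
  have "\<pi> \<otimes>\<^bsub>P\<^esub> p \<otimes>\<^bsub>P\<^esub> p' <#\<^bsub>P\<^esub> A = \<pi> \<otimes>\<^bsub>P\<^esub> p <#\<^bsub>P\<^esub> A" if "p' \<in> A"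
    using that s assms by (intro lcoset_absorb) auto
  then show ?thesis
    using assms s by (auto simp: move_def P.m_assoc B.m_assoc shear_add)
qed

text \<open>No injectivity enters, so the invariance holds for all numberings. The multiplication
  tables follow from \<open>move_mult\<close>, and \<open>letter_pair\<close> already gives both
  sides of the gluing relation the same pair.\<close>

lemma run_word_E:
  assumes "E u u'" "s \<in> states"
  shows "run_word \<kappa> \<nu> u s = run_word \<kappa> \<nu> u' s"
  using assms
proof (induction arbitrary: s rule: amalg_eq.induct)
  case (append u u' v v')
  then have "run_word \<kappa> \<nu> u s \<in> states" using run_word_closed E_words by blast
  then show ?case using append by (simp add: run_word_simps)
next
  case one1
  then show ?case by (auto simp: run_word_simps letter_pair_def move_def states_def)
next
  case one2
  then show ?case by (auto simp: run_word_simps letter_pair_def move_def states_def)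
next
  case (mult1 x y)
  then show ?case
    by (simp add: run_word_simps letter_pair_def move_mult)
next
  case (mult2 x y)
  then show ?case
    using A.mem_carrier by (cases x; cases y) (simp add: run_word_simps letter_pair_def move_mult)
qed (simp_all add: run_word_simps letter_pair_def)

section \<open>Reduced words and ping-pong\<close>

definition spell :: "('p \<times> 'b) list \<Rightarrow> ('p + 'p \<times> 'b) list" where
  "spell ws = concat (map (\<lambda>(p, b). [Inl p, Inr (\<one>\<^bsub>P\<^esub>, b)]) ws)"

lemma spell_simps [simp]: "spell [] = []" "spell ((p, b) # ws) = Inl p # Inr (\<one>\<^bsub>P\<^esub>, b) # spell ws"
    "spell (ws @ ws') = spell ws @ spell ws'"
  by (simp_all add: spell_def)

abbreviation "pairs \<equiv> lists (carrier P \<times> carrier B)"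

lemma spell_closed: "ws \<in> pairs \<Longrightarrow> spell ws \<in> W"
  by (induction ws) auto

lemma run_spell: "ws \<in> pairs \<Longrightarrow> s \<in> states \<Longrightarrow> run_word \<kappa> \<nu> (spell ws) s = fold (move \<kappa> \<nu>) ws s"
proof (induction ws arbitrary: s)
  case (Cons q ws)
  obtain p b where q: "q = (p, b)" by (cases q)
  have "move \<kappa> \<nu> (\<one>\<^bsub>P\<^esub>, b) (move \<kappa> \<nu> (p, \<one>\<^bsub>B\<^esub>) s) = move \<kappa> \<nu> (p, b) s"
    using Cons.prems by (subst move_mult) (auto simp: q)
  moreover have "move \<kappa> \<nu> (p, b) s \<in> states" using Cons.prems by (intro move_closed) (auto simp: q)
  ultimately show ?case using Cons by (simp add: q run_word_simps letter_pair_def)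
qed (simp add: run_word_simps)

definition inB :: "'b \<Rightarrow> ('p + 'p \<times> 'b) list set" where "inB b = inj2 (\<one>\<^bsub>P\<^esub>, b)"

lemma inB_hom: "inB \<in> hom B Q"
proof (rule homI)
  show "inB b \<in> carrier Q" if "b \<in> carrier B" for b
    using that hom_in_carrier[OF inj2_hom, of "(\<one>\<^bsub>P\<^esub>, b)"] by (simp add: inB_def)
  show "inB (b \<otimes>\<^bsub>B\<^esub> b') = inB b \<otimes>\<^bsub>Q\<^esub> inB b'" if "b \<in> carrier B" "b' \<in> carrier B" for b b'
    using that hom_mult[OF inj2_hom, of "(\<one>\<^bsub>P\<^esub>, b)" "(\<one>\<^bsub>P\<^esub>, b')"] by (simp add: inB_def)
qed

lemma inj2_pair:
  assumes "a \<in> A" "b \<in> carrier B"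
  shows "inj2 (a, b) = inj1 a \<otimes>\<^bsub>Q\<^esub> inB b" "inj2 (a, b) = inB b \<otimes>\<^bsub>Q\<^esub> inj1 a"
  using hom_mult[OF inj2_hom, of "(a, \<one>\<^bsub>B\<^esub>)" "(\<one>\<^bsub>P\<^esub>, b)"] hom_mult[OF inj2_hom, of "(\<one>\<^bsub>P\<^esub>, b)" "(a, \<one>\<^bsub>B\<^esub>)"]
    assms inj_glue[of a] A.mem_carrier by (simp_all add: inB_def)

lemma closed [simp]: "p \<in> carrier P \<Longrightarrow> inj1 p \<in> carrier Q" "b \<in> carrier B \<Longrightarrow> inB b \<in> carrier Q"
  using hom_in_carrier[OF inj1_hom] hom_in_carrier[OF inB_hom] by auto

fun eval_pairs :: "('p \<times> 'b) list \<Rightarrow> ('p + 'p \<times> 'b) list set" where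
  "eval_pairs [] = \<one>\<^bsub>Q\<^esub>"
| "eval_pairs ((p, b) # ws) = inj1 p \<otimes>\<^bsub>Q\<^esub> inB b \<otimes>\<^bsub>Q\<^esub> eval_pairs ws"

lemma eval_pairs_closed [simp]: "ws \<in> pairs \<Longrightarrow> eval_pairs ws \<in> carrier Q"
  by (induction ws rule: eval_pairs.induct) auto

lemma eval_pairs_append: "ws \<in> pairs \<Longrightarrow> ws' \<in> pairs \<Longrightarrow> eval_pairs (ws @ ws') = eval_pairs ws \<otimes>\<^bsub>Q\<^esub> eval_pairs ws'"
  by (induction ws rule: eval_pairs.induct) (auto simp: Q.m_assoc)

lemma eval_pairs_spell: "ws \<in> pairs \<Longrightarrow> eval_pairs ws = R `` {spell ws}"
proof (induction ws rule: eval_pairs.induct)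
  case 1
  then show ?case by (simp add: one_class)
next
  case (2 p b ws)
  then show ?case by (simp add: inB_def inj1_def inj2_def mult_class spell_closed)
qed

text \<open>The starting coset is left out, as the initial vector (1, 0) does not depend on it.
  \<open>values_of\<close> contains the starting value, because an exponent is a difference of \<nu>
  taken before and after a syllable.\<close>

fun cosets_of :: "'p \<Rightarrow> ('p \<times> 'b) list \<Rightarrow> 'p set set" where
  "cosets_of \<pi> [] = {}"
| "cosets_of \<pi> ((p, b) # ws) = insert (\<pi> \<otimes>\<^bsub>P\<^esub> p <#\<^bsub>P\<^esub> A) (cosets_of (\<pi> \<otimes>\<^bsub>P\<^esub> p) ws)"

fun values_of :: "'b \<Rightarrow> ('p \<times> 'b) list \<Rightarrow> 'b set" where
  "values_of \<beta> [] = {\<beta>}"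
| "values_of \<beta> ((p, b) # ws) = insert \<beta> (values_of (\<beta> \<otimes>\<^bsub>B\<^esub> b) ws)"

lemma values_of_self: "\<beta> \<in> values_of \<beta> ws"
  by (induction \<beta> ws rule: values_of.induct) auto

text \<open>The first \<open>P\<close>-entry may lie in \<open>A\<close>; there is no syllable
  before it with which it could be merged.\<close>

definition reduced :: "('p \<times> 'b) list \<Rightarrow> bool" where
  "reduced ws \<longleftrightarrow> (\<forall>(p, b) \<in> set ws. b \<noteq> \<one>\<^bsub>B\<^esub>) \<and> (\<forall>(p, b) \<in> set (tl ws). p \<notin> A)"

text \<open>The factor \<open>q\<close> collects what follows the last syllable. The two inclusions
  guarantee that numberings injective on what \<open>ws\<close> visits are injective on what
  \<open>r\<close> visits; they are stated for every start because prepending a syllable shifts the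
  start.\<close>

definition reduces_to :: "('p \<times> 'b) list \<Rightarrow> ('p \<times> 'b) list \<Rightarrow> 'p \<Rightarrow> bool" where
  "reduces_to ws r q \<longleftrightarrow> r \<in> pairs \<and> q \<in> carrier P \<and> reduced r \<and>
     eval_pairs ws = eval_pairs r \<otimes>\<^bsub>Q\<^esub> inj1 q \<and>
     (\<forall>\<pi> \<in> carrier P. cosets_of \<pi> r \<subseteq> cosets_of \<pi> ws) \<and> (\<forall>\<beta> \<in> carrier B. values_of \<beta> r \<subseteq> values_of \<beta> ws)"

lemma inj1_mult: "p \<in> carrier P \<Longrightarrow> p' \<in> carrier P \<Longrightarrow> inj1 (p \<otimes>\<^bsub>P\<^esub> p') = inj1 p \<otimes>\<^bsub>Q\<^esub> inj1 p'"
  by (rule hom_mult[OF inj1_hom])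

lemma inB_mult: "b \<in> carrier B \<Longrightarrow> b' \<in> carrier B \<Longrightarrow> inB (b \<otimes>\<^bsub>B\<^esub> b') = inB b \<otimes>\<^bsub>Q\<^esub> inB b'"
  by (rule hom_mult[OF inB_hom])

lemma inB_one: "inB \<one>\<^bsub>B\<^esub> = \<one>\<^bsub>Q\<^esub>" and inj1_one: "inj1 \<one>\<^bsub>P\<^esub> = \<one>\<^bsub>Q\<^esub>"
  using hom_one[OF inB_hom B.group_axioms Q.group_axioms] hom_one[OF inj1_hom P.group_axioms Q.group_axioms]
  by auto

text \<open>An element of \<open>P\<close> on the left is absorbed by the unconstrained first entry
  of \<open>r\<close>, or by \<open>q\<close> if \<open>r\<close> is empty.\<close>

lemma merge_head:
  assumes "p \<in> carrier P" "r \<in> pairs" "q \<in> carrier P" "reduced r"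
  shows "\<exists>r' q'. r' \<in> pairs \<and> q' \<in> carrier P \<and> reduced r' \<and>
     inj1 p \<otimes>\<^bsub>Q\<^esub> (eval_pairs r \<otimes>\<^bsub>Q\<^esub> inj1 q) = eval_pairs r' \<otimes>\<^bsub>Q\<^esub> inj1 q' \<and>
     (\<forall>\<pi> \<in> carrier P. cosets_of \<pi> r' \<subseteq> cosets_of (\<pi> \<otimes>\<^bsub>P\<^esub> p) r) \<and> (\<forall>\<beta>. values_of \<beta> r' \<subseteq> values_of \<beta> r)"
proof (cases r)
  case Nil
  then show ?thesis
    using assms by (intro exI[of _ "[]"] exI[of _ "p \<otimes>\<^bsub>P\<^esub> q"]) (auto simp: inj1_mult reduced_def)
next
  case (Cons c r')
  obtain p1 b1 where c: "c = (p1, b1)" by (cases c)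
  show ?thesis
    using assms unfolding Cons c
    by (intro exI[of _ "(p \<otimes>\<^bsub>P\<^esub> p1, b1) # r'"] exI[of _ q])
      (auto simp: inj1_mult Q.m_assoc P.m_assoc reduced_def)
qed

text \<open>Syllables are prepended one at a time. A trivial \<open>b\<close> is dropped and its
  \<open>p\<close> absorbed. If the next \<open>P\<close>-entry \<open>p1\<close> lies in
  \<open>A\<close>, it commutes with \<open>b\<close> and moves to the left, the two
  \<open>B\<close>-entries are multiplied, and if they cancel, absorption applies again.\<close>

lemma reduce: "ws \<in> pairs \<Longrightarrow> \<exists>r q. reduces_to ws r q"
proof (induction ws)
  case Nil
  show ?case
    by (intro exI[of _ "[]"] exI[of _ "\<one>\<^bsub>P\<^esub>"]) (simp add: reduces_to_def reduced_def inj1_one)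
next
  case (Cons c ws)
  obtain p b where c: "c = (p, b)" by (cases c)
  have pb: "p \<in> carrier P" "b \<in> carrier B" and ws: "ws \<in> pairs" using Cons.prems by (auto simp: c)
  obtain r q where r: "r \<in> pairs" "q \<in> carrier P" "reduced r" "eval_pairs ws = eval_pairs r \<otimes>\<^bsub>Q\<^esub> inj1 q"
    and VC: "\<And>\<pi>. \<pi> \<in> carrier P \<Longrightarrow> cosets_of \<pi> r \<subseteq> cosets_of \<pi> ws"
    and VB: "\<And>\<beta>. \<beta> \<in> carrier B \<Longrightarrow> values_of \<beta> r \<subseteq> values_of \<beta> ws"
    using Cons.IH[OF ws] unfolding reduces_to_def by blast
  show ?case
  proof (cases "b = \<one>\<^bsub>B\<^esub>")
    case True
    obtain r' q' where r': "r' \<in> pairs" "q' \<in> carrier P" "reduced r'"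
      "inj1 p \<otimes>\<^bsub>Q\<^esub> (eval_pairs r \<otimes>\<^bsub>Q\<^esub> inj1 q) = eval_pairs r' \<otimes>\<^bsub>Q\<^esub> inj1 q'"
      "\<forall>\<pi> \<in> carrier P. cosets_of \<pi> r' \<subseteq> cosets_of (\<pi> \<otimes>\<^bsub>P\<^esub> p) r" "\<forall>\<beta>. values_of \<beta> r' \<subseteq> values_of \<beta> r"
      using merge_head[OF pb(1) r(1-3)] by blast
    have "eval_pairs (c # ws) = eval_pairs r' \<otimes>\<^bsub>Q\<^esub> inj1 q'"
      using r'(4) r pb by (simp add: c True inB_one)
    moreover have "cosets_of \<pi> r' \<subseteq> cosets_of \<pi> (c # ws)" if "\<pi> \<in> carrier P" for \<pi>
      using r'(5) VC[of "\<pi> \<otimes>\<^bsub>P\<^esub> p"] that pb by (auto simp: c)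
    moreover have "values_of \<beta> r' \<subseteq> values_of \<beta> (c # ws)" if "\<beta> \<in> carrier B" for \<beta>
      using r'(6) VB[OF that] that by (auto simp: c True)
    ultimately show ?thesis using r' unfolding reduces_to_def by blast
  next
    case b1: False
    show ?thesis
    proof (cases "r = [] \<or> fst (hd r) \<notin> A")
      case True
      have "reduced ((p, b) # r)"
        using True r(3) b1 by (cases r) (auto simp: reduced_def)
      moreover have "values_of \<beta> ((p, b) # r) \<subseteq> values_of \<beta> (c # ws)" if "\<beta> \<in> carrier B" for \<beta>
        using VB[of "\<beta> \<otimes>\<^bsub>B\<^esub> b"] that pb by (auto simp: c)
      moreover have "cosets_of \<pi> ((p, b) # r) \<subseteq> cosets_of \<pi> (c # ws)" if "\<pi> \<in> carrier P" for \<pi>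
        using VC[of "\<pi> \<otimes>\<^bsub>P\<^esub> p"] that pb by (auto simp: c)
      ultimately show ?thesis
        using r pb by (intro exI[of _ "(p, b) # r"] exI[of _ q]) (auto simp: reduces_to_def c Q.m_assoc)
    next
      case False
      then obtain p1 b1 r1 where r1: "r = (p1, b1) # r1" "p1 \<in> A" by (cases r) auto
      have mem: "p1 \<in> carrier P" "b1 \<in> carrier B" "r1 \<in> pairs" using r(1) r1 by auto
      have "inB b \<otimes>\<^bsub>Q\<^esub> inj1 p1 = inj1 p1 \<otimes>\<^bsub>Q\<^esub> inB b" using inj2_pair[OF r1(2) pb(2)] by simp
      then have comm: "inB b \<otimes>\<^bsub>Q\<^esub> (inj1 p1 \<otimes>\<^bsub>Q\<^esub> z) = inj1 p1 \<otimes>\<^bsub>Q\<^esub> (inB b \<otimes>\<^bsub>Q\<^esub> z)" if "z \<in> carrier Q" for z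
        using that mem pb by (simp flip: Q.m_assoc)
      have ev: "eval_pairs (c # ws) = inj1 (p \<otimes>\<^bsub>P\<^esub> p1) \<otimes>\<^bsub>Q\<^esub> (inB (b \<otimes>\<^bsub>B\<^esub> b1) \<otimes>\<^bsub>Q\<^esub> (eval_pairs r1 \<otimes>\<^bsub>Q\<^esub> inj1 q))"
        using r(2,4) mem pb by (simp add: c r1(1) Q.m_assoc comm inj1_mult inB_mult)
      have red1: "reduced r1" using r(3) by (cases r1) (auto simp: reduced_def r1)
      show ?thesis
      proof (cases "b \<otimes>\<^bsub>B\<^esub> b1 = \<one>\<^bsub>B\<^esub>")
        case True
        have pp: "p \<otimes>\<^bsub>P\<^esub> p1 \<in> carrier P" using pb mem by simp
        obtain r' q' where r': "r' \<in> pairs" "q' \<in> carrier P" "reduced r'"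
          "inj1 (p \<otimes>\<^bsub>P\<^esub> p1) \<otimes>\<^bsub>Q\<^esub> (eval_pairs r1 \<otimes>\<^bsub>Q\<^esub> inj1 q) = eval_pairs r' \<otimes>\<^bsub>Q\<^esub> inj1 q'"
          "\<forall>\<pi> \<in> carrier P. cosets_of \<pi> r' \<subseteq> cosets_of (\<pi> \<otimes>\<^bsub>P\<^esub> (p \<otimes>\<^bsub>P\<^esub> p1)) r1" "\<forall>\<beta>. values_of \<beta> r' \<subseteq> values_of \<beta> r1"
          using merge_head[OF pp mem(3) r(2) red1] by blast
        have "eval_pairs (c # ws) = eval_pairs r' \<otimes>\<^bsub>Q\<^esub> inj1 q'"
          using r'(4) ev mem r(2) by (simp add: True inB_one)
        moreover have "cosets_of \<pi> r' \<subseteq> cosets_of \<pi> (c # ws)" if "\<pi> \<in> carrier P" for \<pi>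
          using r'(5) VC[of "\<pi> \<otimes>\<^bsub>P\<^esub> p"] that pb mem by (auto simp: c r1(1) P.m_assoc)
        moreover have "values_of \<beta> r' \<subseteq> values_of \<beta> (c # ws)" if "\<beta> \<in> carrier B" for \<beta>
        proof -
          have "\<beta> \<otimes>\<^bsub>B\<^esub> b \<otimes>\<^bsub>B\<^esub> b1 = \<beta>" using True that pb mem by (simp add: B.m_assoc)
          then show ?thesis
            using r'(6) VB[of "\<beta> \<otimes>\<^bsub>B\<^esub> b"] that pb by (auto simp: c r1(1))
        qed
        ultimately show ?thesis using r' unfolding reduces_to_def by blast
      next
        case False
        have "reduced ((p \<otimes>\<^bsub>P\<^esub> p1, b \<otimes>\<^bsub>B\<^esub> b1) # r1)" using r(3) False by (auto simp: reduced_def r1)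
        moreover have "cosets_of \<pi> ((p \<otimes>\<^bsub>P\<^esub> p1, b \<otimes>\<^bsub>B\<^esub> b1) # r1) \<subseteq> cosets_of \<pi> (c # ws)" if "\<pi> \<in> carrier P" for \<pi>
          using VC[of "\<pi> \<otimes>\<^bsub>P\<^esub> p"] that pb mem by (auto simp: c r1(1) P.m_assoc)
        moreover have "values_of \<beta> ((p \<otimes>\<^bsub>P\<^esub> p1, b \<otimes>\<^bsub>B\<^esub> b1) # r1) \<subseteq> values_of \<beta> (c # ws)" if "\<beta> \<in> carrier B" for \<beta>
          using VB[of "\<beta> \<otimes>\<^bsub>B\<^esub> b"] that pb mem by (auto simp: c r1(1) B.m_assoc)
        ultimately show ?thesis
          using r mem pb ev
          by (intro exI[of _ "(p \<otimes>\<^bsub>P\<^esub> p1, b \<otimes>\<^bsub>B\<^esub> b1) # r1"] exI[of _ q]) (auto simp: reduces_to_def Q.m_assoc)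
      qed
    qed
  qed
qed

lemma lcoset_neq:
  assumes "\<pi> \<in> carrier P" "p \<in> carrier P" "p \<notin> A" shows "\<pi> \<otimes>\<^bsub>P\<^esub> p <#\<^bsub>P\<^esub> A \<noteq> \<pi> <#\<^bsub>P\<^esub> A"
proof
  assume "\<pi> \<otimes>\<^bsub>P\<^esub> p <#\<^bsub>P\<^esub> A = \<pi> <#\<^bsub>P\<^esub> A"
  moreover have "\<pi> \<otimes>\<^bsub>P\<^esub> p \<in> \<pi> \<otimes>\<^bsub>P\<^esub> p <#\<^bsub>P\<^esub> A"
    using assms A.one_closed by (force simp: l_coset_def)
  ultimately obtain a where "a \<in> A" "\<pi> \<otimes>\<^bsub>P\<^esub> p = \<pi> \<otimes>\<^bsub>P\<^esub> a" by (auto simp: l_coset_def)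
  then show False using assms A.mem_carrier by simp
qed

text \<open>Each syllable satisfies \<open>shear_expands\<close>: consecutive cosets differ because
  \<open>p\<close> is outside \<open>A\<close>, consecutive values differ because \<open>b\<close>
  is nontrivial, and injectivity carries this over to the numbers. The vector thus stays in the
  expanding region, where the second coordinate is nonzero.\<close>

lemma ping_pong:
  assumes "ws \<in> pairs" "\<pi> \<in> carrier P" "\<beta> \<in> carrier B"
    and "\<And>p b. (p, b) \<in> set ws \<Longrightarrow> b \<noteq> \<one>\<^bsub>B\<^esub>" "\<And>p b. (p, b) \<in> set ws \<Longrightarrow> p \<notin> A"
    and "inj_on \<kappa> (insert (\<pi> <#\<^bsub>P\<^esub> A) (cosets_of \<pi> ws))" "inj_on \<nu> (values_of \<beta> ws)"
    and "\<bar>x + 2 * \<kappa> (\<pi> <#\<^bsub>P\<^esub> A) * y\<bar> < \<bar>y\<bar>"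
  shows "snd (snd (snd (fold (move \<kappa> \<nu>) ws (\<pi>, \<beta>, x, y)))) \<noteq> 0"
  using assms
proof (induction ws arbitrary: \<pi> \<beta> x y rule: list.induct)
  case Nil
  then show ?case by auto
next
  case (Cons c ws)
  obtain p b where c: "c = (p, b)" by (cases c)
  have pb: "p \<in> carrier P" "b \<in> carrier B" "b \<noteq> \<one>\<^bsub>B\<^esub>" "p \<notin> A" using Cons.prems(1,4,5) by (auto simp: c)
  let ?\<pi> = "\<pi> \<otimes>\<^bsub>P\<^esub> p" and ?\<beta> = "\<beta> \<otimes>\<^bsub>B\<^esub> b"
  obtain x' y' where s: "shear (\<kappa> (?\<pi> <#\<^bsub>P\<^esub> A)) (\<nu> ?\<beta> - \<nu> \<beta>) (x, y) = (x', y')" by (cases "shear (\<kappa> (?\<pi> <#\<^bsub>P\<^esub> A)) (\<nu> ?\<beta> - \<nu> \<beta>) (x, y)")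
  have "\<kappa> (?\<pi> <#\<^bsub>P\<^esub> A) \<noteq> \<kappa> (\<pi> <#\<^bsub>P\<^esub> A)"
    using lcoset_neq[OF Cons.prems(2) pb(1,4)] Cons.prems(6) by (auto simp: c inj_on_def)
  moreover have "?\<beta> \<noteq> \<beta>" using pb Cons.prems(3) by simp
  then have "\<nu> ?\<beta> - \<nu> \<beta> \<noteq> 0"
    using Cons.prems(7) values_of_self[of ?\<beta> ws] by (auto simp: c inj_on_def)
  ultimately have "\<bar>x' + 2 * \<kappa> (?\<pi> <#\<^bsub>P\<^esub> A) * y'\<bar> < \<bar>y'\<bar>"
    using shear_expands[OF _ _ _ s] Cons.prems(8) by blast
  then have "snd (snd (snd (fold (move \<kappa> \<nu>) ws (?\<pi>, ?\<beta>, x', y')))) \<noteq> 0"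
    using Cons.prems pb by (intro Cons.IH) (auto simp: c inj_on_def)
  then show ?case by (simp add: c move_def s)
qed

text \<open>Invariance under the relations gives one direction. For the other, the word and its
  reduced form have the same effect, and by ping-pong \<open>y = 0\<close> leaves only the empty
  reduced form, that is an element of \<open>P\<close>, which is then \<pi>.\<close>

theorem eval_pairs_eq_one_iff:
  assumes ws: "ws \<in> pairs"
    and inj: "inj_on \<kappa> (cosets_of \<one>\<^bsub>P\<^esub> ws)" "inj_on \<nu> (values_of \<one>\<^bsub>B\<^esub> ws)"
    and run: "fold (move \<kappa> \<nu>) ws (\<one>\<^bsub>P\<^esub>, \<one>\<^bsub>B\<^esub>, 1, 0) = (\<pi>, \<beta>, x, y)"
  shows "eval_pairs ws = \<one>\<^bsub>Q\<^esub> \<longleftrightarrow> \<pi> = \<one>\<^bsub>P\<^esub> \<and> y = 0"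
proof
  let ?s = "(\<one>\<^bsub>P\<^esub>, \<one>\<^bsub>B\<^esub>, 1, 0)"
  have s: "?s \<in> states" by (simp add: states_def)
  {
    assume "eval_pairs ws = \<one>\<^bsub>Q\<^esub>"
    then have "E (spell ws) []"
      using ws by (simp add: eval_pairs_spell one_class class_eq_iff spell_closed)
    from run_word_E[OF this s, of \<kappa> \<nu>] show "\<pi> = \<one>\<^bsub>P\<^esub> \<and> y = 0"
      using run by (simp add: run_spell[OF ws s] run_word_simps)
  }
  assume *: "\<pi> = \<one>\<^bsub>P\<^esub> \<and> y = 0"
  obtain r q where r: "r \<in> pairs" "q \<in> carrier P" "reduced r" "eval_pairs ws = eval_pairs r \<otimes>\<^bsub>Q\<^esub> inj1 q"
    "cosets_of \<one>\<^bsub>P\<^esub> r \<subseteq> cosets_of \<one>\<^bsub>P\<^esub> ws" "values_of \<one>\<^bsub>B\<^esub> r \<subseteq> values_of \<one>\<^bsub>B\<^esub> ws"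
    using reduce[OF ws] unfolding reduces_to_def by blast
  have "E (spell ws) (spell r @ [Inl q])"
    using r(1,2,4) ws by (simp add: eval_pairs_spell inj1_def mult_class class_eq_iff spell_closed)
  from run_word_E[OF this s, of \<kappa> \<nu>]
  have eq: "move \<kappa> \<nu> (q, \<one>\<^bsub>B\<^esub>) (fold (move \<kappa> \<nu>) r ?s) = (\<pi>, \<beta>, x, y)"
    using run by (simp add: run_spell[OF ws s] run_spell[OF r(1) s] run_word_simps letter_pair_def)
  show "eval_pairs ws = \<one>\<^bsub>Q\<^esub>"
  proof (cases r)
    case Nil
    then have "q = \<pi>" using eq r(2) by (simp add: move_def)
    then show ?thesis using * r(4) Nil by (simp add: inj1_one)
  next
    \<comment> \<open>The first syllable is treated apart from \<open>ping_pong\<close>: its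
      \<open>p\<close> may lie in \<open>A\<close>, and it acts on (1, 0), which is not yet in the
      expanding region.\<close>
    case (Cons c r')
    obtain p b where c: "c = (p, b)" by (cases c)
    have pb: "p \<in> carrier P" "b \<in> carrier B" "b \<noteq> \<one>\<^bsub>B\<^esub>" "r' \<in> pairs" using r(1,3) by (auto simp: Cons c reduced_def)
    have nb: "\<And>p b. (p, b) \<in> set r' \<Longrightarrow> b \<noteq> \<one>\<^bsub>B\<^esub>" "\<And>p b. (p, b) \<in> set r' \<Longrightarrow> p \<notin> A"
      using r(3) by (auto simp: Cons c reduced_def)
    obtain x' y' where s': "shear (\<kappa> (p <#\<^bsub>P\<^esub> A)) (\<nu> b - \<nu> \<one>\<^bsub>B\<^esub>) (1, 0) = (x', y')"
      by (cases "shear (\<kappa> (p <#\<^bsub>P\<^esub> A)) (\<nu> b - \<nu> \<one>\<^bsub>B\<^esub>) (1, 0)")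
    have ik: "inj_on \<kappa> (insert (p <#\<^bsub>P\<^esub> A) (cosets_of p r'))" and iv: "inj_on \<nu> (insert \<one>\<^bsub>B\<^esub> (values_of b r'))"
      using inj_on_subset[OF inj(1) r(5)] inj_on_subset[OF inj(2) r(6)] pb by (simp_all add: Cons c)
    have "\<nu> b - \<nu> \<one>\<^bsub>B\<^esub> \<noteq> 0"
      using iv pb(3) values_of_self[of b r'] by (auto simp: inj_on_def)
    then have "\<bar>x' + 2 * \<kappa> (p <#\<^bsub>P\<^esub> A) * y'\<bar> < \<bar>y'\<bar>"
      by (intro shear_expands[OF _ _ _ s']) auto
    then have "snd (snd (snd (fold (move \<kappa> \<nu>) r' (p, b, x', y')))) \<noteq> 0"
      using ik inj_on_subset[OF iv subset_insertI] pb by (intro ping_pong nb)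
    moreover have "fold (move \<kappa> \<nu>) r ?s = fold (move \<kappa> \<nu>) r' (p, b, x', y')"
      using pb by (simp add: Cons c move_def s')
    ultimately have "snd (snd (snd (fold (move \<kappa> \<nu>) r ?s))) \<noteq> 0" by metis
    moreover have "fold (move \<kappa> \<nu>) r ?s \<in> states"
      using run_word_closed[OF spell_closed[OF r(1)] s] by (simp add: run_spell[OF r(1) s])
    \<comment> \<open>The final letter \<open>q\<close> has trivial \<open>B\<close>-entry, so its
      shear has exponent 0 and leaves the vector alone.\<close>
    ultimately have "snd (snd (snd (move \<kappa> \<nu> (q, \<one>\<^bsub>B\<^esub>) (fold (move \<kappa> \<nu>) r ?s)))) \<noteq> 0"
      by (auto simp: move_def states_def split_beta)
    then show ?thesis using eq * by simp
  qed
qed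

end

section \<open>Homomorphic images of infixes\<close>

definition infix_image :: "('a \<Rightarrow> 'b list) \<Rightarrow> nat \<Rightarrow> nat \<Rightarrow> 'a list \<Rightarrow> 'b list" where
  "infix_image h i j w = concat (map h (drop i (take j w)))"

lemma infix_image_upt:
  "infix_image h i j w = concat (map (\<lambda>l. if i \<le> l \<and> l < j then h (w ! l) else []) [0..<length w])"
proof (induction w rule: rev_induct)
  case (snoc a w)
  let ?H = "\<lambda>w l. if i \<le> l \<and> l < j then h (w ! l) else []"
  have "drop i (take j (w @ [a])) = drop i (take j w) @ (if i \<le> length w \<and> length w < j then [a] else [])"
    by (cases "j \<le> length w"; cases "i \<le> length w") (auto simp: take_Cons' drop_Cons')
  then have "infix_image h i j (w @ [a]) = concat (map (?H w) [0..<length w]) @ ?H (w @ [a]) (length w)"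
    using snoc by (auto simp: infix_image_def)
  also have "map (?H w) [0..<length w] = map (?H (w @ [a])) [0..<length w]"
    by (simp add: nth_append)
  finally show ?case by simp
qed (simp add: infix_image_def)

text \<open>Reads one letter of a concatenation without building it: block \<open>l\<close> starts
  at the total length of the earlier blocks, so at most one pair of \<open>l\<close> and
  \<open>q\<close> hits position \<open>p\<close>, and past the end the sum is 0.\<close>

lemma nth_concat_sum:
  fixes f :: "'b \<Rightarrow> nat"
  assumes "\<And>l. l < n \<Longrightarrow> length (H l) \<le> C"
  shows "(\<Sum>l<n. \<Sum>q<C. if length (concat (map H [0..<l])) + q = p \<and> q < length (H l) then f (H l ! q) else 0) =
    (if p < length (concat (map H [0..<n])) then f (concat (map H [0..<n]) ! p) else 0)"
  using assms
proof (induction n)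
  case (Suc n)
  let ?L = "length (concat (map H [0..<n]))"
  have "(\<Sum>q<C. if ?L + q = p \<and> q < length (H n) then f (H n ! q) else 0) =
      (if ?L \<le> p \<and> p - ?L < length (H n) then f (H n ! (p - ?L)) else 0)"
  proof (cases "?L \<le> p")
    case True
    have "(\<Sum>q<C. if ?L + q = p \<and> q < length (H n) then f (H n ! q) else 0) =
        (\<Sum>q<C. if q = p - ?L then (if p - ?L < length (H n) then f (H n ! (p - ?L)) else 0) else 0)"
      using True by (intro sum.cong) auto
    also have "\<dots> = (if p - ?L < length (H n) then f (H n ! (p - ?L)) else 0)"
      using Suc.prems[of n] by auto
    finally show ?thesis using True by simp
  qed simp
  then show ?case using Suc by (auto simp: nth_append simp del: length_concat)
qed simp

definition letter_num :: "('a \<Rightarrow> nat) \<Rightarrow> 'a in_sym \<Rightarrow> nat" where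
  "letter_num g x = (case x of Letter a \<Rightarrow> g a | _ \<Rightarrow> 0)"

lemma letter_num_read: "l < length w \<Longrightarrow> letter_num g (in_read w (Suc l)) = g (w ! l)"
  by (simp add: letter_num_def in_read_def)

lemma cpt_infix_read:
  fixes \<phi> :: "'b in_sym \<Rightarrow> nat" and h :: "'a \<Rightarrow> 'b list"
  assumes "finite \<Sigma>"
  shows "cpt \<Sigma> (\<lambda>w \<rho>. \<phi> (in_read (infix_image h (\<rho> (Suc 0)) (\<rho> 2) w) (\<rho> 0)))"
proof (rule cpt_cong)
  define C where "C = (\<Sum>a\<in>\<Sigma>. length (h a))"
  define lenH where "lenH = (\<lambda>(w :: 'a list) l i j. if i \<le> l \<and> l < j then letter_num (\<lambda>a. length (h a)) (in_read w (Suc l)) else 0)"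
  \<comment> \<open>Position 0 is the left end marker, so the index of a letter is
    \<open>\<rho> 0 - 1\<close>. As \<open>C\<close> bounds the length of every block, the inner sum
    has a fixed number of terms.\<close>
  let ?f = "\<lambda>w \<rho>. if \<rho> 0 = 0 then \<phi> LeftEnd
    else if (\<Sum>l'<length w. lenH w l' (\<rho> (Suc 0)) (\<rho> 2)) < \<rho> 0 then \<phi> RightEnd
    else \<Sum>l<length w. \<Sum>q<C. if (\<Sum>l'<l. lenH w l' (\<rho> (Suc 0)) (\<rho> 2)) + q = \<rho> 0 - 1 \<and> q < lenH w l (\<rho> (Suc 0)) (\<rho> 2)
      then letter_num (\<lambda>a. \<phi> (Letter (h a ! q))) (in_read w (Suc l)) else 0"
  show "cpt \<Sigma> ?f"
    unfolding lenH_def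
    by (rule cpt_const cpt_var cpt_if cptp_conj cptp_le cptp_less cptp_eq cpt_sum_const cpt_sum cpt_add cpt_diff
        cpt_length[OF assms] cpt_Suc cpt_in_read[OF assms])+
  fix w and \<rho> :: "nat \<Rightarrow> nat" assume w: "w \<in> lists \<Sigma>"
  define H where "H l = (if \<rho> (Suc 0) \<le> l \<and> l < \<rho> 2 then h (w ! l) else [])" for l
  have C: "length (H l) \<le> C" if "l < length w" for l
  proof -
    have "w ! l \<in> \<Sigma>" using that w nth_mem by (auto simp: in_lists_conv_set)
    then have "length (h (w ! l)) \<le> C" unfolding C_def by (intro member_le_sum) (auto simp: assms)
    then show ?thesis by (simp add: H_def)
  qed
  have lH: "lenH w l (\<rho> (Suc 0)) (\<rho> 2) = length (H l)" if "l < length w" for l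
    using that by (simp add: lenH_def H_def letter_num_read)
  have off: "(\<Sum>l'<l. lenH w l' (\<rho> (Suc 0)) (\<rho> 2)) = length (concat (map H [0..<l]))" if "l \<le> length w" for l
  proof -
    have "(\<Sum>l'<l. lenH w l' (\<rho> (Suc 0)) (\<rho> 2)) = (\<Sum>l'<l. length (H l'))"
      using that by (intro sum.cong) (auto simp: lH)
    also have "\<dots> = length (concat (map H [0..<l]))"
      by (simp add: length_concat comp_def interv_sum_list_conv_sum_set_nat lessThan_atLeast0)
    finally show ?thesis .
  qed
  let ?v = "infix_image h (\<rho> (Suc 0)) (\<rho> 2) w"
  have v: "?v = concat (map H [0..<length w])" unfolding infix_image_upt H_def ..
  have "(\<Sum>l<length w. \<Sum>q<C. if (\<Sum>l'<l. lenH w l' (\<rho> (Suc 0)) (\<rho> 2)) + q = \<rho> 0 - 1 \<and> q < lenH w l (\<rho> (Suc 0)) (\<rho> 2)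
      then letter_num (\<lambda>a. \<phi> (Letter (h a ! q))) (in_read w (Suc l)) else 0) =
    (\<Sum>l<length w. \<Sum>q<C. if length (concat (map H [0..<l])) + q = \<rho> 0 - 1 \<and> q < length (H l)
      then \<phi> (Letter (H l ! q)) else 0)"
  proof (intro sum.cong HOL.refl)
    fix l q assume "l \<in> {..<length w}"
    then have l: "l < length w" "l \<le> length w" by simp_all
    have "H l = [] \<or> H l = h (w ! l)" by (simp add: H_def)
    then show "(if (\<Sum>l'<l. lenH w l' (\<rho> (Suc 0)) (\<rho> 2)) + q = \<rho> 0 - 1 \<and> q < lenH w l (\<rho> (Suc 0)) (\<rho> 2)
        then letter_num (\<lambda>a. \<phi> (Letter (h a ! q))) (in_read w (Suc l)) else 0) =
      (if length (concat (map H [0..<l])) + q = \<rho> 0 - 1 \<and> q < length (H l)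
        then \<phi> (Letter (H l ! q)) else 0)"
      unfolding off[OF l(2)] lH[OF l(1)] letter_num_read[OF l(1)] by auto
  qed
  also have "\<dots> = (if \<rho> 0 - 1 < length ?v then \<phi> (Letter (?v ! (\<rho> 0 - 1))) else 0)"
    unfolding v by (rule nth_concat_sum[OF C])
  finally show "?f w \<rho> = \<phi> (in_read ?v (\<rho> 0))"
    using off[of "length w"] by (simp add: in_read_def v del: length_concat) auto
qed

lemma cptp_infix:
  fixes h :: "'a \<Rightarrow> 'b list"
  assumes fin: "finite \<Sigma>" and L: "in_logspace \<Gamma> L" and h: "\<And>a. a \<in> \<Sigma> \<Longrightarrow> h a \<in> lists \<Gamma>"
    and e: "cpt \<Sigma> e" and e': "cpt \<Sigma> e'"
  shows "cptp \<Sigma> (\<lambda>w \<rho>. infix_image h (e w \<rho>) (e' w \<rho>) w \<in> L)"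
proof -
  have "cptp \<Sigma> (\<lambda>w \<rho>. infix_image h (\<rho> 0) (\<rho> 1) w \<in> L)"
  proof (rule cptp_mem[OF L])
    show "infix_image h (\<rho> 0) (\<rho> 1) w \<in> lists \<Gamma>" if "w \<in> lists \<Sigma>" for w and \<rho> :: "nat \<Rightarrow> nat"
      using that h by (fastforce simp: infix_image_def in_lists_conv_set dest: in_set_dropD in_set_takeD)
    show "cpt \<Sigma> (\<lambda>w \<rho>. \<phi> (in_read (infix_image h (\<rho> (Suc 0)) (\<rho> (Suc 1)) w) (\<rho> 0)))" for \<phi> :: "'b in_sym \<Rightarrow> nat"
      using cpt_infix_read[OF fin, of \<phi> h] by (simp add: numeral_2_eq_2)
    let ?C = "\<Sum>a\<in>\<Sigma>. length (h a)"
    have "length (infix_image h i j w) \<le> ?C * length w" if "w \<in> lists \<Sigma>" for w i j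
    proof -
      have "length (concat (map h u)) \<le> ?C * length u" if "u \<in> lists \<Sigma>" for u
        using that
      proof (induction u)
        case (Cons a u)
        then have "length (h a) \<le> ?C" using fin by (intro member_le_sum) auto
        then show ?case using Cons by simp
      qed simp
      moreover have "drop i (take j w) \<in> lists \<Sigma>"
        using that by (auto simp: in_lists_conv_set dest: in_set_dropD in_set_takeD)
      ultimately have "length (infix_image h i j w) \<le> ?C * length (drop i (take j w))"
        unfolding infix_image_def by blast
      also have "\<dots> \<le> ?C * length w" by (intro mult_left_mono) auto
      finally show ?thesis .
    qed
    then show "poly_bounded \<Sigma> (\<lambda>w \<rho>. length (infix_image h (\<rho> 0) (\<rho> 1) w))"
      by (intro poly_bounded_mono[OF poly_bounded_mult[OF poly_bounded_const[of _ ?C] poly_bounded_length]])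
  qed
  from cpt_comp[OF this[unfolded cptp_def], of "\<lambda>i. if i = 0 then e else e'"] e e'
  show ?thesis by (simp add: cptp_def)
qed

theorem in_logspace_inverse_hom:
  assumes "finite \<Sigma>" "in_logspace \<Gamma> L" "\<And>a. a \<in> \<Sigma> \<Longrightarrow> h a \<in> lists \<Gamma>"
  shows "in_logspace \<Sigma> {w \<in> lists \<Sigma>. concat (map h w) \<in> L}"
proof -
  have "cptp \<Sigma> (\<lambda>w \<rho>. infix_image h 0 (length w) w \<in> L)"
    by (rule cptp_infix[OF assms cpt_const cpt_length[OF assms(1)]])
  from cpt_in_logspace[OF assms(1) this[unfolded cptp_def]] show ?thesis
    by (simp add: infix_image_def)
qed

section \<open>The word problem\<close>

lemma (in group) word_value_simps [simp]:
  "word_value G [] = \<one>" "word_value G (x # u) = x \<otimes> word_value G u"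
  by (simp_all add: word_value_def)

lemma (in group) word_value_closed [simp]: "u \<in> lists (carrier G) \<Longrightarrow> word_value G u \<in> carrier G"
  by (induction u) auto

lemma (in group) word_value_append:
  "u \<in> lists (carrier G) \<Longrightarrow> u' \<in> lists (carrier G) \<Longrightarrow> word_value G (u @ u') = word_value G u \<otimes> word_value G u'"
  by (induction u) (auto simp: m_assoc)

lemma (in group) sym_gen_word:
  assumes "sym_gen_set G S" "x \<in> carrier G"
  shows "\<exists>u \<in> lists S. word_value G u = x"
proof -
  have S: "S \<subseteq> carrier G" "\<forall>x \<in> S. inv x \<in> S" using assms(1) by (auto simp: sym_gen_set_def)
  have "x \<in> generate G S" using assms by (simp add: sym_gen_set_def)
  then show ?thesis
  proof (induction rule: generate.induct)
    case one
    show ?case by (rule bexI[of _ "[]"]) auto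
  next
    case (incl x)
    then show ?case using S by (intro bexI[of _ "[x]"]) auto
  next
    case (inv x)
    then show ?case using S by (intro bexI[of _ "[inv x]"]) auto
  next
    case (eng x y)
    then obtain u u' where u: "u \<in> lists S" "word_value G u = x" "u' \<in> lists S" "word_value G u' = y" by blast
    have "lists S \<subseteq> lists (carrier G)" using S(1) by (rule lists_mono)
    then have "word_value G (u @ u') = x \<otimes> y" using u by (subst word_value_append) auto
    then show ?case using u by (intro bexI[of _ "u @ u'"]) auto
  qed
qed

lemma (in group) word_value_concat:
  assumes "\<And>a. a \<in> set w \<Longrightarrow> h a \<in> lists (carrier G) \<and> word_value G (h a) = g a"
  shows "concat (map h w) \<in> lists (carrier G) \<and> word_value G (concat (map h w)) = word_value G (map g w)"
  using assms by (induction w) (auto simp: word_value_append)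

text \<open>Needed for tests on the infix from \<open>j\<close> to \<open>i\<close>: for
  \<open>j > i\<close> this infix is empty and always passes. The least indices still agree since
  \<open>i\<close> itself is a witness for both predicates.\<close>

lemma Least_eq_bounded:
  fixes n :: nat
  assumes "P n" "Q n" "\<And>j. j \<le> n \<Longrightarrow> P j \<longleftrightarrow> Q j"
  shows "(LEAST j. P j) = (LEAST j. Q j)"
proof (rule antisym)
  have "(LEAST j. Q j) \<le> n" "(LEAST j. P j) \<le> n" using assms(1,2) by (auto intro: Least_le)
  moreover have "Q (LEAST j. Q j)" "P (LEAST j. P j)" using assms(1,2) by (auto intro: LeastI)
  ultimately show "(LEAST j. P j) \<le> (LEAST j. Q j)" "(LEAST j. Q j) \<le> (LEAST j. P j)"
    using assms(3) by (auto intro!: Least_le)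
qed

text \<open>The cube stems from the three elementary operations in \<open>shear\<close>, each of
  which enlarges the entries by a factor of at most \<open>1 + 2 * n\<close>.\<close>

lemma shear_bound:
  assumes "\<bar>k\<bar> \<le> n" "\<bar>d\<bar> \<le> n" "\<bar>fst v\<bar> \<le> c" "\<bar>snd v\<bar> \<le> c"
  shows "\<bar>fst (shear k d v)\<bar> \<le> (1 + 2 * n) ^ 3 * c" "\<bar>snd (shear k d v)\<bar> \<le> (1 + 2 * n) ^ 3 * c"
proof -
  obtain x y where v: "v = (x, y)" by (cases v)
  define a where "a = 1 + 2 * n"
  have n: "0 \<le> n" using assms(1) by linarith
  have a: "1 \<le> a" "2 * n = a - 1" using n by (auto simp: a_def)
  have add: "\<bar>p + 2 * k' * q\<bar> \<le> a * c'" if "\<bar>p\<bar> \<le> c'" "\<bar>q\<bar> \<le> c'" "\<bar>k'\<bar> \<le> n" for p q k' c' :: int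
  proof -
    have "\<bar>k' * q\<bar> \<le> n * c'" unfolding abs_mult using that n by (intro mult_mono) auto
    then have "\<bar>p + 2 * (k' * q)\<bar> \<le> c' + 2 * (n * c')" using that(1) by linarith
    then show ?thesis by (simp add: a_def algebra_simps)
  qed
  define x1 where "x1 = x + 2 * k * y"
  define y1 where "y1 = y + 2 * d * x1"
  have c: "0 \<le> c" using assms(3) by linarith
  have ac: "c \<le> a * c" using mult_right_mono[OF a(1) c] by simp
  have aac: "a * c \<le> a * (a * c)" using mult_right_mono[OF a(1), of "a * c"] ac c by simp
  have 1: "\<bar>x1\<bar> \<le> a * c" unfolding x1_def using assms v by (intro add) auto
  have 2: "\<bar>y1\<bar> \<le> a * (a * c)" unfolding y1_def using 1 ac assms v by (intro add) auto
  have 3: "\<bar>x1 + 2 * (- k) * y1\<bar> \<le> a * (a * (a * c))" using 1 2 aac assms by (intro add) auto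
  have sh: "shear k d v = (x1 + 2 * (- k) * y1, y1)" by (simp add: shear_def v Let_def x1_def y1_def)
  have cube: "(1 + 2 * n) ^ 3 * c = a * (a * (a * c))" by (simp add: a_def power3_eq_cube)
  have 4: "a * (a * c) \<le> a * (a * (a * c))" using mult_left_mono[OF aac, of a] a(1) by simp
  show "\<bar>fst (shear k d v)\<bar> \<le> (1 + 2 * n) ^ 3 * c" "\<bar>snd (shear k d v)\<bar> \<le> (1 + 2 * n) ^ 3 * c"
    unfolding sh cube using 2 3 4 by simp_all
qed

section \<open>Numbering by first occurrence and the size of the vector\<close>

context tree_action
begin

definition ppre :: "('p \<times> 'b) list \<Rightarrow> nat \<Rightarrow> 'p" where
  "ppre ws j = word_value P (map fst (take j ws))"

definition bpre :: "('p \<times> 'b) list \<Rightarrow> nat \<Rightarrow> 'b" where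
  "bpre ws j = word_value B (map snd (take j ws))"

definition cidx :: "('p \<times> 'b) list \<Rightarrow> 'p set \<Rightarrow> nat" where
  "cidx ws c = (LEAST j. ppre ws j <#\<^bsub>P\<^esub> A = c)"

definition bidx :: "('p \<times> 'b) list \<Rightarrow> 'b \<Rightarrow> nat" where
  "bidx ws b = (LEAST j. bpre ws j = b)"

fun vec :: "('p \<times> 'b) list \<Rightarrow> nat \<Rightarrow> int \<times> int" where
  "vec ws 0 = (1, 0)"
| "vec ws (Suc i) = shear (int (cidx ws (ppre ws (Suc i) <#\<^bsub>P\<^esub> A)))
     (int (bidx ws (bpre ws (Suc i))) - int (bidx ws (bpre ws i))) (vec ws i)"

lemma pairs_map: "ws \<in> pairs \<Longrightarrow> map fst ws \<in> lists (carrier P)" "ws \<in> pairs \<Longrightarrow> map snd ws \<in> lists (carrier B)"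
  by (induction ws) auto

lemma pairs_take: "ws \<in> pairs \<Longrightarrow> take i ws \<in> pairs" "ws \<in> pairs \<Longrightarrow> drop i ws \<in> pairs"
  by (auto simp: in_lists_conv_set dest: in_set_takeD in_set_dropD)

lemma pre_closed: "ws \<in> pairs \<Longrightarrow> ppre ws i \<in> carrier P" "ws \<in> pairs \<Longrightarrow> bpre ws i \<in> carrier B"
  unfolding ppre_def bpre_def
  by (intro P.word_value_closed B.word_value_closed pairs_map pairs_take; assumption)+

lemma pre_split:
  assumes "ws \<in> pairs" "j \<le> i"
  shows "ppre ws i = ppre ws j \<otimes>\<^bsub>P\<^esub> word_value P (map fst (drop j (take i ws)))"
    "bpre ws i = bpre ws j \<otimes>\<^bsub>B\<^esub> word_value B (map snd (drop j (take i ws)))"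
proof -
  have t: "take i ws = take j ws @ drop j (take i ws)"
    using append_take_drop_id[of j "take i ws"] assms(2) by (simp add: min_def)
  have c: "take j ws \<in> pairs" "drop j (take i ws) \<in> pairs" 
    by (rule pairs_take(1)[OF assms(1)], rule pairs_take(2)[OF pairs_take(1)[OF assms(1)]])
  show "ppre ws i = ppre ws j \<otimes>\<^bsub>P\<^esub> word_value P (map fst (drop j (take i ws)))"
    "bpre ws i = bpre ws j \<otimes>\<^bsub>B\<^esub> word_value B (map snd (drop j (take i ws)))"
    unfolding ppre_def bpre_def by (subst t, simp only: map_append P.word_value_append[OF pairs_map(1) pairs_map(1)]
      B.word_value_append[OF pairs_map(2) pairs_map(2)] c)+
qed

lemma pre_Suc:
  assumes "ws \<in> pairs" "i < length ws"
  shows "ppre ws (Suc i) = ppre ws i \<otimes>\<^bsub>P\<^esub> fst (ws ! i)" "bpre ws (Suc i) = bpre ws i \<otimes>\<^bsub>B\<^esub> snd (ws ! i)"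
proof -
  have d: "drop i (take (Suc i) ws) = [ws ! i]" using assms(2) by (simp add: take_Suc_conv_app_nth)
  have "ws ! i \<in> carrier P \<times> carrier B" using assms by (auto simp: in_lists_conv_set)
  then show "ppre ws (Suc i) = ppre ws i \<otimes>\<^bsub>P\<^esub> fst (ws ! i)" "bpre ws (Suc i) = bpre ws i \<otimes>\<^bsub>B\<^esub> snd (ws ! i)"
    using pre_split[OF assms(1), of i "Suc i"] by (auto simp: d)
qed

lemma fold_move_take:
  assumes "ws \<in> pairs" "i \<le> length ws"
  shows "fold (move (\<lambda>c. int (cidx ws c)) (\<lambda>b. int (bidx ws b))) (take i ws) (\<one>\<^bsub>P\<^esub>, \<one>\<^bsub>B\<^esub>, 1, 0) =
    (ppre ws i, bpre ws i, vec ws i)"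
  using assms(2)
proof (induction i)
  case 0
  show ?case by (simp add: ppre_def bpre_def)
next
  case (Suc i)
  then have "i < length ws" by simp
  then show ?case
    using Suc pre_Suc[OF assms(1)] by (simp add: take_Suc_conv_app_nth move_def split_beta)
qed

text \<open>The range may run over all \<open>j\<close>, since beyond the end of the word the prefix
  is the whole word; the plain range is the form that \<open>inj_on_Least\<close> expects.\<close>

lemma cosets_of_subset: "ws \<in> pairs \<Longrightarrow> \<pi> \<in> carrier P \<Longrightarrow> cosets_of \<pi> ws \<subseteq> range (\<lambda>j. \<pi> \<otimes>\<^bsub>P\<^esub> ppre ws j <#\<^bsub>P\<^esub> A)"
proof (induction ws arbitrary: \<pi> rule: list.induct)
  case (Cons c ws)
  obtain p b where c: "c = (p, b)" by (cases c)
  have p: "p \<in> carrier P" and ws: "ws \<in> pairs" using Cons.prems by (auto simp: c)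
  have pre: "ppre (c # ws) (Suc j) = p \<otimes>\<^bsub>P\<^esub> ppre ws j" for j by (simp add: ppre_def c)
  have "\<pi> \<otimes>\<^bsub>P\<^esub> p <#\<^bsub>P\<^esub> A = \<pi> \<otimes>\<^bsub>P\<^esub> ppre (c # ws) (Suc 0) <#\<^bsub>P\<^esub> A"
    using p by (simp add: pre) (simp add: ppre_def)
  then have "\<pi> \<otimes>\<^bsub>P\<^esub> p <#\<^bsub>P\<^esub> A \<in> range (\<lambda>j. \<pi> \<otimes>\<^bsub>P\<^esub> ppre (c # ws) j <#\<^bsub>P\<^esub> A)" by blast
  moreover have "cosets_of (\<pi> \<otimes>\<^bsub>P\<^esub> p) ws \<subseteq> range (\<lambda>j. \<pi> \<otimes>\<^bsub>P\<^esub> ppre (c # ws) j <#\<^bsub>P\<^esub> A)"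
  proof
    fix z assume "z \<in> cosets_of (\<pi> \<otimes>\<^bsub>P\<^esub> p) ws"
    then obtain j where "z = \<pi> \<otimes>\<^bsub>P\<^esub> p \<otimes>\<^bsub>P\<^esub> ppre ws j <#\<^bsub>P\<^esub> A"
      using Cons.IH[OF ws, of "\<pi> \<otimes>\<^bsub>P\<^esub> p"] Cons.prems p by auto
    then have "z = \<pi> \<otimes>\<^bsub>P\<^esub> ppre (c # ws) (Suc j) <#\<^bsub>P\<^esub> A"
      using Cons.prems(2) p pre_closed(1)[OF ws] by (simp add: pre P.m_assoc)
    then show "z \<in> range (\<lambda>j. \<pi> \<otimes>\<^bsub>P\<^esub> ppre (c # ws) j <#\<^bsub>P\<^esub> A)" by blast
  qed
  ultimately show ?case by (simp add: c)
qed simp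

lemma values_of_subset: "ws \<in> pairs \<Longrightarrow> \<beta> \<in> carrier B \<Longrightarrow> values_of \<beta> ws \<subseteq> range (\<lambda>j. \<beta> \<otimes>\<^bsub>B\<^esub> bpre ws j)"
proof (induction ws arbitrary: \<beta> rule: list.induct)
  case Nil
  then show ?case by (auto simp: bpre_def)
next
  case (Cons c ws)
  obtain p b where c: "c = (p, b)" by (cases c)
  have b: "b \<in> carrier B" and ws: "ws \<in> pairs" using Cons.prems by (auto simp: c)
  have pre: "bpre (c # ws) (Suc j) = b \<otimes>\<^bsub>B\<^esub> bpre ws j" for j by (simp add: bpre_def c)
  have "\<beta> = \<beta> \<otimes>\<^bsub>B\<^esub> bpre (c # ws) 0" using Cons.prems(2) by (simp add: bpre_def)
  then have "\<beta> \<in> range (\<lambda>j. \<beta> \<otimes>\<^bsub>B\<^esub> bpre (c # ws) j)" by blast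
  moreover have "values_of (\<beta> \<otimes>\<^bsub>B\<^esub> b) ws \<subseteq> range (\<lambda>j. \<beta> \<otimes>\<^bsub>B\<^esub> bpre (c # ws) j)"
  proof
    fix z assume "z \<in> values_of (\<beta> \<otimes>\<^bsub>B\<^esub> b) ws"
    then obtain j where "z = \<beta> \<otimes>\<^bsub>B\<^esub> b \<otimes>\<^bsub>B\<^esub> bpre ws j"
      using Cons.IH[OF ws, of "\<beta> \<otimes>\<^bsub>B\<^esub> b"] Cons.prems b by auto
    then have "z = \<beta> \<otimes>\<^bsub>B\<^esub> bpre (c # ws) (Suc j)"
      using Cons.prems(2) b pre_closed(2)[OF ws] by (simp add: pre B.m_assoc)
    then show "z \<in> range (\<lambda>j. \<beta> \<otimes>\<^bsub>B\<^esub> bpre (c # ws) j)" by blast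
  qed
  ultimately show ?case by (simp add: c)
qed

lemma inj_on_Least: "inj_on (\<lambda>c. int (LEAST j :: nat. f j = c)) (range f)"
proof (rule inj_onI)
  fix c c' assume c: "c \<in> range f" "c' \<in> range f" and eq: "int (LEAST j. f j = c) = int (LEAST j. f j = c')"
  have "f (LEAST j. f j = c) = c" "f (LEAST j. f j = c') = c'"
    using c by (auto intro: LeastI)
  then show "c = c'" using eq unfolding of_nat_eq_iff by metis
qed

lemma eval_pairs_eq_one_iff_vec:
  assumes ws: "ws \<in> pairs"
  shows "eval_pairs ws = \<one>\<^bsub>Q\<^esub> \<longleftrightarrow> ppre ws (length ws) = \<one>\<^bsub>P\<^esub> \<and> snd (vec ws (length ws)) = 0"
proof (rule eval_pairs_eq_one_iff[OF ws])
  have "cosets_of \<one>\<^bsub>P\<^esub> ws \<subseteq> range (\<lambda>j. ppre ws j <#\<^bsub>P\<^esub> A)"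
    using cosets_of_subset[OF ws P.one_closed] pre_closed(1)[OF ws] by simp
  with inj_on_Least show "inj_on (\<lambda>c. int (cidx ws c)) (cosets_of \<one>\<^bsub>P\<^esub> ws)"
    unfolding cidx_def by (rule inj_on_subset)
  have "values_of \<one>\<^bsub>B\<^esub> ws \<subseteq> range (\<lambda>j. bpre ws j)"
    using values_of_subset[OF ws B.one_closed] pre_closed(2)[OF ws] by simp
  with inj_on_Least show "inj_on (\<lambda>b. int (bidx ws b)) (values_of \<one>\<^bsub>B\<^esub> ws)"
    unfolding bidx_def by (rule inj_on_subset)
  show "fold (move (\<lambda>c. int (cidx ws c)) (\<lambda>b. int (bidx ws b))) ws (\<one>\<^bsub>P\<^esub>, \<one>\<^bsub>B\<^esub>, 1, 0) =
      (ppre ws (length ws), bpre ws (length ws), fst (vec ws (length ws)), snd (vec ws (length ws)))"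
    using fold_move_take[OF ws, of "length ws"] by simp
qed

lemma idx_le: "cidx ws (ppre ws i <#\<^bsub>P\<^esub> A) \<le> i" "bidx ws (bpre ws i) \<le> i"
  unfolding cidx_def bidx_def by (auto intro: Least_le)

lemma vec_bound:
  "i \<le> n \<Longrightarrow> \<bar>fst (vec ws i)\<bar> \<le> ((1 + 2 * int n) ^ 3) ^ i \<and> \<bar>snd (vec ws i)\<bar> \<le> ((1 + 2 * int n) ^ 3) ^ i"
proof (induction i)
  case (Suc i)
  let ?k = "cidx ws (ppre ws (Suc i) <#\<^bsub>P\<^esub> A)" and ?b' = "bidx ws (bpre ws (Suc i))" and ?b = "bidx ws (bpre ws i)"
  have k: "\<bar>int ?k\<bar> \<le> int n" "\<bar>int ?b' - int ?b\<bar> \<le> int n"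
    using idx_le[of ws "Suc i"] idx_le(2)[of ws i] Suc.prems by linarith+
  have "\<bar>fst (vec ws i)\<bar> \<le> ((1 + 2 * int n) ^ 3) ^ i" "\<bar>snd (vec ws i)\<bar> \<le> ((1 + 2 * int n) ^ 3) ^ i"
    using Suc by auto
  from shear_bound[OF k this] show ?case by simp
qed simp

text \<open>The entries are at most \<open>(1 + 2 * n) ^ (3 * n) \<le> 2 ^ (6 * (n * n))\<close>,
  whereas a nonzero multiple of all numbers up to \<open>6 * (n * n) + 2\<close> is at least
  \<open>2 ^ (6 * (n * n) + 1)\<close>.\<close>

lemma snd_vec_eq_0_iff:
  assumes "n = length ws"
  shows "snd (vec ws n) = 0 \<longleftrightarrow> (\<forall>m < 6 * (n * n) + 2. snd (vec ws n) mod int (Suc m) = 0)"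
proof
  assume *: "\<forall>m < 6 * (n * n) + 2. snd (vec ws n) mod int (Suc m) = 0"
  show "snd (vec ws n) = 0"
  proof (rule ccontr)
    assume nz: "snd (vec ws n) \<noteq> 0"
    have "int m dvd snd (vec ws n)" if "1 \<le> m" "m \<le> Suc (6 * (n * n) + 1)" for m
      using *[rule_format, of "m - 1"] that by (simp add: dvd_eq_mod_eq_0)
    from power_le_if_many_divisors[OF this nz]
    have "2 ^ (6 * (n * n) + 1) \<le> \<bar>snd (vec ws n)\<bar>" .
    also have "\<dots> \<le> ((1 + 2 * int n) ^ 3) ^ n" using vec_bound[of n n ws] by simp
    also have "\<dots> \<le> ((2 ^ (2 * n)) ^ 3) ^ n"
    proof (intro power_mono)
      have "2 * n < 2 ^ (2 * n)" by (rule less_exp)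
      then have "1 + 2 * n \<le> 2 ^ (2 * n)" by linarith
      then have "int (1 + 2 * n) \<le> int (2 ^ (2 * n))" by (rule zle_int[THEN iffD2])
      then show "1 + 2 * int n \<le> 2 ^ (2 * n)" by simp
    qed simp_all
    also have "\<dots> = (2 :: int) ^ (6 * (n * n))" by (simp add: mult.assoc flip: power_mult)
    finally show False by simp
  qed
qed simp

text \<open>One \<open>shear\<close> on residues modulo \<open>Suc m\<close>. Since \<open>m\<close>
  is congruent to -1, multiplication by \<open>m\<close> replaces subtraction and the computation
  stays within the natural numbers.\<close>

definition next_y :: "nat \<Rightarrow> nat \<Rightarrow> nat \<Rightarrow> nat \<Rightarrow> nat \<Rightarrow> nat \<Rightarrow> nat" where
  "next_y m k d' d y x = (y + 2 * (d' + m * d) * (x + 2 * k * y)) mod Suc m"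

definition next_x :: "nat \<Rightarrow> nat \<Rightarrow> nat \<Rightarrow> nat \<Rightarrow> nat \<Rightarrow> nat \<Rightarrow> nat" where
  "next_x m k d' d y x = (x + 2 * k * y + m * (2 * k * next_y m k d' d y x)) mod Suc m"

lemma next_shear:
  assumes "int x = fst v mod int (Suc m)" "int y = snd v mod int (Suc m)"
  shows "int (next_y m k d' d y x) = snd (shear (int k) (int d' - int d) v) mod int (Suc m)"
    "int (next_x m k d' d y x) = fst (shear (int k) (int d' - int d) v) mod int (Suc m)"
proof -
  define M where "M = int (Suc m)"
  have m: "int m = M - 1" by (simp add: M_def)
  define t r where "t = snd v div M" and "r = fst v div M"
  have v: "v = (int x + M * r, int y + M * t)"
    using assms by (simp add: t_def r_def M_def prod_eq_iff)
  define x1 where "x1 = int x + 2 * int k * int y"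
  define y1 where "y1 = int y + M * t + 2 * (int d' - int d) * (x1 + M * (r + 2 * int k * t))"
  have sh: "shear (int k) (int d' - int d) v = (x1 + M * (r + 2 * int k * t) - 2 * int k * y1, y1)"
    by (simp add: shear_def v Let_def y1_def x1_def algebra_simps)
  have "int y + 2 * (int d' + int m * int d) * x1 =
      y1 - M * (t + 2 * (int d' - int d) * (r + 2 * int k * t) - 2 * int d * x1)"
    by (simp add: y1_def m algebra_simps)
  then have "(int y + 2 * (int d' + int m * int d) * x1) mod M = y1 mod M"
    by (simp add: mod_eq_dvd_iff)
  then show y: "int (next_y m k d' d y x) = snd (shear (int k) (int d' - int d) v) mod int (Suc m)"
    unfolding next_y_def sh by (simp add: zmod_int x1_def M_def)
  define s where "s = y1 div M"
  have y1: "int (next_y m k d' d y x) = y1 - M * s"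
    using y by (simp add: sh s_def M_def minus_mult_div_eq_mod)
  have "x1 + int m * (2 * int k * int (next_y m k d' d y x)) =
      x1 + M * (r + 2 * int k * t) - 2 * int k * y1 - M * (r + 2 * int k * t - 2 * int k * y1 + 2 * int k * (s * (M - 1)))"
    by (simp add: y1 m algebra_simps)
  then have "(x1 + int m * (2 * int k * int (next_y m k d' d y x))) mod M = (x1 + M * (r + 2 * int k * t) - 2 * int k * y1) mod M"
    by (simp add: mod_eq_dvd_iff)
  then show "int (next_x m k d' d y x) = fst (shear (int k) (int d' - int d) v) mod int (Suc m)"
    unfolding next_x_def sh by (simp add: zmod_int x1_def M_def)
qed

end

context tree_action
begin

text \<open>The coordinates are swapped because \<open>cpt_iter2\<close> returns the first component
  and the test needs \<open>y\<close>. The start \<open>1 mod Suc m\<close> is 0 for modulus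
  1.\<close>

lemma snd_vec_iter2:
  assumes "x0 = 1 mod Suc m"
  shows "case iter2 (\<lambda>j y x. next_y m (cidx ws (ppre ws (Suc j) <#\<^bsub>P\<^esub> A)) (bidx ws (bpre ws (Suc j))) (bidx ws (bpre ws j)) y x)
      (\<lambda>j y x. next_x m (cidx ws (ppre ws (Suc j) <#\<^bsub>P\<^esub> A)) (bidx ws (bpre ws (Suc j))) (bidx ws (bpre ws j)) y x)
      0 x0 i of (y, x) \<Rightarrow>
    int y = snd (vec ws i) mod int (Suc m) \<and> int x = fst (vec ws i) mod int (Suc m)"
proof (induction i)
  case 0
  show ?case by (simp add: assms zmod_int)
next
  case (Suc i)
  then show ?case by (auto simp: next_shear simp del: of_nat_Suc split: prod.splits)
qed

lemma in_logspace_pairs: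
  fixes \<Sigma> :: "('p \<times> 'b) set"
  assumes fin: "finite \<Sigma>" and \<Sigma>: "\<Sigma> \<subseteq> carrier P \<times> carrier B"
    and SP: "sym_gen_set P S\<^sub>P" "in_logspace S\<^sub>P (word_problem P S\<^sub>P)"
    and SB: "sym_gen_set B S\<^sub>B" "in_logspace S\<^sub>B (word_problem B S\<^sub>B)"
    and SM: "sym_gen_set P S\<^sub>M" "in_logspace S\<^sub>M (membership_problem P A S\<^sub>M)"
  shows "in_logspace \<Sigma> {ws \<in> lists \<Sigma>. eval_pairs ws = \<one>\<^bsub>Q\<^esub>}"
proof -
  have subs: "lists S\<^sub>P \<subseteq> lists (carrier P)" "lists S\<^sub>M \<subseteq> lists (carrier P)" "lists S\<^sub>B \<subseteq> lists (carrier B)"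
    using SP(1) SB(1) SM(1) by (auto simp: sym_gen_set_def intro!: lists_mono)
  have fs: "fst c \<in> carrier P" "snd c \<in> carrier B" if "c \<in> \<Sigma>" for c using that \<Sigma> by auto
  \<comment> \<open>Each letter is spelled over each of the three generating sets, so that infixes
    can be handed to the three given machines; the word problem and the membership problem of
    \<open>P\<close> may use different generators.\<close>
  have "\<forall>c \<in> \<Sigma>. \<exists>u. u \<in> lists S\<^sub>P \<and> word_value P u = fst c" using P.sym_gen_word[OF SP(1) fs(1)] by blast
  then obtain hP where hP: "\<And>c. c \<in> \<Sigma> \<Longrightarrow> hP c \<in> lists S\<^sub>P \<and> word_value P (hP c) = fst c" by metis
  have "\<forall>c \<in> \<Sigma>. \<exists>u. u \<in> lists S\<^sub>M \<and> word_value P u = fst c" using P.sym_gen_word[OF SM(1) fs(1)] by blast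
  then obtain hM where hM: "\<And>c. c \<in> \<Sigma> \<Longrightarrow> hM c \<in> lists S\<^sub>M \<and> word_value P (hM c) = fst c" by metis
  have "\<forall>c \<in> \<Sigma>. \<exists>u. u \<in> lists S\<^sub>B \<and> word_value B u = snd c" using B.sym_gen_word[OF SB(1) fs(2)] by blast
  then obtain hB where hB: "\<And>c. c \<in> \<Sigma> \<Longrightarrow> hB c \<in> lists S\<^sub>B \<and> word_value B (hB c) = snd c" by metis
  have hPc: "hP c \<in> lists (carrier P) \<and> word_value P (hP c) = fst c"
    and hMc: "hM c \<in> lists (carrier P) \<and> word_value P (hM c) = fst c" if "c \<in> \<Sigma>" for c
    using hP[OF that] hM[OF that] subs by blast+
  have pairs: "ws \<in> pairs" if "ws \<in> lists \<Sigma>" for ws using that \<Sigma> lists_mono by blast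
  have in\<Sigma>: "c \<in> \<Sigma>" if "ws \<in> lists \<Sigma>" "c \<in> set (drop j (take i ws))" for ws c i j
    using that by (meson in_listsD in_set_dropD in_set_takeD)
  have inl: "infix_image h j i ws \<in> lists S" if "ws \<in> lists \<Sigma>" "\<And>c. c \<in> \<Sigma> \<Longrightarrow> h c \<in> lists S"
    for h :: "'p \<times> 'b \<Rightarrow> 'z list" and S i j ws
    using that(2) in\<Sigma>[OF that(1)] by (fastforce simp: infix_image_def in_lists_conv_set)
  have valP: "word_value P (infix_image h j i ws) = word_value P (map fst (drop j (take i ws)))"
    if "ws \<in> lists \<Sigma>" "\<And>c. c \<in> \<Sigma> \<Longrightarrow> h c \<in> lists (carrier P) \<and> word_value P (h c) = fst c" for h ws i j
    unfolding infix_image_def using in\<Sigma>[OF that(1)] that(2) by (intro P.word_value_concat[THEN conjunct2]) blast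
  have valB: "word_value B (infix_image hB j i ws) = word_value B (map snd (drop j (take i ws)))"
    if "ws \<in> lists \<Sigma>" for ws i j
    unfolding infix_image_def using in\<Sigma>[OF that(1)] hB subs(3) by (intro B.word_value_concat[THEN conjunct2]) blast
  let ?MP = "membership_problem P A S\<^sub>M" and ?WB = "word_problem B S\<^sub>B" and ?WP = "word_problem P S\<^sub>P"
  \<comment> \<open>The infix from \<open>j\<close> to \<open>i\<close> represents the inverse of
    the prefix at \<open>j\<close> times the prefix at \<open>i\<close>. Its membership in
    \<open>A\<close> compares two cosets, and for \<open>cB\<close> its triviality compares two
    values, so first occurrences are found without any prefix being stored.\<close>
  define cM where "cM w i = (LEAST j. infix_image hM j i w \<in> ?MP)" for w i
  define cB where "cB w i = (LEAST j. infix_image hB j i w \<in> ?WB)" for w i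
  have self: "infix_image hM i i w \<in> ?MP" "infix_image hB i i w \<in> ?WB" for i w
    by (simp_all add: infix_image_def membership_problem_def word_problem_def A.one_closed)
  have cM: "cM ws i = cidx ws (ppre ws i <#\<^bsub>P\<^esub> A)" if ws: "ws \<in> lists \<Sigma>" for ws i
    unfolding cM_def cidx_def
  proof (rule Least_eq_bounded[where n = i])
    show "infix_image hM j i ws \<in> ?MP \<longleftrightarrow> ppre ws j <#\<^bsub>P\<^esub> A = ppre ws i <#\<^bsub>P\<^esub> A" if "j \<le> i" for j
    proof -
      let ?z = "word_value P (map fst (drop j (take i ws)))"
      have z: "?z \<in> carrier P"
        using pairs_map(1)[OF pairs_take(2)[OF pairs_take(1)[OF pairs[OF ws]]]] by (rule P.word_value_closed)
      have "infix_image hM j i ws \<in> ?MP \<longleftrightarrow> ?z \<in> A"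
        using valP[OF ws hMc] inl[OF ws hM[THEN conjunct1]] by (simp add: membership_problem_def)
      also have "\<dots> \<longleftrightarrow> ppre ws j <#\<^bsub>P\<^esub> A = ppre ws i <#\<^bsub>P\<^esub> A"
        using pre_split(1)[OF pairs[OF ws] that] lcoset_absorb[OF pre_closed(1)[OF pairs[OF ws]], of ?z j]
          lcoset_neq[OF pre_closed(1)[OF pairs[OF ws]] z, of j] by metis
      finally show ?thesis .
    qed
  qed (use self in auto)
  have cB: "cB ws i = bidx ws (bpre ws i)" if ws: "ws \<in> lists \<Sigma>" for ws i
    unfolding cB_def bidx_def
  proof (rule Least_eq_bounded[where n = i])
    show "infix_image hB j i ws \<in> ?WB \<longleftrightarrow> bpre ws j = bpre ws i" if "j \<le> i" for j
    proof -
      let ?z = "word_value B (map snd (drop j (take i ws)))"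
      have z: "?z \<in> carrier B"
        using pairs_map(2)[OF pairs_take(2)[OF pairs_take(1)[OF pairs[OF ws]]]] by (rule B.word_value_closed)
      have "infix_image hB j i ws \<in> ?WB \<longleftrightarrow> ?z = \<one>\<^bsub>B\<^esub>"
        using valB[OF ws] inl[OF ws hB[THEN conjunct1]] by (simp add: word_problem_def)
      also have "\<dots> \<longleftrightarrow> bpre ws j = bpre ws i"
        using pre_split(2)[OF pairs[OF ws] that] pre_closed(2)[OF pairs[OF ws], of j] z
        by (metis B.l_cancel_one B.r_one)
      finally show ?thesis .
    qed
  qed (use self in auto)
  have cptM: "cpt \<Sigma> (\<lambda>w \<rho>. cM w (\<rho> 0))"
    unfolding cM_def
    by (rule cpt_Least[where n = "\<lambda>w \<rho>. \<rho> 0"])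
      (rule cpt_var cptp_infix[OF fin SM(2) hM[THEN conjunct1]] self | assumption)+
  have cptB: "cpt \<Sigma> (\<lambda>w \<rho>. cB w (\<rho> 0))"
    unfolding cB_def
    by (rule cpt_Least[where n = "\<lambda>w \<rho>. \<rho> 0"])
      (rule cpt_var cptp_infix[OF fin SB(2) hB[THEN conjunct1]] self | assumption)+
  define F where "F = (\<lambda>w m j y x. next_y m (cM w (Suc j)) (cB w (Suc j)) (cB w j) y x)"
  define G where "G = (\<lambda>w m j y x. next_x m (cM w (Suc j)) (cB w (Suc j)) (cB w j) y x)"
  define res where "res w m = fst (iter2 (F w m) (G w m) 0 (1 mod Suc m) (length w))" for w m
  have le: "fst (iter2 (F w m) (G w m) 0 (1 mod Suc m) j) \<le> Suc m \<and> snd (iter2 (F w m) (G w m) 0 (1 mod Suc m) j) \<le> Suc m" for w m j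
    by (cases j) (auto simp: F_def G_def next_y_def next_x_def less_imp_le split: prod.splits)
  have cptF: "cpt \<Sigma> (\<lambda>w \<rho>. F w (\<rho> (0 + 3)) (\<rho> 0) (\<rho> 1) (\<rho> 2))"
    unfolding F_def next_y_def
    by (intro cpt_mod cpt_add cpt_mult cpt_var cpt_const cpt_Suc cpt_fun1[OF cptM] cpt_fun1[OF cptB])
  have cptG: "cpt \<Sigma> (\<lambda>w \<rho>. G w (\<rho> (0 + 3)) (\<rho> 0) (\<rho> 1) (\<rho> 2))"
    unfolding G_def next_x_def next_y_def
    by (intro cpt_mod cpt_add cpt_mult cpt_var cpt_const cpt_Suc cpt_fun1[OF cptM] cpt_fun1[OF cptB])
  have "cpt \<Sigma> (\<lambda>w \<rho>. fst (iter2 (\<lambda>j y x. F w (\<rho> 0) j y x) (\<lambda>j y x. G w (\<rho> 0) j y x) 0 (1 mod Suc (\<rho> 0)) (length w)))"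
    by (rule cpt_iter2[where f = "\<lambda>w j y x \<rho>. F w (\<rho> 0) j y x" and g = "\<lambda>w j y x \<rho>. G w (\<rho> 0) j y x"
          and u = "\<lambda>w \<rho>. Suc (\<rho> 0)", OF cpt_const _ cpt_length[OF fin] cptF cptG])
      (rule cpt_mod cpt_const cpt_Suc_var cpt_poly_bounded le)+
  then have cptR: "cpt \<Sigma> (\<lambda>w \<rho>. res w (\<rho> 0))" unfolding res_def .
  let ?R = "\<lambda>w \<rho>. infix_image hP 0 (length w) w \<in> ?WP \<and> (\<forall>m < 6 * (length w * length w) + 2. res w m = 0)"
  have "cptp \<Sigma> ?R"
    by (intro cptp_conj cptp_all cptp_zero cptR cpt_add cpt_mult cpt_const cpt_length[OF fin]
        cptp_infix[OF fin SP(2)]) (use hP in blast)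
  from cpt_in_logspace[OF fin this[unfolded cptp_def]]
  have "in_logspace \<Sigma> {ws \<in> lists \<Sigma>. ?R ws (\<lambda>_. 0)}" by simp
  moreover have "?R ws (\<lambda>_. 0) \<longleftrightarrow> eval_pairs ws = \<one>\<^bsub>Q\<^esub>" if ws: "ws \<in> lists \<Sigma>" for ws
  proof -
    have res: "int (res ws m) = snd (vec ws (length ws)) mod int (Suc m)" for m
      using snd_vec_iter2[where m = m and ws = ws and i = "length ws", OF HOL.refl] by (auto simp: res_def F_def G_def cM[OF ws] cB[OF ws] split: prod.splits)
    have z: "res ws m = 0 \<longleftrightarrow> snd (vec ws (length ws)) mod int (Suc m) = 0" for m
      unfolding res[symmetric] by simp
    have "(\<forall>m < 6 * (length ws * length ws) + 2. res ws m = 0) \<longleftrightarrow> snd (vec ws (length ws)) = 0"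
      by (subst snd_vec_eq_0_iff[OF HOL.refl]) (simp only: z)
    moreover have "word_value P (infix_image hP 0 (length ws) ws) = ppre ws (length ws)"
      using valP[OF ws hPc] by (simp add: ppre_def)
    then have "infix_image hP 0 (length ws) ws \<in> ?WP \<longleftrightarrow> ppre ws (length ws) = \<one>\<^bsub>P\<^esub>"
      using inl[OF ws hP[THEN conjunct1]] by (simp add: word_problem_def)
    ultimately show ?thesis using eval_pairs_eq_one_iff_vec[OF pairs[OF ws]] by simp
  qed
  then have "{ws \<in> lists \<Sigma>. ?R ws (\<lambda>_. 0)} = {ws \<in> lists \<Sigma>. eval_pairs ws = \<one>\<^bsub>Q\<^esub>}" by blast
  ultimately show ?thesis by simp
qed

text \<open>Shows that \<open>eval_pairs\<close> reaches all of \<open>Q\<close>, so that arbitrary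
  generators can be written as words of pairs.\<close>

lemma eval_letter_pairs: "u \<in> W \<Longrightarrow> map letter_pair u \<in> pairs \<and> eval_pairs (map letter_pair u) = R `` {u}"
proof (induction u)
  case Nil
  then show ?case by (simp add: one_class)
next
  case (Cons e u)
  have u: "u \<in> W" "[e] \<in> W" using Cons.prems by (auto simp: amalg_words_def)
  have "R `` {e # u} = R `` {[e]} \<otimes>\<^bsub>Q\<^esub> R `` {u}" using u by (simp add: mult_class)
  moreover have "eval_pairs [letter_pair e] = R `` {[e]}"
    using u(2) inj2_pair(1) A.mem_carrier
    by (cases e) (auto simp: letter_pair_def inB_one inj1_def[symmetric] inj2_def[symmetric])
  moreover have "[letter_pair e] \<in> pairs" using letter_pair_closed[OF u(2)] by simp
  ultimately show ?case
    using Cons.IH[OF u(1)] eval_pairs_append[of "[letter_pair e]" "map letter_pair u"] by simp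
qed

lemma finitely_generated_Q:
  assumes "sym_gen_set P S\<^sub>P" "sym_gen_set B S\<^sub>B"
  shows "finitely_generated Q"
proof -
  define T where "T = inj1 ` S\<^sub>P \<union> inB ` S\<^sub>B"
  have S: "finite S\<^sub>P" "finite S\<^sub>B" "S\<^sub>P \<subseteq> carrier P" "S\<^sub>B \<subseteq> carrier B"
    using assms by (auto simp: sym_gen_set_def)
  have T: "finite T" "T \<subseteq> carrier Q" using S by (auto simp: T_def)
  have P: "inj1 p \<in> generate Q T" if p: "p \<in> carrier P" for p
  proof -
    obtain u where u: "u \<in> lists S\<^sub>P" "word_value P u = p" using P.sym_gen_word[OF assms(1) p] by blast
    have "inj1 (word_value P u) \<in> generate Q T"
      using u(1)
    proof (induction u)
      case (Cons x u)
      then have "word_value P u \<in> carrier P" using S(3) lists_mono by (intro P.word_value_closed) blast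
      then have "inj1 (word_value P (x # u)) = inj1 x \<otimes>\<^bsub>Q\<^esub> inj1 (word_value P u)"
        using Cons S(3) by (simp add: inj1_mult subset_iff)
      then show ?case using Cons by (auto simp: T_def intro: generate.eng generate.incl)
    qed (simp add: inj1_one generate.one)
    then show ?thesis by (simp add: u(2))
  qed
  have B: "inB b \<in> generate Q T" if b: "b \<in> carrier B" for b
  proof -
    obtain u where u: "u \<in> lists S\<^sub>B" "word_value B u = b" using B.sym_gen_word[OF assms(2) b] by blast
    have "inB (word_value B u) \<in> generate Q T"
      using u(1)
    proof (induction u)
      case (Cons x u)
      then have "word_value B u \<in> carrier B" using S(4) lists_mono by (intro B.word_value_closed) blast
      then have "inB (word_value B (x # u)) = inB x \<otimes>\<^bsub>Q\<^esub> inB (word_value B u)"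
        using Cons S(4) by (simp add: inB_mult subset_iff)
      then show ?case using Cons by (auto simp: T_def intro: generate.eng generate.incl)
    qed (simp add: inB_one generate.one)
    then show ?thesis by (simp add: u(2))
  qed
  have "eval_pairs ws \<in> generate Q T" if "ws \<in> pairs" for ws
    using that by (induction ws rule: eval_pairs.induct) (auto intro: generate.intros P B)
  then have "carrier Q \<subseteq> generate Q T"
    using eval_letter_pairs by (metis carrier_cases subsetI)
  then have "generate Q T = carrier Q" using Q.generate_in_carrier[OF T(2)] by blast
  with T show ?thesis unfolding finitely_generated_def by blast
qed

text \<open>A fixed word of pairs is chosen for each generator. Only finitely many pairs occur, and
  they form the alphabet of a reduction by a homomorphism of words.\<close>

lemma in_logspace_word_problem:
  assumes S: "finite S" "S \<subseteq> carrier Q"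
    and L: "\<And>\<Sigma>. finite \<Sigma> \<Longrightarrow> \<Sigma> \<subseteq> carrier P \<times> carrier B \<Longrightarrow> in_logspace \<Sigma> {ws \<in> lists \<Sigma>. eval_pairs ws = \<one>\<^bsub>Q\<^esub>}"
  shows "in_logspace S (word_problem Q S)"
proof -
  have "\<forall>x \<in> S. \<exists>ws. ws \<in> pairs \<and> eval_pairs ws = x"
  proof
    fix x assume "x \<in> S"
    then have "x \<in> carrier Q" using S(2) by blast
    then obtain u where "u \<in> W" "x = R `` {u}" by (rule carrier_cases)
    then show "\<exists>ws. ws \<in> pairs \<and> eval_pairs ws = x" using eval_letter_pairs[of u] by blast
  qed
  then obtain h where h: "\<And>x. x \<in> S \<Longrightarrow> h x \<in> pairs \<and> eval_pairs (h x) = x" by metis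
  define \<Sigma> where "\<Sigma> = (\<Union>x\<in>S. set (h x))"
  have fin: "finite \<Sigma>" and sub: "\<Sigma> \<subseteq> carrier P \<times> carrier B"
    using S(1) h by (auto simp: \<Sigma>_def in_lists_conv_set)
  have hl: "h x \<in> lists \<Sigma>" if "x \<in> S" for x using that by (auto simp: \<Sigma>_def)
  have ev: "concat (map h u) \<in> lists \<Sigma> \<and> concat (map h u) \<in> pairs \<and> eval_pairs (concat (map h u)) = word_value Q u"
    if "u \<in> lists S" for u
    using that
  proof (induction u)
    case (Cons x u)
    then show ?case using h[of x] hl[of x] by (simp add: eval_pairs_append)
  qed simp
  have "word_problem Q S = {u \<in> lists S. concat (map h u) \<in> {ws \<in> lists \<Sigma>. eval_pairs ws = \<one>\<^bsub>Q\<^esub>}}"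
    unfolding word_problem_def
  proof (rule Collect_cong)
    show "u \<in> lists S \<and> word_value Q u = \<one>\<^bsub>Q\<^esub> \<longleftrightarrow>
        u \<in> lists S \<and> concat (map h u) \<in> {ws \<in> lists \<Sigma>. eval_pairs ws = \<one>\<^bsub>Q\<^esub>}" for u
    proof (cases "u \<in> lists S")
      case True
      from ev[OF this] show ?thesis using True by simp
    qed simp
  qed
  then show ?thesis using in_logspace_inverse_hom[OF S(1) L[OF fin sub] hl] by simp
qed

end

text \<open>Each hypothesis on complexity is about one generating set, the conclusion about every
  symmetric generating set of \<open>G\<close>. Finite generation of \<open>G\<close> is asserted
  too, so that this quantifier is not vacuous.\<close>

theorem theorem1:
  fixes P :: "('p, 'm) monoid_scheme" and B :: "('b, 'n) monoid_scheme"
    and A S\<^sub>P S\<^sub>M :: "'p set" and S\<^sub>B :: "'b set"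
  assumes "group P" and "group B" and "subgroup A P"
    and "finitely_generated P" and "finitely_generated B"
    and "finitely_generated (P\<lparr>carrier := A\<rparr>)"
    and "sym_gen_set P S\<^sub>P" and "in_logspace S\<^sub>P (word_problem P S\<^sub>P)"
    and "sym_gen_set B S\<^sub>B" and "in_logspace S\<^sub>B (word_problem B S\<^sub>B)"
    and "sym_gen_set P S\<^sub>M" and "in_logspace S\<^sub>M (membership_problem P A S\<^sub>M)"
  shows "finitely_generated (amalg_direct P A B) \<and>
    (\<forall>S. sym_gen_set (amalg_direct P A B) S \<longrightarrow>
       in_logspace S (word_problem (amalg_direct P A B) S))"
proof -
  interpret tree_action P B A
    using assms(1-3) by (simp add: tree_action_def)
  have "in_logspace S (word_problem Q S)" if "sym_gen_set Q S" for S
    using that assms(7-12)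
    by (intro in_logspace_word_problem in_logspace_pairs) (auto simp: sym_gen_set_def)
  then show ?thesis
    using finitely_generated_Q[OF assms(7,9)] unfolding amalg_direct_def by blast
qed

end
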